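(* Let $E$ be a rearrangement invariant Banach function space on $\mathbb{R}^n$. Let $0<q_0,q_1<\infty$ with $q_0\neq q_1$, $0<q<\infty$, $0<\theta<1$, $b_j\in SV_{0,q_j}$ for $j=0,1$, and $b\in SV$. For $t>0$ put $$\rho(t)=\frac{\|u^{-1/q_0}b_0(u)\|_{q_0,(t,\infty)}}{\|u^{-1/q_1}b_1(u)\|_{q_1,(t,\infty)}},\qquad \rho_\epsilon(t)=\frac{\|u^{-1/q_0}b_0(u)\|_{q_0,(t,\infty)}^{1+\epsilon}}{\|u^{-1/q_1}b_1(u)\|_{q_1,(t,\infty)}}\quad(\epsilon>0).$$ Assume that $\rho_\epsilon$ is equivalent to a non-decreasing function for some $\epsilon>0$, and that $\rho$ is increasing with $\lim_{t\to0^+}\rho(t)=0$ and $\lim_{t\to\infty}\rho(t)=\infty$. Then $$\left(B^{0,b_0}_{E,q_0},B^{0,b_1}_{E,q_1}\right)_{\theta,q;b}=B^{0,\tilde b}_{E,q}$$ (with equivalence of semi-quasi-norms), where $$\tilde b(t)=[\rho(t)]^{1-\theta}\,b(\rho(t))\,[b_1(t)]^{q_1/q}\left(\int_t^\infty b_1^{q_1}(u)\frac{du}{u}\right)^{1/q_1-1/q}.$$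
   Context: Notation: $\|\cdot\|_{q,(a,b)}$ is the $L^q$-quasi-norm on $(a,b)$ with respect to Lebesgue measure ($1/q=0$ if $q=\infty$). $A\lesssim B$ means $A\le cB$ with a positive constant $c$ independent of the appropriate parameters; $A\approx B$ means $A\lesssim B$ and $B\lesssim A$. A positive function $g$ on $(0,\infty)$ is equivalent to a function $h$ if $g(t)\approx h(t)$ for all $t>0$. Slowly varying functions: a Lebesgue measurable $b:(0,\infty)\to(0,\infty)$ is slowly varying, $b\in SV$, if for every $\varepsilon>0$ there are positive functions $g_\varepsilon$ (non-decreasing) and $g_{-\varepsilon}$ (non-increasing) on $(0,\infty)$ with $t^{\varepsilon}b(t)\approx g_\varepsilon(t)$ and $t^{-\varepsilon}b(t)\approx g_{-\varepsilon}(t)$ for all $t>0$. For $0<q\le\infty$, $b\in SV_{0,q}$ means $b\in SV$ and $\|u^{-1/q}b(u)\|_{q,(1,\infty)}<\infty$. Interpolation: for a compatible couple $(A_0,A_1)$ of (semi-)quasi-normed spaces, $f\in A_0+A_1$, $t>0$, $K(t,f;A_0,A_1)=\inf\{\|f_0\|_{A_0}+t\|f_1\|_{A_1}: f_0\in A_0,\ f_1\in A_1,\ f=f_0+f_1\}$, and for $0<q\le\infty$, $0\le\theta\le1$, $b\in SV$, $(A_0,A_1)_{\theta,q;b}$ is the space of $f\in A_0+A_1$ with $\|t^{-\theta-1/q}b(t)K(t,f;A_0,A_1)\|_{q,(0,\infty)}<\infty$, equipped with this (semi-)quasi-norm. Homogeneous Besov spaces: for $f\in E$ let $\omega_E(f,t)=\sup_{|h|\le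 t}\|\Delta_hf\|_E$ be the modulus of continuity, where $\Delta_hf(x)=f(x+h)-f(x)$. For $0<q\le\infty$ and $b\in SV_{0,q}$, $B^{0,b}_{E,q}$ consists of those $f\in E$ for which the semi-quasi-norm $\|f\|_{B^{0,b}_{E,q}}=\|t^{-1/q}b(t)\,\omega_E(f,t)\|_{q,(0,\infty)}$ is finite. *)

theory Defs
  imports "HOL-Analysis.Analysis"
begin

text \<open>
  Real powers of extended nonnegative numbers, used with positive exponents only.
\<close>
definition epowr :: "ennreal \<Rightarrow> real \<Rightarrow> ennreal" where
  "epowr x p = (if x = top then top else ennreal (enn2real x powr p))"

text \<open>
  The \<open>L\<^sup>q\<close> quasi-norm over a set \<open>A\<close> for a finite exponent \<open>q > 0\<close>. Functions have values
  in \<open>[0, \<infinity>]\<close>, so that moduli of continuity and K-functionals can be inserted directly.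
\<close>
definition Lq_norm :: "real \<Rightarrow> real set \<Rightarrow> (real \<Rightarrow> ennreal) \<Rightarrow> ennreal" where
  "Lq_norm q A g = epowr (\<integral>\<^sup>+ t \<in> A. epowr (g t) q \<partial>lebesgue) (1 / q)"


section \<open>Slowly varying functions\<close>

text \<open>
  \<open>g \<approx> h\<close> on \<open>(0, \<infinity>)\<close>. Functions on \<open>(0, \<infinity>)\<close> are represented by total functions whose
  values outside \<open>(0, \<infinity>)\<close> are irrelevant.
\<close>
definition equiv_pos :: "(real \<Rightarrow> real) \<Rightarrow> (real \<Rightarrow> real) \<Rightarrow> bool" where
  "equiv_pos g h \<longleftrightarrow>
     (\<exists>c>0. \<forall>t>0. g t \<le> c * h t) \<and> (\<exists>c>0. \<forall>t>0. h t \<le> c * g t)"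

definition SV :: "(real \<Rightarrow> real) set" where
  "SV = {b. b \<in> borel_measurable (lebesgue_on {0<..}) \<and> (\<forall>t>0. b t > 0) \<and>
     (\<forall>\<epsilon>>0.
        (\<exists>g. (\<forall>t>0. g t > 0) \<and> mono_on {0<..} g \<and> equiv_pos (\<lambda>t. t powr \<epsilon> * b t) g) \<and>
        (\<exists>g. (\<forall>t>0. g t > 0) \<and> antimono_on {0<..} g \<and> equiv_pos (\<lambda>t. t powr (- \<epsilon>) * b t) g))}"

text \<open>\<open>tail_norm q b t\<close> is the quasi-norm of \<open>u\<^sup>-\<^sup>1\<^sup>/\<^sup>q b(u)\<close> in \<open>L\<^sup>q(t, \<infinity>)\<close>.\<close>
definition tail_norm :: "real \<Rightarrow> (real \<Rightarrow> real) \<Rightarrow> real \<Rightarrow> ennreal" where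
  "tail_norm q b t = Lq_norm q {t<..} (\<lambda>u. ennreal (u powr (- 1 / q) * b u))"

definition SV0 :: "real \<Rightarrow> (real \<Rightarrow> real) set" where
  "SV0 q = {b \<in> SV. tail_norm q b 1 < top}"


section \<open>Rearrangement invariant Banach function spaces\<close>

text \<open>Banach function norms in the sense of Bennett and Sharpley.\<close>
definition banach_function_norm :: "'x measure \<Rightarrow> (('x \<Rightarrow> ennreal) \<Rightarrow> ennreal) \<Rightarrow> bool" where
  "banach_function_norm M N \<longleftrightarrow>
     (\<forall>f \<in> borel_measurable M. N f = 0 \<longleftrightarrow> (AE x in M. f x = 0)) \<and>
     (\<forall>f \<in> borel_measurable M. \<forall>a\<ge>0. N (\<lambda>x. ennreal a * f x) = ennreal a * N f) \<and>
     (\<forall>f \<in> borel_measurable M. \<forall>g \<in> borel_measurable M. N (\<lambda>x. f x + g x) \<le> N f + N g) \<and>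
     (\<forall>f \<in> borel_measurable M. \<forall>g \<in> borel_measurable M.
        (AE x in M. g x \<le> f x) \<longrightarrow> N g \<le> N f) \<and>
     (\<forall>F. \<forall>f \<in> borel_measurable M. (\<forall>m::nat. F m \<in> borel_measurable M) \<longrightarrow>
        (AE x in M. incseq (\<lambda>m. F m x) \<and> (\<lambda>m. F m x) \<longlonglongrightarrow> f x) \<longrightarrow>
        (\<lambda>m. N (F m)) \<longlonglongrightarrow> N f) \<and>
     (\<forall>A \<in> sets M. emeasure M A < top \<longrightarrow> N (indicator A) < top) \<and>
     (\<forall>A \<in> sets M. emeasure M A < top \<longrightarrow>
        (\<exists>C\<ge>0. \<forall>f \<in> borel_measurable M. (\<integral>\<^sup>+ x \<in> A. f x \<partial>M) \<le> ennreal C * N f))"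

definition equimeasurable :: "'x measure \<Rightarrow> ('x \<Rightarrow> ennreal) \<Rightarrow> ('x \<Rightarrow> ennreal) \<Rightarrow> bool" where
  "equimeasurable M f g \<longleftrightarrow>
     (\<forall>s::real. s \<ge> 0 \<longrightarrow>
        emeasure M {x \<in> space M. f x > ennreal s} = emeasure M {x \<in> space M. g x > ennreal s})"

definition ri_norm :: "'x measure \<Rightarrow> (('x \<Rightarrow> ennreal) \<Rightarrow> ennreal) \<Rightarrow> bool" where
  "ri_norm M N \<longleftrightarrow> banach_function_norm M N \<and>
     (\<forall>f \<in> borel_measurable M. \<forall>g \<in> borel_measurable M.
        (AE x in M. f x < top) \<longrightarrow> (AE x in M. g x < top) \<longrightarrow>
        equimeasurable M f g \<longrightarrow> N f = N g)"

text \<open>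
  A space with a semi-quasi-norm is a pair of its carrier and its \<open>[0, \<infinity>]\<close>-valued
  semi-quasi-norm. Elements are functions rather than classes modulo null functions: all carriers
  and semi-quasi-norms built from a Banach function norm are invariant under changes on null
  sets. The class constraint on the scalars covers exactly the real and the complex case.
\<close>
type_synonym ('x, 's) qspace = "('x \<Rightarrow> 's) set \<times> (('x \<Rightarrow> 's) \<Rightarrow> ennreal)"

definition bfs ::
  "'x measure \<Rightarrow> (('x \<Rightarrow> ennreal) \<Rightarrow> ennreal) \<Rightarrow> ('x, 's::{real_normed_field, euclidean_space}) qspace"
  where
  "bfs M N =
     ({f \<in> borel_measurable M. N (\<lambda>x. ennreal (norm (f x))) < top}, \<lambda>f. N (\<lambda>x. ennreal (norm (f x))))"

definition ri_bfs ::
  "(real ^ 'n, 's::{real_normed_field, euclidean_space}) qspace \<Rightarrow> bool" where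
  "ri_bfs E \<longleftrightarrow> (\<exists>N. ri_norm lebesgue N \<and> E = bfs lebesgue N)"


section \<open>Interpolation spaces\<close>

definition sum_space :: "('x \<Rightarrow> 's::plus) set \<Rightarrow> ('x \<Rightarrow> 's) set \<Rightarrow> ('x \<Rightarrow> 's) set" where
  "sum_space A B = {f. \<exists>f0 \<in> A. \<exists>f1 \<in> B. f = (\<lambda>x. f0 x + f1 x)}"

definition K_functional ::
  "('x, 's::plus) qspace \<Rightarrow> ('x, 's) qspace \<Rightarrow> real \<Rightarrow> ('x \<Rightarrow> 's) \<Rightarrow> ennreal" where
  "K_functional A0 A1 t f =
     Inf {snd A0 f0 + ennreal t * snd A1 f1 | f0 f1.
            f0 \<in> fst A0 \<and> f1 \<in> fst A1 \<and> f = (\<lambda>x. f0 x + f1 x)}"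

definition interp_norm ::
  "('x, 's::plus) qspace \<Rightarrow> ('x, 's) qspace \<Rightarrow> real \<Rightarrow> real \<Rightarrow> (real \<Rightarrow> real) \<Rightarrow> ('x \<Rightarrow> 's) \<Rightarrow> ennreal"
  where
  "interp_norm A0 A1 \<theta> q b f =
     Lq_norm q {0<..} (\<lambda>t. ennreal (t powr (- \<theta> - 1 / q) * b t) * K_functional A0 A1 t f)"

definition interp ::
  "('x, 's::plus) qspace \<Rightarrow> ('x, 's) qspace \<Rightarrow> real \<Rightarrow> real \<Rightarrow> (real \<Rightarrow> real) \<Rightarrow> ('x, 's) qspace"
  where
  "interp A0 A1 \<theta> q b =
     ({f \<in> sum_space (fst A0) (fst A1). interp_norm A0 A1 \<theta> q b f < top}, interp_norm A0 A1 \<theta> q b)"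

text \<open>Equality of spaces with equivalence of their semi-quasi-norms.\<close>
definition same_space :: "('x, 's) qspace \<Rightarrow> ('x, 's) qspace \<Rightarrow> bool" where
  "same_space X Y \<longleftrightarrow> fst X = fst Y \<and>
     (\<exists>c>0. \<forall>f \<in> fst X. snd X f \<le> ennreal c * snd Y f) \<and>
     (\<exists>c>0. \<forall>f \<in> fst X. snd Y f \<le> ennreal c * snd X f)"


section \<open>Homogeneous Besov spaces\<close>

definition modulus :: "('x::real_normed_vector, 's::minus) qspace \<Rightarrow> ('x \<Rightarrow> 's) \<Rightarrow> real \<Rightarrow> ennreal"
  where
  "modulus E f t = (SUP h \<in> {h. norm h \<le> t}. snd E (\<lambda>x. f (x + h) - f x))"

definition besov_norm ::
  "('x::real_normed_vector, 's::minus) qspace \<Rightarrow> real \<Rightarrow> (real \<Rightarrow> real) \<Rightarrow> ('x \<Rightarrow> 's) \<Rightarrow> ennreal" where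
  "besov_norm E q b f = Lq_norm q {0<..} (\<lambda>t. ennreal (t powr (- 1 / q) * b t) * modulus E f t)"

definition besov ::
  "('x::real_normed_vector, 's::minus) qspace \<Rightarrow> real \<Rightarrow> (real \<Rightarrow> real) \<Rightarrow> ('x, 's) qspace" where
  "besov E q b = ({f \<in> fst E. besov_norm E q b f < top}, besov_norm E q b)"

end

theory Submission
  imports Defs "HOL-Probability.Probability_Measure"
begin

text \<open>
  The Besov quasi-norms of \<open>f\<close> depend only on its modulus of continuity \<open>\<omega>\<close>, and the theorem comes
  down to an inequality between numerical sequences. Write \<open>T\<^sub>0\<close>, \<open>T\<^sub>1\<close> for the tail
  quasi-norms of the two weights, so that \<open>\<rho> = T\<^sub>0 / T\<^sub>1\<close>, let \<open>t\<^sub>k\<close> be the point with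
  \<open>\<rho>(t\<^sub>k) = 2\<^sup>k\<close> for an integer \<open>k\<close>, and put \<open>a\<^sub>k = T\<^sub>0(t\<^sub>k) \<omega>(t\<^sub>k)\<close> and
  \<open>W\<^sub>k = 2\<^sup>-\<^sup>k\<^sup>\<theta> b(2\<^sup>k)\<close>.

  Both quasi-norms in question are equivalent to weighted \<open>l\<^sup>q\<close> quasi-norms. The interpolation
  quasi-norm is equivalent to that of \<open>W\<^sub>k K(2\<^sup>k)\<close>, because \<open>b\<close> is slowly varying and the K-functional
  is monotone (\<open>interp_discrete\<close>). The Besov quasi-norm with weight \<open>bt\<close> is equivalent to that of
  \<open>W\<^sub>k a\<^sub>k\<close> (\<open>besov_discrete\<close>): the weight is built so that its \<open>q\<close>-th power with respect to
  \<open>dt / t\<close> is \<open>(\<rho>\<^sup>-\<^sup>\<theta> b(\<rho>) T\<^sub>0)\<^sup>q\<close> times a multiple of \<open>- d log T\<^sub>1\<close>, and the latter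
  measure gives each interval from \<open>t\<^sub>k\<close> to \<open>t\<^sub>k\<^sub>+\<^sub>1\<close> a mass comparable to 1. Indeed \<open>T\<^sub>1\<close> drops at
  least by the factor 2 there, since \<open>T\<^sub>0\<close> decreases while \<open>\<rho>\<close> doubles, and it drops at most
  by a constant factor because of the hypothesis on \<open>\<rho>\<^sub>\<epsilon>\<close> (\<open>tail_doubling\<close>).

  It remains to compare \<open>K(2\<^sup>k)\<close> with \<open>a\<^sub>k\<close>. The inequality \<open>a\<^sub>k \<le> K(2\<^sup>k)\<close> is immediate
  (\<open>K_lower\<close>). For an upper bound, \<open>f\<close> is split into its mean over cubes of size about \<open>t\<^sub>k\<close>
  and the remainder (\<open>smoothing_decomposition\<close>). This gives \<open>K_upper\<close>, which bounds \<open>K(2\<^sup>k)\<close>, up to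
  a constant, by the quasi-norm with exponent \<open>q0\<close> of the \<open>a\<^sub>j\<close> with \<open>j \<le> k\<close> plus \<open>2\<^sup>k\<close>
  times the quasi-norm with exponent \<open>q1\<close> of the \<open>2\<^sup>-\<^sup>j a\<^sub>j\<close> with \<open>j \<ge> k\<close>. Since \<open>0 < \<theta> < 1\<close>, the
  weights change geometrically along both sums, and Hardy's inequality (\<open>weighted_hardy\<close>) bounds the
  weighted quasi-norm of \<open>K(2\<^sup>k)\<close> by that of \<open>a\<^sub>k\<close>.

  Averaging in the function space rests on Minkowski's integral inequality for its norm (\<open>minkowski\<close>). An
  integral mean is the limit almost everywhere of finite means, chosen greedily (\<open>greedy_sample\<close>), and the
  norm has the Fatou property; no duality is involved.
\<close>

section \<open>Powers of extended nonnegative numbers\<close>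

lemma epowr_ennreal: "0 \<le> x \<Longrightarrow> epowr (ennreal x) p = ennreal (x powr p)"
  by (simp add: epowr_def)

lemma epowr_top [simp]: "epowr top p = top"
  by (simp add: epowr_def)

lemma epowr_zero [simp]: "epowr 0 p = 0"
  by (simp add: epowr_def)

lemma epowr_one_right [simp]: "epowr x 1 = x"
  by (cases x) (auto simp: epowr_ennreal)

lemma epowr_eq_top_iff [simp]: "epowr x p = top \<longleftrightarrow> x = top"
  by (simp add: epowr_def)

lemma epowr_less_top_iff [simp]: "epowr x p < top \<longleftrightarrow> x < top"
  by (simp add: less_top[symmetric])

lemma epowr_mono: "x \<le> y \<Longrightarrow> 0 \<le> p \<Longrightarrow> epowr x p \<le> epowr y p"
  by (cases x; cases y) (auto simp: epowr_ennreal powr_mono2 top_unique)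

lemma epowr_epowr: "epowr (epowr x p) q = epowr x (p * q)"
  by (cases x) (auto simp: epowr_ennreal powr_powr)

lemma epowr_le_iff: "0 < p \<Longrightarrow> epowr x p \<le> epowr y p \<longleftrightarrow> x \<le> y"
  using epowr_mono[of x y p] epowr_mono[of "epowr x p" "epowr y p" "1/p"]
  by (auto simp: epowr_epowr)

lemma epowr_mult: "0 < p \<Longrightarrow> epowr (x * y) p = epowr x p * epowr y p"
  by (cases x; cases y)
    (auto simp: epowr_ennreal powr_mult ennreal_mult[symmetric] ennreal_mult_top ennreal_top_mult)

text \<open>
  The bound \<open>x + y \<le> 2 * max x y\<close> treats exponents below and above 1 alike.
\<close>
lemma epowr_add_le:
  assumes "0 < p"
  shows "epowr (x + y) p \<le> ennreal (2 powr p) * (epowr x p + epowr y p)"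
proof -
  have "epowr (x + y) p \<le> epowr (2 * max x y) p"
    using assms by (intro epowr_mono) (auto simp: mult_2 max_def intro: add_mono)
  also have "\<dots> = ennreal (2 powr p) * epowr (max x y) p"
    using assms epowr_ennreal[of 2 p] by (simp add: epowr_mult)
  also have "\<dots> \<le> ennreal (2 powr p) * (epowr x p + epowr y p)"
    by (intro mult_left_mono) (auto simp: max_def)
  finally show ?thesis .
qed

lemma borel_measurable_epowr [measurable]: "(\<lambda>x. epowr x p) \<in> borel_measurable borel"
  unfolding epowr_def by measurable

lemma epowr_Lq_norm:
  "0 < q \<Longrightarrow> epowr (Lq_norm q A g) q = (\<integral>\<^sup>+ t \<in> A. epowr (g t) q \<partial>lebesgue)"
  by (simp add: Lq_norm_def epowr_epowr)

section \<open>Minkowski's integral inequality for Banach function norms\<close>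

text \<open>
  A random \<open>y\<close> works: the cross term of the square has mean zero because \<open>G (x, y)\<close> minus its
  mean over \<open>y\<close> does, and the variance of \<open>G (x, y)\<close> is at most \<open>m\<^sup>2\<close>. Hence the
  inequality holds for the mean over \<open>y\<close> of its left-hand side, and it cannot fail for almost all \<open>y\<close>.
\<close>
lemma greedy_step:
  fixes G :: "'x \<times> 'y \<Rightarrow> real" and S :: "'x \<Rightarrow> real"
  assumes "finite_measure M" and "prob_space P"
    and G [measurable]: "G \<in> borel_measurable (M \<Otimes>\<^sub>M P)" and bound: "\<And>z. \<bar>G z\<bar> \<le> m"
    and S [measurable]: "S \<in> borel_measurable M" and Sb: "\<And>x. x \<in> space M \<Longrightarrow> \<bar>S x\<bar> \<le> L"
    and Y: "AE y in P. R y"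
  shows "\<exists>y\<in>space P. R y \<and> (\<integral>x. (S x + (G (x, y) - (\<integral>v. G (x, v) \<partial>P)))\<^sup>2 \<partial>M)
           \<le> (\<integral>x. (S x)\<^sup>2 \<partial>M) + m\<^sup>2 * measure M (space M)"
proof (rule ccontr)
  assume neg: "\<not> ?thesis"
  interpret M: finite_measure M by fact
  interpret P: prob_space P by fact
  interpret MP: pair_sigma_finite M P ..
  interpret MPf: finite_measure "M \<Otimes>\<^sub>M P"
    by (rule finite_measure_pair_measure) unfold_locales
  define F where "F x = (\<integral>v. G (x, v) \<partial>P)" for x
  define c where "c = (\<integral>x. (S x)\<^sup>2 \<partial>M) + m\<^sup>2 * measure M (space M)"
  \<comment> \<open>the integrand, whose double integral is computed in both orders\<close>
  define H where "H = (\<lambda>(x, y). (S x + (G (x, y) - F x))\<^sup>2)"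
  have m0: "0 \<le> m" using bound[of undefined] by linarith
  have Fm [measurable]: "F \<in> borel_measurable M" unfolding F_def by measurable
  have iG: "integrable P (\<lambda>y. G (x, y))" if "x \<in> space M" for x
    using that bound by (intro P.integrable_const_bound[where B=m]) auto
  have iG2: "integrable P (\<lambda>y. (G (x, y))\<^sup>2)" if "x \<in> space M" for x
    using that bound by (intro P.integrable_const_bound[where B="m\<^sup>2"]) (auto simp: abs_le_square_iff[symmetric] m0)
  have Fb: "\<bar>F x\<bar> \<le> m" if "x \<in> space M" for x
  proof -
    have "F x \<le> m" unfolding F_def using iG[OF that] bound
      by (intro P.integral_le_const) (auto simp: abs_le_iff)
    moreover have "- m \<le> F x" unfolding F_def using iG[OF that] bound
      by (intro P.integral_ge_const) (auto simp: abs_le_iff intro!: AE_I2, metis minus_le_iff)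
    ultimately show ?thesis by (simp add: abs_le_iff)
  qed
  have Hb: "\<bar>H (x, y)\<bar> \<le> (L + 2 * m)\<^sup>2" if "x \<in> space M" for x y
  proof -
    have "\<bar>S x + (G (x, y) - F x)\<bar> \<le> L + 2 * m"
      using Fb[OF that] bound[of "(x, y)"] Sb[OF that] by linarith
    then show ?thesis unfolding H_def by (simp add: abs_le_square_iff[symmetric])
  qed
  have iH: "integrable (M \<Otimes>\<^sub>M P) H"
    using Hb by (intro MPf.integrable_const_bound[where B="(L + 2 * m)\<^sup>2"])
      (auto simp: H_def space_pair_measure)
  have inner: "(\<integral>y. H (x, y) \<partial>P) \<le> (S x)\<^sup>2 + m\<^sup>2" if x: "x \<in> space M" for x
  proof -
    have "(\<integral>y. H (x, y) \<partial>P) = (\<integral>y. (S x - F x)\<^sup>2 + 2 * (S x - F x) * G (x, y) + (G (x, y))\<^sup>2 \<partial>P)"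
      unfolding H_def by (intro Bochner_Integration.integral_cong) (auto simp: power2_eq_square algebra_simps)
    also have "\<dots> = (S x - F x)\<^sup>2 + 2 * (S x - F x) * F x + (\<integral>y. (G (x, y))\<^sup>2 \<partial>P)"
      using iG[OF x] iG2[OF x] by (simp add: F_def P.prob_space)
    also have "(\<integral>y. (G (x, y))\<^sup>2 \<partial>P) \<le> m\<^sup>2"
      using iG2[OF x] bound by (intro P.integral_le_const) (auto simp: abs_le_square_iff[symmetric] m0)
    also have "(S x - F x)\<^sup>2 + 2 * (S x - F x) * F x + m\<^sup>2 \<le> (S x)\<^sup>2 + m\<^sup>2"
      by (simp add: power2_eq_square algebra_simps)
    finally show ?thesis by simp
  qed
  have "(\<integral>y. (\<integral>x. H (x, y) \<partial>M) \<partial>P) = (\<integral>x. (\<integral>y. H (x, y) \<partial>P) \<partial>M)"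
    using MP.Fubini_integral[of "\<lambda>x y. H (x, y)"] iH by simp
  also have "\<dots> \<le> (\<integral>x. (S x)\<^sup>2 + m\<^sup>2 \<partial>M)"
    using inner MP.integrable_fst'[OF iH] Sb
    by (intro integral_mono Bochner_Integration.integrable_add)
      (auto intro!: M.integrable_const_bound[where B="L\<^sup>2"] simp: abs_le_square_iff[symmetric] order_trans[OF Sb abs_ge_self])
  also have "\<dots> = c"
    using Sb unfolding c_def
    by (subst Bochner_Integration.integral_add)
      (auto intro!: M.integrable_const_bound[where B="L\<^sup>2"] simp: abs_le_square_iff[symmetric] order_trans[OF Sb abs_ge_self])
  finally have le: "(\<integral>y. (\<integral>x. H (x, y) \<partial>M) \<partial>P) \<le> c" .
  have "AE y in P. (\<integral>x. H (x, y) \<partial>M) > c"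
    using Y AE_space by eventually_elim (use neg in \<open>auto simp: c_def H_def F_def not_le\<close>)
  moreover have "integrable P (\<lambda>y. \<integral>x. H (x, y) \<partial>M)"
    using MP.integrable_snd[of "\<lambda>x y. H (x, y)"] iH by simp
  ultimately have "(\<integral>y. - (\<integral>x. H (x, y) \<partial>M) \<partial>P) < - c"
    by (intro P.expectation_less) auto
  with le show False by simp
qed

text \<open>
  After \<open>k\<close> greedy choices the squared \<open>L\<^sup>2\<close> norm of the sum of the deviations from the mean has
  grown only linearly in \<open>k\<close>, so the averages of \<open>G (x, y)\<close> over the chosen points approach the mean at the rate \<open>1 / sqrt k\<close>. This
  replaces the law of large numbers.
\<close>
lemma greedy_sample:
  fixes G :: "'x \<times> 'y \<Rightarrow> real"
  assumes "finite_measure M" and "prob_space P"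
    and G [measurable]: "G \<in> borel_measurable (M \<Otimes>\<^sub>M P)" and bound: "\<And>z. \<bar>G z\<bar> \<le> m"
    and Y: "AE y in P. R y"
  shows "\<exists>ys. length ys = k \<and> (\<forall>y\<in>set ys. y \<in> space P \<and> R y) \<and>
           (\<integral>x. (\<Sum>y\<leftarrow>ys. G (x, y) - (\<integral>v. G (x, v) \<partial>P))\<^sup>2 \<partial>M)
             \<le> real k * (m\<^sup>2 * measure M (space M))"
proof (induction k)
  case 0
  show ?case by simp
next
  case (Suc k)
  interpret P: prob_space P by fact
  define F where "F x = (\<integral>v. G (x, v) \<partial>P)" for x
  have Fm [measurable]: "F \<in> borel_measurable M" unfolding F_def by measurable
  have Fb: "\<bar>F x\<bar> \<le> m" if "x \<in> space M" for x
  proof -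
    have "integrable P (\<lambda>y. G (x, y))"
      using that bound by (intro P.integrable_const_bound[where B=m]) auto
    then have "\<bar>F x\<bar> \<le> (\<integral>y. \<bar>G (x, y)\<bar> \<partial>P)"
      unfolding F_def by (intro integral_abs_bound)
    also have "\<dots> \<le> m"
      using \<open>integrable P _\<close> bound by (intro P.integral_le_const) auto
    finally show ?thesis .
  qed
  obtain ys where ys: "length ys = k" "\<forall>y\<in>set ys. y \<in> space P \<and> R y"
    "(\<integral>x. (\<Sum>y\<leftarrow>ys. G (x, y) - F x)\<^sup>2 \<partial>M) \<le> real k * (m\<^sup>2 * measure M (space M))"
    using Suc unfolding F_def by blast
  define S where "S x = (\<Sum>y\<leftarrow>ys. G (x, y) - F x)" for x
  have "set zs \<subseteq> space P \<Longrightarrow> (\<lambda>x. \<Sum>y\<leftarrow>zs. G (x, y) - F x) \<in> borel_measurable M" for zs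
    by (induction zs) auto
  then have [measurable]: "S \<in> borel_measurable M"
    unfolding S_def using ys(2) by blast
  have "x \<in> space M \<Longrightarrow> \<bar>\<Sum>y\<leftarrow>zs. G (x, y) - F x\<bar> \<le> real (length zs) * (2 * m)" for zs x
  proof (induction zs)
    case (Cons z zs)
    then show ?case using Fb[of x] bound[of "(x, z)"] by (simp add: algebra_simps) 
  qed simp
  then have Sb: "x \<in> space M \<Longrightarrow> \<bar>S x\<bar> \<le> real (length ys) * (2 * m)" for x
    unfolding S_def by blast
  from greedy_step[OF assms(1-4) \<open>S \<in> _\<close> Sb Y]
  obtain y where y: "y \<in> space P" "R y"
    "(\<integral>x. (S x + (G (x, y) - F x))\<^sup>2 \<partial>M) \<le> (\<integral>x. (S x)\<^sup>2 \<partial>M) + m\<^sup>2 * measure M (space M)"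
    unfolding F_def by auto
  have "(\<integral>x. (\<Sum>v\<leftarrow>y # ys. G (x, v) - F x)\<^sup>2 \<partial>M) \<le> real (Suc k) * (m\<^sup>2 * measure M (space M))"
    using y(3) ys(3) by (simp add: S_def[symmetric] algebra_simps)
  then show ?case using y ys unfolding F_def
    by (intro exI[of _ "y # ys"]) auto
qed

lemma banach_function_norm_mono:
  assumes "banach_function_norm M N" "f \<in> borel_measurable M" "g \<in> borel_measurable M"
    "AE x in M. g x \<le> f x"
  shows "N g \<le> N f"
  using assms unfolding banach_function_norm_def by blast

lemma banach_function_norm_add:
  assumes "banach_function_norm M N" "f \<in> borel_measurable M" "g \<in> borel_measurable M"
  shows "N (\<lambda>x. f x + g x) \<le> N f + N g"
  using assms unfolding banach_function_norm_def by blast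

lemma banach_function_norm_scale:
  assumes "banach_function_norm M N" "f \<in> borel_measurable M" "0 \<le> a"
  shows "N (\<lambda>x. ennreal a * f x) = ennreal a * N f"
  using assms unfolding banach_function_norm_def by blast

lemma banach_function_norm_zero:
  assumes "banach_function_norm M N"
  shows "N (\<lambda>x. 0) = 0"
  using assms borel_measurable_const[of 0 M] unfolding banach_function_norm_def by auto

text \<open>
  The infima over the tails of the sequence increase to the limit and are dominated by the members of
  the sequence, so the monotone convergence axiom applies to them.
\<close>
lemma banach_function_norm_fatou:
  assumes N: "banach_function_norm M N"
    and F [measurable]: "\<And>k::nat. F k \<in> borel_measurable M" and f [measurable]: "f \<in> borel_measurable M"
    and lim: "AE x in M. (\<lambda>k. F k x) \<longlonglongrightarrow> f x" and le: "\<And>k. N (F k) \<le> c"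
  shows "N f \<le> c"
proof -
  define g where "g k x = (INF j\<in>{k..}. F j x)" for k x
  have [measurable]: "g k \<in> borel_measurable M" for k unfolding g_def by measurable
  have inc: "incseq (\<lambda>k. g k x)" for x
    unfolding g_def by (intro incseq_SucI INF_superset_mono) auto
  have "AE x in M. incseq (\<lambda>k. g k x) \<and> (\<lambda>k. g k x) \<longlonglongrightarrow> f x"
    using lim
  proof eventually_elim
    case (elim x)
    have "(SUP k. g k x) = f x"
      using lim_imp_Liminf[OF _ elim] unfolding g_def liminf_SUP_INF by simp
    then show ?case using LIMSEQ_SUP[OF inc[of x]] inc[of x] by simp
  qed
  then have "(\<lambda>k. N (g k)) \<longlonglongrightarrow> N f"
    using N f unfolding banach_function_norm_def by auto
  moreover have "N (g k) \<le> c" for k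
  proof -
    have "N (g k) \<le> N (F k)"
      by (rule banach_function_norm_mono[OF N]) (auto simp: g_def intro!: INF_lower AE_I2)
    with le[of k] show ?thesis by simp
  qed
  ultimately show ?thesis by (intro LIMSEQ_le_const2) auto
qed

lemma banach_function_norm_sum_list:
  assumes N: "banach_function_norm M N"
    and "\<And>y. y \<in> set ys \<Longrightarrow> g y \<in> borel_measurable M \<and> N (g y) \<le> c"
  shows "(\<lambda>x. \<Sum>y\<leftarrow>ys. g y x) \<in> borel_measurable M \<and> N (\<lambda>x. \<Sum>y\<leftarrow>ys. g y x) \<le> of_nat (length ys) * c"
  using assms(2)
proof (induction ys)
  case Nil
  then show ?case using banach_function_norm_zero[OF N] by simp
next
  case (Cons z ys)
  then have IH: "(\<lambda>x. \<Sum>y\<leftarrow>ys. g y x) \<in> borel_measurable M"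
    "N (\<lambda>x. \<Sum>y\<leftarrow>ys. g y x) \<le> of_nat (length ys) * c" and z: "g z \<in> borel_measurable M" "N (g z) \<le> c"
    by auto
  have "N (\<lambda>x. g z x + (\<Sum>y\<leftarrow>ys. g y x)) \<le> c + of_nat (length ys) * c"
    using banach_function_norm_add[OF N z(1) IH(1)] add_mono[OF z(2) IH(2)] by (rule order_trans)
  then show ?case using IH z by (simp add: distrib_right)
qed

text \<open>
  Finite averages of functions of norm at most \<open>c\<close> have norm at most \<open>c\<close>. The averages over a
  greedy sample converge to the mean in \<open>L\<^sup>2(B)\<close>, hence almost everywhere along a subsequence,
  and the Fatou property passes the bound to the limit.
\<close>
lemma minkowski_bounded:
  fixes G :: "'x \<times> 'y \<Rightarrow> real"
  assumes N: "banach_function_norm M N" and P: "prob_space P"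
    and G [measurable]: "G \<in> borel_measurable (M \<Otimes>\<^sub>M P)" and bound: "\<And>z. 0 \<le> G z" "\<And>z. G z \<le> m"
    and B [measurable]: "B \<in> sets M" and Bfin: "emeasure M B < top"
    and supp: "\<And>x y. x \<notin> B \<Longrightarrow> G (x, y) = 0"
    and le: "AE y in P. N (\<lambda>x. ennreal (G (x, y))) \<le> c"
  shows "N (\<lambda>x. ennreal (\<integral>y. G (x, y) \<partial>P)) \<le> c"
proof -
  interpret P: prob_space P by fact
  \<comment> \<open>a finite measure on the same \<open>\<sigma>\<close>-algebra, so that measurability carries over\<close>
  define M' where "M' = density M (indicator B)"
  have sp: "space M' = space M" and [measurable_cong]: "sets M' = sets M" by (auto simp: M'_def)
  have "emeasure M' (space M') = emeasure M B"
    unfolding M'_def using sets.sets_into_space[OF B]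
    by (simp add: emeasure_density emeasure_eq_0 nn_integral_indicator Int_absorb2 flip: indicator_inter_arith)
  then interpret M': finite_measure M'
    using Bfin by (intro finite_measureI) (auto simp: less_top)
  define F where "F x = (\<integral>v. G (x, v) \<partial>P)" for x
  have Fm [measurable]: "F \<in> borel_measurable M" unfolding F_def by measurable
  have Gm': "G \<in> borel_measurable (M' \<Otimes>\<^sub>M P)" by measurable
  have "\<bar>G z\<bar> \<le> m" for z using bound[of z] by simp
  from greedy_sample[OF M'.finite_measure_axioms P Gm' this le]
  have "\<forall>k. \<exists>ys. length ys = Suc k \<and> (\<forall>y\<in>set ys. y \<in> space P \<and> N (\<lambda>x. ennreal (G (x, y))) \<le> c) \<and>
           (\<integral>x. (\<Sum>y\<leftarrow>ys. G (x, y) - F x)\<^sup>2 \<partial>M') \<le> real (Suc k) * (m\<^sup>2 * measure M' (space M'))"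
    unfolding F_def by blast
  from choice[OF this] obtain ys where ys: "\<And>k. length (ys k) = Suc k"
    "\<And>k y. y \<in> set (ys k) \<Longrightarrow> y \<in> space P \<and> N (\<lambda>x. ennreal (G (x, y))) \<le> c"
    "\<And>k. (\<integral>x. (\<Sum>y\<leftarrow>ys k. G (x, y) - F x)\<^sup>2 \<partial>M') \<le> real (Suc k) * (m\<^sup>2 * measure M' (space M'))"
    by blast
  define A where "A k x = (\<Sum>y\<leftarrow>ys k. G (x, y)) / real (Suc k)" for k x
  have "set zs \<subseteq> space P \<Longrightarrow> (\<lambda>x. \<Sum>y\<leftarrow>zs. G (x, y)) \<in> borel_measurable M" for zs
    by (induction zs) auto
  then have Am [measurable]: "A k \<in> borel_measurable M" for k
    unfolding A_def using ys(2) by (intro borel_measurable_divide) auto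
  have AF: "A k x - F x = (\<Sum>y\<leftarrow>ys k. G (x, y) - F x) / real (Suc k)" for k x
    by (simp add: A_def sum_list_subtractf sum_list_triv ys(1) field_simps)
  have AFint: "(\<integral>x. (A k x - F x)\<^sup>2 \<partial>M') \<le> (m\<^sup>2 * measure M' (space M')) * inverse (real (Suc k))" for k
    using ys(3)[of k] unfolding AF power_divide 
    by (simp add: field_simps power2_eq_square del: of_nat_Suc)
  have Gb: "set zs \<subseteq> space P \<Longrightarrow> 0 \<le> (\<Sum>y\<leftarrow>zs. G (x, y)) \<and> (\<Sum>y\<leftarrow>zs. G (x, y)) \<le> real (length zs) * m" for zs x
    using bound by (induction zs) (auto simp: algebra_simps intro: add_mono)
  have Ab: "0 \<le> A k x" "A k x \<le> m" for k x
    using Gb[of "ys k" x] ys(1,2) by (auto simp: A_def field_simps subset_eq)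
  have Fb: "0 \<le> F x" "F x \<le> m" if "x \<in> space M" for x
  proof -
    have "integrable P (\<lambda>y. G (x, y))"
      using that bound by (intro P.integrable_const_bound[where B=m]) auto
    then show "F x \<le> m" "0 \<le> F x" unfolding F_def using bound
      by (auto intro!: P.integral_le_const)
  qed
  have AFb: "\<bar>A k x - F x\<bar> \<le> m" if "x \<in> space M" for k x
    using Ab[of k x] Fb[OF that] by (auto simp: abs_le_iff)
  have m0: "0 \<le> m" using bound[of undefined] by linarith
  have int: "integrable M' (\<lambda>x. (A k x - F x)\<^sup>2)" for k
    using AFb by (intro M'.integrable_const_bound[where B="m\<^sup>2"])
      (auto simp: sp abs_le_square_iff[symmetric] m0)
  have "(\<lambda>k. \<integral>x. (A k x - F x)\<^sup>2 \<partial>M') \<longlonglongrightarrow> 0"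
  proof (rule tendsto_sandwich[where f="\<lambda>_. 0"])
    show "(\<lambda>k. (m\<^sup>2 * measure M' (space M')) * inverse (real (Suc k))) \<longlonglongrightarrow> 0"
      by (intro tendsto_mult_right_zero LIMSEQ_inverse_real_of_nat)
  qed (use AFint in \<open>auto intro!: always_eventually\<close>)
  then have "(\<lambda>k. \<integral>x. norm ((A k x - F x)\<^sup>2) \<partial>M') \<longlonglongrightarrow> 0" by simp
  from tendsto_L1_AE_subseq[OF int this]
  obtain r where "AE x in M'. (\<lambda>k. (A (r k) x - F x)\<^sup>2) \<longlonglongrightarrow> 0" by auto
  then have "AE x in M. x \<in> B \<longrightarrow> (\<lambda>k. (A (r k) x - F x)\<^sup>2) \<longlonglongrightarrow> 0"
    unfolding M'_def by (subst (asm) AE_density) (auto simp: indicator_def split: if_splits)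
  then have lim: "AE x in M. (\<lambda>k. ennreal (A (r k) x)) \<longlonglongrightarrow> ennreal (F x)"
  proof eventually_elim
    case (elim x)
    show ?case
    proof (cases "x \<in> B")
      case True
      then have "(\<lambda>k. sqrt ((A (r k) x - F x)\<^sup>2)) \<longlonglongrightarrow> sqrt 0" using elim by (intro tendsto_real_sqrt) auto
      then have "(\<lambda>k. A (r k) x) \<longlonglongrightarrow> F x"
        by (simp add: tendsto_rabs_zero_iff LIM_zero_iff)
      then show ?thesis by (intro tendsto_ennrealI)
    next
      case False
      then show ?thesis using supp by (simp add: A_def F_def)
    qed
  qed
  have "N (\<lambda>x. ennreal (A k x)) \<le> c" for k
  proof -
    have "0 \<le> (\<Sum>y\<leftarrow>zs. G (x, y))" for zs x
      using bound(1) by (induction zs) auto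
    then have *: "(\<Sum>y\<leftarrow>zs. ennreal (G (x, y))) = ennreal (\<Sum>y\<leftarrow>zs. G (x, y))" for zs x
      using bound(1) by (induction zs) auto
    have "N (\<lambda>x. \<Sum>y\<leftarrow>ys k. ennreal (G (x, y))) \<le> of_nat (Suc k) * c"
      "(\<lambda>x. \<Sum>y\<leftarrow>ys k. ennreal (G (x, y))) \<in> borel_measurable M"
      using banach_function_norm_sum_list[OF N, of "ys k" "\<lambda>y x. ennreal (G (x, y))" c] ys by auto
    moreover have "(\<lambda>x. ennreal (A k x)) = (\<lambda>x. ennreal (1 / real (Suc k)) * (\<Sum>y\<leftarrow>ys k. ennreal (G (x, y))))"
      unfolding * by (auto simp: A_def ennreal_mult'[symmetric])
    ultimately have "N (\<lambda>x. ennreal (A k x)) \<le> ennreal (1 / real (Suc k)) * (of_nat (Suc k) * c)"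
      using banach_function_norm_scale[OF N] by (simp add: mult_left_mono del: of_nat_Suc)
    also have "\<dots> = c"
      by (simp add: mult.assoc[symmetric] ennreal_of_nat_eq_real_of_nat ennreal_mult'[symmetric] del: of_nat_Suc)
    finally show ?thesis .
  qed
  then show ?thesis
    using banach_function_norm_fatou[OF N _ _ lim, of c] unfolding F_def by simp
qed

text \<open>
  A norm bound that holds for almost every section of \<open>G\<close> holds for the mean of the sections.
  Truncation in height and support reduces this to bounded functions on a set of finite measure. The
  usual proof by duality would need the associate space and the Lorentz-Luxemburg theorem.
\<close>
proposition minkowski:
  fixes G :: "'x \<times> 'y \<Rightarrow> ennreal"
  assumes N: "banach_function_norm M N" and "sigma_finite_measure M" and P: "prob_space P"
    and G [measurable]: "G \<in> borel_measurable (M \<Otimes>\<^sub>M P)"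
    and le: "AE y in P. N (\<lambda>x. G (x, y)) \<le> c"
  shows "N (\<lambda>x. \<integral>\<^sup>+ y. G (x, y) \<partial>P) \<le> c"
proof -
  interpret M: sigma_finite_measure M by fact
  interpret P: prob_space P by fact
  obtain B :: "nat \<Rightarrow> 'x set" where B: "range B \<subseteq> sets M" "(\<Union>i. B i) = space M"
    "\<And>i. emeasure M (B i) \<noteq> \<infinity>" "incseq B"
    using M.sigma_finite_incseq by blast
  have [measurable]: "B k \<in> sets M" for k using B(1) by auto
  define H where "H k z = min (G z) (of_nat k) * indicator (B k) (fst z)" for k z
  have [measurable]: "H k \<in> borel_measurable (M \<Otimes>\<^sub>M P)" for k unfolding H_def by measurable
  have Htop: "H k z < top" for k z
    by (auto simp: H_def indicator_def min_less_iff_disj of_nat_less_top)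
  have Hinc: "incseq (\<lambda>k. H k z)" for z
    using B(4) by (auto simp: H_def incseq_def indicator_def min_def le_fun_def of_nat_mono intro: order_trans)
  have Hlim: "(SUP k. H k (x, y)) = G (x, y)" if x: "x \<in> space M" for x y
  proof -
    obtain k0 where k0: "x \<in> B k0" using x B(2) by blast
    have "(\<lambda>k. H k (x, y)) \<longlonglongrightarrow> G (x, y)"
    proof (rule Lim_transform_eventually)
      have "(\<lambda>k. of_nat k :: ennreal) \<longlonglongrightarrow> top" by (rule of_nat_tendsto_top_ennreal)
      then have "(\<lambda>k. min (G (x, y)) (of_nat k)) \<longlonglongrightarrow> min (G (x, y)) top" by (intro tendsto_intros)
      then show "(\<lambda>k. min (G (x, y)) (of_nat k)) \<longlonglongrightarrow> G (x, y)" by simp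
      show "\<forall>\<^sub>F k in sequentially. min (G (x, y)) (of_nat k) = H k (x, y)"
        using eventually_ge_at_top[of k0]
        by eventually_elim (use k0 B(4) in \<open>auto simp: H_def incseq_def indicator_def\<close>)
    qed
    then show ?thesis using LIMSEQ_SUP[OF Hinc] LIMSEQ_unique by blast
  qed
  have step: "N (\<lambda>x. \<integral>\<^sup>+ y. H k (x, y) \<partial>P) \<le> c" for k
  proof -
    have le1: "AE y in P. N (\<lambda>x. ennreal (enn2real (H k (x, y)))) \<le> c"
      using le AE_space
    proof eventually_elim
      case (elim y)
      have "N (\<lambda>x. H k (x, y)) \<le> N (\<lambda>x. G (x, y))"
        using elim by (intro banach_function_norm_mono[OF N]) (auto simp: H_def indicator_def)
      then show ?case using elim Htop by simp
    qed
    have rb: "enn2real (H k z) \<le> real k" for z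
      by (rule enn2real_leI) (auto simp: H_def indicator_def ennreal_of_nat_eq_real_of_nat[symmetric])
    have "N (\<lambda>x. ennreal (\<integral>y. enn2real (H k (x, y)) \<partial>P)) \<le> c"
    proof (rule minkowski_bounded[OF N P, where B="B k" and m="real k"])
      show "emeasure M (B k) < top" using B(3)[of k] by (simp add: less_top)
    qed (use rb le1 in \<open>auto simp: H_def\<close>)
    moreover have "ennreal (\<integral>y. enn2real (H k (x, y)) \<partial>P) = (\<integral>\<^sup>+ y. H k (x, y) \<partial>P)" if "x \<in> space M" for x
    proof -
      have "integrable P (\<lambda>y. enn2real (H k (x, y)))"
        using that rb by (intro P.integrable_const_bound[where B="real k"]) auto
      then show ?thesis using Htop by (subst nn_integral_eq_integral[symmetric]) auto
    qed
    moreover have "N (\<lambda>x. \<integral>\<^sup>+ y. H k (x, y) \<partial>P) \<le> N (\<lambda>x. ennreal (\<integral>y. enn2real (H k (x, y)) \<partial>P))"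
      using calculation(2) by (intro banach_function_norm_mono[OF N]) auto
    ultimately show ?thesis by (meson order_trans)
  qed
  have lim: "(\<lambda>k. \<integral>\<^sup>+ y. H k (x, y) \<partial>P) \<longlonglongrightarrow> (\<integral>\<^sup>+ y. G (x, y) \<partial>P)" if "x \<in> space M" for x
  proof -
    have "(\<integral>\<^sup>+ y. G (x, y) \<partial>P) = (SUP k. \<integral>\<^sup>+ y. H k (x, y) \<partial>P)"
      using Hlim[OF that] Hinc that
      by (subst nn_integral_monotone_convergence_SUP[symmetric]) (auto simp: incseq_def le_fun_def)
    moreover have "incseq (\<lambda>k. \<integral>\<^sup>+ y. H k (x, y) \<partial>P)"
      using Hinc by (auto simp: incseq_def intro!: nn_integral_mono)
    ultimately show ?thesis using LIMSEQ_SUP by metis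
  qed
  show ?thesis
  proof (rule banach_function_norm_fatou[where F="\<lambda>k x. \<integral>\<^sup>+ y. H k (x, y) \<partial>P", OF N _ _ _ step])
    show "AE x in M. (\<lambda>k. \<integral>\<^sup>+ y. H k (x, y) \<partial>P) \<longlonglongrightarrow> (\<integral>\<^sup>+ y. G (x, y) \<partial>P)"
      by (rule AE_I2) (rule lim)
  qed measurable
qed

section \<open>Translations and means in rearrangement invariant spaces\<close>

lemma ident_borel_measurable_lebesgue:
  "(\<lambda>x::'a::euclidean_space. x) \<in> borel_measurable lebesgue"
  using id_borel_measurable_lebesgue by (simp add: id_def)

lemma lebesgue_distr_plus: "distr lebesgue lebesgue ((+) (c::'a::euclidean_space)) = lebesgue"
proof -
  have "lebesgue = density (distr lebesgue lebesgue (\<lambda>x. c + (\<Sum>j\<in>Basis. (1 * (x \<bullet> j)) *\<^sub>R j))) (\<lambda>_. (\<Prod>j\<in>(Basis::'a set). \<bar>1::real\<bar>))"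
    by (intro lebesgue_affine_euclidean) auto
  then show ?thesis by (simp add: euclidean_representation density_1 one_ennreal_def[symmetric])
qed

lemma measurable_lebesgue_plus: "(\<lambda>x. x + (c::'a::euclidean_space)) \<in> lebesgue \<rightarrow>\<^sub>M lebesgue"
proof -
  have "(\<lambda>x. c + (\<Sum>j\<in>Basis. (1 * (x \<bullet> j)) *\<^sub>R j)) \<in> lebesgue \<rightarrow>\<^sub>M lebesgue"
    by (intro lebesgue_affine_measurable) auto
  then show ?thesis by (simp add: euclidean_representation add.commute)
qed

lemma measurable_lebesgue_plus': "(+) (c::'a::euclidean_space) \<in> lebesgue \<rightarrow>\<^sub>M lebesgue"
proof -
  have "(+) c = (\<lambda>x. x + c)" by (auto simp: add.commute)
  then show ?thesis using measurable_lebesgue_plus[of c] by simp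
qed

lemma AE_lebesgue_plus:
  fixes c :: "'a::euclidean_space"
  assumes "AE x in lebesgue. P x"
  shows "AE x in lebesgue. P (x + c)"
proof -
  have "AE x in distr lebesgue lebesgue ((+) c). P x"
    unfolding lebesgue_distr_plus by (rule assms)
  then have "AE x in lebesgue. P (c + x)"
    by (rule AE_distrD[OF measurable_lebesgue_plus'])
  then show ?thesis by (simp add: add.commute)
qed

lemma ri_norm_translate:
  fixes g :: "'a::euclidean_space \<Rightarrow> ennreal"
  assumes N: "ri_norm lebesgue N" and g: "g \<in> borel_measurable lebesgue" and fin: "\<And>x. g x < top"
  shows "N (\<lambda>x. g (x + c)) = N g"
proof -
  have gc: "(\<lambda>x. g (x + c)) \<in> borel_measurable lebesgue"
    using measurable_compose[OF measurable_lebesgue_plus g] .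
  have "equimeasurable lebesgue (\<lambda>x. g (x + c)) g"
    unfolding equimeasurable_def
  proof (intro allI impI)
    fix s :: real
    let ?A = "{x \<in> space lebesgue. ennreal s < g x}"
    have A: "?A \<in> sets lebesgue" using g by measurable
    have "emeasure lebesgue ?A = emeasure (distr lebesgue lebesgue ((+) c)) ?A"
      by (simp add: lebesgue_distr_plus)
    also have "\<dots> = emeasure lebesgue ((+) c -` ?A \<inter> space lebesgue)"
      by (rule emeasure_distr[OF measurable_lebesgue_plus' A])
    also have "(+) c -` ?A \<inter> space lebesgue = {x \<in> space lebesgue. ennreal s < g (x + c)}"
      by (auto simp: add.commute)
    finally show "emeasure lebesgue {x \<in> space lebesgue. ennreal s < g (x + c)} = emeasure lebesgue ?A" ..
  qed
  then show ?thesis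
    using N g gc fin unfolding ri_norm_def by auto
qed

text \<open>
  Functions such as \<open>(x, y) \<mapsto> f (x + y)\<close> are measurable on the product \<open>\<sigma>\<close>-algebra
  when \<open>f\<close> is a Borel function, but need not be when \<open>f\<close> is merely Lebesgue measurable, as the
  elements of the function space are.
\<close>
lemma lebesgue_ae_borel:
  fixes f :: "'a::euclidean_space \<Rightarrow> 'b::euclidean_space"
  assumes "f \<in> borel_measurable lebesgue"
  obtains g where "g \<in> borel_measurable borel" "AE x in lebesgue. f x = g x"
proof -
  have "\<exists>g. g \<in> borel_measurable lborel \<and> (AE x in lborel. f x \<bullet> i = g x)" for i
  proof -
    have "(\<lambda>x. f x \<bullet> i) \<in> borel_measurable lebesgue" using assms by measurable
    from completion_ex_borel_measurable_real[OF this] show ?thesis by blast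
  qed
  then obtain g where g: "\<And>i. g i \<in> borel_measurable lborel" "\<And>i. AE x in lborel. f x \<bullet> i = g i x" by metis
  have "(\<lambda>x. \<Sum>i\<in>Basis. g i x *\<^sub>R i) \<in> borel_measurable borel"
    using g(1) by (intro borel_measurable_sum borel_measurable_scaleR) auto
  moreover have "AE x in lborel. \<forall>i\<in>Basis. f x \<bullet> i = g i x"
    using g(2) by (intro AE_finite_allI) auto
  then have "AE x in lborel. f x = (\<Sum>i\<in>Basis. g i x *\<^sub>R i)"
  proof eventually_elim
    case (elim x)
    have "(\<Sum>i\<in>Basis. g i x *\<^sub>R i) = (\<Sum>i\<in>Basis. (f x \<bullet> i) *\<^sub>R i)"
      using elim by (intro sum.cong) auto
    also have "\<dots> = f x" by (rule euclidean_representation)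
    finally show ?case ..
  qed
  then have "AE x in lebesgue. f x = (\<Sum>i\<in>Basis. g i x *\<^sub>R i)" by (rule AE_completion)
  ultimately show thesis by (rule that)
qed

definition cube :: "real \<Rightarrow> (real ^ 'n) set" where
  "cube l = cbox 0 (\<chi> i. l)"

lemma measure_cube:
  assumes "0 < l"
  shows "measure lborel (cube l :: (real ^ 'n) set) = l ^ CARD('n)"
  using assms by (simp add: cube_def content_cbox_if_cart interval_eq_empty_cart not_less)

lemma norm_cube:
  assumes "y \<in> (cube l :: (real ^ 'n) set)"
  shows "norm y \<le> real CARD('n) * l"
proof -
  have "norm y \<le> (\<Sum>i\<in>UNIV. \<bar>y $ i\<bar>)" by (rule norm_le_l1_cart)
  also have "\<dots> \<le> (\<Sum>i\<in>(UNIV :: 'n set). l)"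
    using assms by (intro sum_mono) (auto simp: cube_def mem_box_cart)
  finally show ?thesis by simp
qed

text \<open>
  The intersection of the cube and its translate contains the box with side lengths
  \<open>l - \<bar>h\<^sub>i\<bar>\<close>, whose volume is estimated from below by Bernoulli's inequality.
\<close>
lemma measure_cube_shift:
  fixes h :: "real ^ 'n"
  assumes l: "0 < l" and h: "norm h \<le> l"
  shows "measure lborel ((+) h ` cube l - cube l) \<le> (real CARD('n) * norm h / l) * measure lborel (cube l :: (real ^ 'n) set)"
    "measure lborel (cube l - (+) h ` cube l) \<le> (real CARD('n) * norm h / l) * measure lborel (cube l :: (real ^ 'n) set)"
proof -
  let ?Q = "cube l :: (real ^ 'n) set"
  let ?R = "cbox (\<chi> i. max 0 (h $ i)) (\<chi> i. min l (l + h $ i)) :: (real ^ 'n) set"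
  have hi: "\<bar>h $ i\<bar> \<le> l" for i using component_le_norm_cart[of h i] h by linarith
  have shift: "(+) h ` ?Q = cbox h (h + (\<chi> i. l))"
    using cbox_translation[of h 0 "\<chi> i. l"] by (simp add: cube_def)
  have sub: "?R \<subseteq> ?Q" "?R \<subseteq> (+) h ` ?Q"
    unfolding shift by (auto simp: cube_def mem_box_cart add.commute)
  have "measure lborel ?R = (\<Prod>i\<in>UNIV. min l (l + h $ i) - max 0 (h $ i))"
  proof -
    have "max 0 (h $ i) \<le> min l (l + h $ i)" for i using hi[of i] l by (auto simp: max_def min_def abs_le_iff)
    then show ?thesis by (subst content_cbox_cart) (auto simp: interval_ne_empty_cart)
  qed
  also have "\<dots> = (\<Prod>i\<in>UNIV. l * (1 - \<bar>h $ i\<bar> / l))"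
    using l by (intro prod.cong) (auto simp: max_def min_def field_simps abs_if)
  also have "\<dots> = l ^ CARD('n) * (\<Prod>i\<in>UNIV. 1 - \<bar>h $ i\<bar> / l)"
    by (simp add: prod.distrib)
  also have "\<dots> \<ge> l ^ CARD('n) * (1 - (\<Sum>i\<in>UNIV. \<bar>h $ i\<bar> / l))"
    using l hi by (intro mult_left_mono Weierstrass_prod_ineq) auto
  finally have R0: "l ^ CARD('n) * (1 - (\<Sum>i\<in>UNIV. \<bar>h $ i\<bar> / l)) \<le> measure lborel ?R" .
  have "(\<Sum>i\<in>UNIV. \<bar>h $ i\<bar> / l) \<le> (\<Sum>i\<in>(UNIV::'n set). norm h / l)"
    using l component_le_norm_cart[of h] by (intro sum_mono divide_right_mono) auto
  then have "l ^ CARD('n) * (1 - real CARD('n) * norm h / l) \<le> l ^ CARD('n) * (1 - (\<Sum>i\<in>UNIV. \<bar>h $ i\<bar> / l))"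
    using l by (intro mult_left_mono) auto
  from this R0 have "l ^ CARD('n) * (1 - real CARD('n) * norm h / l) \<le> measure lborel ?R" by (rule order_trans)
  then have R: "measure lborel ?Q * (1 - real CARD('n) * norm h / l) \<le> measure lborel ?R"
    using l by (simp add: measure_cube)
  have fm: "?Q \<in> fmeasurable lborel" "(+) h ` ?Q \<in> fmeasurable lborel" "?R \<in> fmeasurable lborel"
    unfolding shift by (auto simp: cube_def)
  have "measure lborel ((+) h ` ?Q) = measure lborel ?Q"
    using l unfolding shift by (simp add: cube_def content_cbox_if_cart interval_eq_empty_cart not_less)
  moreover have "measure lborel ((+) h ` ?Q - ?Q) \<le> measure lborel ((+) h ` ?Q - ?R)"
    using sub fm by (intro measure_mono_fmeasurable fmeasurable.Diff fmeasurable_Diff) (auto simp: fmeasurable_def)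
  moreover have "measure lborel ((+) h ` ?Q - ?R) = measure lborel ((+) h ` ?Q) - measure lborel ?R"
    using sub fm by (intro measurable_measure_Diff) (auto simp: fmeasurable_def)
  ultimately show "measure lborel ((+) h ` ?Q - ?Q) \<le> (real CARD('n) * norm h / l) * measure lborel ?Q"
    using R by (simp add: algebra_simps)
  have "measure lborel (?Q - (+) h ` ?Q) \<le> measure lborel (?Q - ?R)"
    using sub fm by (intro measure_mono_fmeasurable fmeasurable.Diff fmeasurable_Diff) (auto simp: fmeasurable_def)
  moreover have "measure lborel (?Q - ?R) = measure lborel ?Q - measure lborel ?R"
    using sub fm by (intro measurable_measure_Diff) (auto simp: fmeasurable_def)
  ultimately show "measure lborel (?Q - (+) h ` ?Q) \<le> (real CARD('n) * norm h / l) * measure lborel ?Q"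
    using R by (simp add: algebra_simps)
qed

lemma sigma_finite_lebesgue: "sigma_finite_measure (lebesgue :: 'a::euclidean_space measure)"
proof
  obtain A :: "'a set set" where "countable A \<and> A \<subseteq> sets lborel \<and> \<Union>A = space lborel \<and> (\<forall>a\<in>A. emeasure lborel a \<noteq> \<infinity>)"
    using sigma_finite_measure.sigma_finite_countable[OF sigma_finite_lborel] by (rule exE)
  then show "\<exists>A. countable A \<and> A \<subseteq> sets (lebesgue :: 'a measure) \<and> \<Union>A = space lebesgue \<and> (\<forall>a\<in>A. emeasure lebesgue a \<noteq> \<infinity>)"
    by (intro exI[of _ A]) (auto intro: sets_completionI_sets)
qed

text \<open>
  Minkowski's inequality for the uniform distribution on \<open>D\<close>, rescaled to the Lebesgue measure.
\<close>
lemma minkowski_set: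
  fixes G :: "'a::euclidean_space \<times> 'b::euclidean_space \<Rightarrow> ennreal"
  assumes N: "banach_function_norm lebesgue N"
    and D: "D \<in> sets borel" "emeasure lborel D < top"
    and G: "G \<in> borel_measurable (borel \<Otimes>\<^sub>M borel)"
    and le: "\<And>y. y \<in> D \<Longrightarrow> N (\<lambda>x. G (x, y)) \<le> c"
  shows "N (\<lambda>x. \<integral>\<^sup>+ y\<in>D. G (x, y) \<partial>lborel) \<le> emeasure lborel D * c"
proof (cases "emeasure lborel D = 0")
  case True
  then have "AE y in lborel. y \<notin> D"
    using D by (subst AE_iff_measurable[of D]) auto
  then have "(\<integral>\<^sup>+ y\<in>D. G (x, y) \<partial>lborel) = 0" for x
    by (subst nn_integral_cong_AE[where v="\<lambda>_. 0"]) auto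
  then show ?thesis using banach_function_norm_zero[OF N] by simp
next
  case False
  define P where "P = uniform_measure lborel D"
  have [measurable]: "D \<in> sets borel" by fact
  interpret P: prob_space P
    unfolding P_def using D False by (intro prob_space_uniform_measure) auto
  have sP: "sets P = sets borel" by (simp add: P_def)
  have Gm: "G \<in> borel_measurable (lebesgue \<Otimes>\<^sub>M P)"
  proof -
    have 2: "(\<lambda>x. x) \<in> P \<rightarrow>\<^sub>M borel" using sP by (intro measurable_ident_sets)
    have "fst \<in> lebesgue \<Otimes>\<^sub>M P \<rightarrow>\<^sub>M (borel :: 'a measure)" by (rule measurable_compose[OF measurable_fst ident_borel_measurable_lebesgue])
    moreover have "snd \<in> lebesgue \<Otimes>\<^sub>M P \<rightarrow>\<^sub>M (borel :: 'b measure)" by (rule measurable_compose[OF measurable_snd 2])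
    ultimately have "(\<lambda>z. (fst z, snd z)) \<in> lebesgue \<Otimes>\<^sub>M P \<rightarrow>\<^sub>M (borel :: 'a measure) \<Otimes>\<^sub>M (borel :: 'b measure)"
      by (intro measurable_Pair) auto
    from measurable_compose[OF this G] show ?thesis by simp
  qed
  have "AE y in P. N (\<lambda>x. G (x, y)) \<le> c"
    unfolding P_def using le by (intro AE_uniform_measureI) auto
  from minkowski[OF N _ P.prob_space_axioms Gm this]
  have mink: "N (\<lambda>x. \<integral>\<^sup>+ y. G (x, y) \<partial>P) \<le> c"
    using sigma_finite_lebesgue by blast
  have Gx: "(\<lambda>y. G (x, y)) \<in> borel_measurable lborel" for x
    using measurable_compose[OF measurable_Pair1' G] by simp
  define d where "d = measure lborel D"
  have d: "emeasure lborel D = ennreal d" "0 < d"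
    using D(2) False unfolding d_def by (auto simp: emeasure_eq_ennreal_measure zero_less_measure_iff less_top)
  have cancel: "ennreal d * (z / ennreal d) = z" for z
    using d(2) by (subst ennreal_times_divide, subst mult.commute, intro mult_divide_eq_ennreal) auto
  have "(\<integral>\<^sup>+ y\<in>D. G (x, y) \<partial>lborel) = ennreal d * (\<integral>\<^sup>+ y. G (x, y) \<partial>P)" for x
    unfolding P_def using Gx D(1) d(1)
    by (subst nn_integral_uniform_measure) (simp_all add: cancel)
  moreover have "(\<lambda>x. \<integral>\<^sup>+ y. G (x, y) \<partial>P) \<in> borel_measurable lebesgue"
    using P.borel_measurable_nn_integral_fst[OF Gm] .
  ultimately have "N (\<lambda>x. \<integral>\<^sup>+ y\<in>D. G (x, y) \<partial>lborel) = ennreal d * N (\<lambda>x. \<integral>\<^sup>+ y. G (x, y) \<partial>P)"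
    using banach_function_norm_scale[OF N] d by (simp add: less_imp_le)
  then show ?thesis using mink d by (simp add: mult_left_mono)
qed

context
  fixes N :: "(real ^ 'n \<Rightarrow> ennreal) \<Rightarrow> ennreal"
  assumes N: "ri_norm lebesgue N"
begin

lemma ri_imp_banach: "banach_function_norm lebesgue N" using N by (simp add: ri_norm_def)

definition nrm :: "(real ^ 'n \<Rightarrow> 's::{real_normed_field, euclidean_space}) \<Rightarrow> ennreal" where
  "nrm g = N (\<lambda>x. ennreal (norm (g x)))"

lemma nrm_mono_AE:
  assumes "g \<in> borel_measurable lebesgue" "h \<in> borel_measurable lebesgue" "AE x in lebesgue. norm (g x) \<le> norm (h x)"
  shows "nrm g \<le> nrm h"
  unfolding nrm_def using assms by (intro banach_function_norm_mono[OF ri_imp_banach]) (auto intro: ennreal_leI)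

lemma nrm_cong_AE:
  assumes "g \<in> borel_measurable lebesgue" "h \<in> borel_measurable lebesgue" "AE x in lebesgue. g x = h x"
  shows "nrm g = nrm h"
  using assms by (intro antisym nrm_mono_AE) auto

lemma nrm_translate:
  assumes "g \<in> borel_measurable lebesgue"
  shows "nrm (\<lambda>x. g (x + c)) = nrm g"
  unfolding nrm_def using assms by (intro ri_norm_translate[OF N]) auto

lemma nrm_le_add:
  assumes "F \<in> borel_measurable lebesgue" "g \<in> borel_measurable lebesgue" "h \<in> borel_measurable lebesgue"
    and "\<And>x. norm (F x) \<le> norm (g x) + norm (h x)"
  shows "nrm F \<le> nrm g + nrm h"
proof -
  have "nrm F \<le> N (\<lambda>x. ennreal (norm (g x)) + ennreal (norm (h x)))"
    unfolding nrm_def using assms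
    by (intro banach_function_norm_mono[OF ri_imp_banach]) (auto simp flip: ennreal_plus intro!: ennreal_leI)
  also have "\<dots> \<le> nrm g + nrm h"
    unfolding nrm_def using assms by (intro banach_function_norm_add[OF ri_imp_banach]) auto
  finally show ?thesis .
qed

lemma measurable_translate [measurable (raw)]:
  assumes "g \<in> borel_measurable lebesgue"
  shows "(\<lambda>x. g (x + (c :: real ^ 'n)) :: 's::{real_normed_field, euclidean_space}) \<in> borel_measurable lebesgue"
  using measurable_compose[OF measurable_lebesgue_plus assms] .

lemma modulus_bfs: "modulus (bfs lebesgue N) g u = (SUP h\<in>{h. norm h \<le> u}. nrm (\<lambda>x. g (x + h) - g x))"
  by (simp add: modulus_def bfs_def nrm_def)

lemma modulus_upper: "norm h \<le> u \<Longrightarrow> nrm (\<lambda>x. g (x + h) - g x) \<le> modulus (bfs lebesgue N) g u"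
  unfolding modulus_bfs by (rule SUP_upper) simp

lemma modulus_cong_AE:
  assumes "g \<in> borel_measurable lebesgue" "h \<in> borel_measurable lebesgue" "AE x in lebesgue. g x = h x"
  shows "modulus (bfs lebesgue N) g u = modulus (bfs lebesgue N) h u"
proof -
  have "nrm (\<lambda>x. g (x + v) - g x) = nrm (\<lambda>x. h (x + v) - h x)" for v
  proof (rule nrm_cong_AE)
    show "AE x in lebesgue. g (x + v) - g x = h (x + v) - h x"
      using assms(3) AE_lebesgue_plus[OF assms(3), of v] by eventually_elim simp
  qed (use assms in measurable)
  then show ?thesis by (simp add: modulus_bfs)
qed

lemma modulus_le_add:
  assumes m: "F \<in> borel_measurable lebesgue" "g \<in> borel_measurable lebesgue" "h \<in> borel_measurable lebesgue"
    and le: "\<And>x y. norm (F y - F x) \<le> norm (g y - g x) + norm (h y - h x)"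
  shows "modulus (bfs lebesgue N) F u \<le> modulus (bfs lebesgue N) g u + modulus (bfs lebesgue N) h u"
  unfolding modulus_bfs[of F]
proof (intro SUP_least)
  fix v :: "real ^ 'n" assume v: "v \<in> {v. norm v \<le> u}"
  have "nrm (\<lambda>x. F (x + v) - F x) \<le> nrm (\<lambda>x. g (x + v) - g x) + nrm (\<lambda>x. h (x + v) - h x)"
    using m by (intro nrm_le_add le) auto
  also have "\<dots> \<le> modulus (bfs lebesgue N) g u + modulus (bfs lebesgue N) h u"
    using v by (intro add_mono modulus_upper) auto
  finally show "nrm (\<lambda>x. F (x + v) - F x) \<le> \<dots>" .
qed

lemma modulus_le_nrm:
  assumes "g \<in> borel_measurable lebesgue"
  shows "modulus (bfs lebesgue N) g u \<le> 2 * nrm g"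
  unfolding modulus_bfs
proof (intro SUP_least)
  fix v :: "real ^ 'n"
  have "nrm (\<lambda>x. g (x + v) - g x) \<le> nrm (\<lambda>x. g (x + v)) + nrm g"
    using assms by (intro nrm_le_add norm_triangle_ineq4) auto
  then show "nrm (\<lambda>x. g (x + v) - g x) \<le> 2 * nrm g"
    using nrm_translate[OF assms] by (simp add: mult_2)
qed

context
  fixes f :: "real ^ 'n \<Rightarrow> 's::{real_normed_field, euclidean_space}"
  assumes f [measurable]: "f \<in> borel_measurable borel" and fin: "nrm f < top"
begin

lemma f_lebesgue: "f \<in> borel_measurable lebesgue"
  using f by (simp add: measurable_completion)

lemma nrm_set_integral_le:
  fixes G :: "real ^ 'n \<Rightarrow> real ^ 'n \<Rightarrow> 's"
  assumes D [measurable]: "D \<in> sets borel" and Dfin: "emeasure lborel D < top"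
    and G [measurable]: "(\<lambda>(x, y). G x y) \<in> borel_measurable (borel \<Otimes>\<^sub>M borel)"
    and le: "\<And>y. y \<in> D \<Longrightarrow> nrm (\<lambda>x. G x y) \<le> c"
  shows "(\<lambda>x. LINT y:D|lborel. G x y) \<in> borel_measurable borel"
    and "nrm (\<lambda>x. LINT y:D|lborel. G x y) \<le> emeasure lborel D * c"
proof -
  show meas: "(\<lambda>x. LINT y:D|lborel. G x y) \<in> borel_measurable borel"
    unfolding set_lebesgue_integral_def by measurable
  have "nrm (\<lambda>x. LINT y:D|lborel. G x y) \<le> N (\<lambda>x. \<integral>\<^sup>+ y\<in>D. ennreal (norm (G x y)) \<partial>lborel)"
    unfolding nrm_def
  proof (intro banach_function_norm_mono[OF ri_imp_banach] AE_I2)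
    have "(\<lambda>x. \<integral>\<^sup>+ y\<in>D. ennreal (norm (G x y)) \<partial>lborel) \<in> borel_measurable borel" by measurable
    then show "(\<lambda>x. \<integral>\<^sup>+ y\<in>D. ennreal (norm (G x y)) \<partial>lborel) \<in> borel_measurable lebesgue"
      by (simp add: measurable_completion)
    show "(\<lambda>x. ennreal (norm (LINT y:D|lborel. G x y))) \<in> borel_measurable lebesgue"
      using meas by (simp add: measurable_completion)
    fix x
    have "ennreal (norm (LINT y:D|lborel. G x y)) \<le> (\<integral>\<^sup>+ y. ennreal (norm (indicator D y *\<^sub>R G x y)) \<partial>lborel)"
      unfolding set_lebesgue_integral_def
    proof (cases "integrable lborel (\<lambda>y. indicator D y *\<^sub>R G x y)")
      case True
      then show "ennreal (norm (\<integral>y. indicator D y *\<^sub>R G x y \<partial>lborel)) \<le> (\<integral>\<^sup>+ y. ennreal (norm (indicator D y *\<^sub>R G x y)) \<partial>lborel)"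
        by (rule integral_norm_bound_ennreal)
      \<comment> \<open>A function that is not integrable has Bochner integral 0.\<close>
    qed (simp add: not_integrable_integral_eq)
    also have "\<dots> = (\<integral>\<^sup>+ y\<in>D. ennreal (norm (G x y)) \<partial>lborel)"
      by (intro nn_integral_cong) (auto simp: indicator_def)
    finally show "ennreal (norm (LINT y:D|lborel. G x y)) \<le> \<dots>" .
  qed
  also have "\<dots> \<le> emeasure lborel D * c"
  proof -
    have "(\<lambda>z. ennreal (norm (G (fst z) (snd z)))) \<in> borel_measurable (borel \<Otimes>\<^sub>M borel)" by measurable
    from minkowski_set[OF ri_imp_banach D Dfin this] show ?thesis using le by (simp add: nrm_def)
  qed
  finally show "nrm (\<lambda>x. LINT y:D|lborel. G x y) \<le> emeasure lborel D * c" .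
qed

text \<open>
  The last axiom of a Banach function norm embeds the space into the locally integrable functions.
\<close>
lemma locally_integrable:
  assumes D: "D \<in> sets borel" "bounded D"
  shows "set_integrable lborel D (\<lambda>y. f (x + y))"
  unfolding set_integrable_def
proof (rule integrableI_bounded)
  note D(1)[measurable]
  show "(\<lambda>y. indicator D y *\<^sub>R f (x + y)) \<in> borel_measurable lborel" by measurable
  obtain r where r: "D \<subseteq> cball 0 r" using D(2) by (force simp: bounded_iff)
  obtain C where C: "C \<ge> 0" "\<And>g. g \<in> borel_measurable lebesgue \<Longrightarrow> (\<integral>\<^sup>+ z\<in>cball x r. g z \<partial>lebesgue) \<le> ennreal C * N g"
  proof -
    have "cball x r \<in> sets lebesgue" "emeasure lebesgue (cball x r) < top"
      using emeasure_bounded_finite[OF bounded_cball, of x r] by auto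
    then have "\<exists>C\<ge>0. \<forall>g\<in>borel_measurable lebesgue. (\<integral>\<^sup>+ z\<in>cball x r. g z \<partial>lebesgue) \<le> ennreal C * N g"
      using ri_imp_banach by (simp add: banach_function_norm_def)
    then show thesis using that by blast
  qed
  let ?g = "\<lambda>z. ennreal (norm (f z)) * indicator (cball x r) z"
  have "(\<integral>\<^sup>+ y. ennreal (norm (indicator D y *\<^sub>R f (x + y))) \<partial>lborel) \<le> (\<integral>\<^sup>+ y. ?g (x + y) \<partial>lborel)"
    using r by (intro nn_integral_mono) (auto simp: indicator_def dist_norm)
  also have "\<dots> = (\<integral>\<^sup>+ z. ?g z \<partial>distr lborel borel ((+) x))"
    by (rule nn_integral_distr[symmetric]) (measurable, simp)
  also have "\<dots> = (\<integral>\<^sup>+ z. ?g z \<partial>lebesgue)"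
    by (simp add: lborel_distr_plus nn_integral_completion)
  also have "\<dots> \<le> ennreal C * nrm f"
    unfolding nrm_def using f_lebesgue by (intro C) auto
  also have "\<dots> < top" using fin by (simp add: ennreal_mult_less_top)
  finally show "(\<integral>\<^sup>+ y. ennreal (norm (indicator D y *\<^sub>R f (x + y))) \<partial>lborel) < \<infinity>" by simp
qed

text \<open>
  Each translation difference \<open>f (x + y) - f x\<close> has norm at most the modulus at \<open>r\<close>, and by
  Minkowski's inequality so has their mean over \<open>D\<close>.
\<close>
lemma increment_mean_nrm:
  assumes D: "D \<in> sets borel" "bounded D" and r: "\<And>y. y \<in> D \<Longrightarrow> norm y \<le> r"
  shows "nrm (\<lambda>x. LINT y:D|lborel. f (x + y) - f x) \<le> emeasure lborel D * modulus (bfs lebesgue N) f r"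
    and "(\<lambda>x. LINT y:D|lborel. f (x + y) - f x) \<in> borel_measurable borel"
    and "(LINT y:D|lborel. f (x + y) - f x) = (LINT y:D|lborel. f (x + y)) - measure lborel D *\<^sub>R f x"
proof -
  note D(1)[measurable]
  have Dfin: "emeasure lborel D < top" using emeasure_bounded_finite[OF D(2)] by simp
  have cint: "set_integrable lborel D (\<lambda>y. f x)" for x
    using Dfin D unfolding set_integrable_def by (simp add: integrable_indicator_iff)
  have "(\<lambda>(x, y). f (x + y) - f x) \<in> borel_measurable (borel \<Otimes>\<^sub>M borel)" by measurable
  from nrm_set_integral_le[OF D(1) Dfin this modulus_upper] r
  show "nrm (\<lambda>x. LINT y:D|lborel. f (x + y) - f x) \<le> emeasure lborel D * modulus (bfs lebesgue N) f r"
    and "(\<lambda>x. LINT y:D|lborel. f (x + y) - f x) \<in> borel_measurable borel" by auto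
  show "(LINT y:D|lborel. f (x + y) - f x) = (LINT y:D|lborel. f (x + y)) - measure lborel D *\<^sub>R f x"
    using cint locally_integrable[OF D] Dfin D(1)
    by (subst set_integral_diff) (auto simp: set_integral_const less_top)
qed

lemma mean_translate:
  assumes D [measurable]: "D \<in> sets borel" "(+) h ` D \<in> sets borel"
  shows "(LINT y:D|lborel. f ((x + h) + y)) = (LINT y:((+) h ` D)|lborel. f (x + y))"
proof -
  let ?F = "\<lambda>z. indicator ((+) h ` D) z *\<^sub>R f (x + z)"
  have "integral\<^sup>L lborel ?F = integral\<^sup>L (distr lborel borel ((+) h)) ?F"
    by (simp add: lborel_distr_plus)
  also have "\<dots> = (\<integral>y. ?F (h + y) \<partial>lborel)"
    by (intro integral_distr) auto
  also have "\<dots> = (LINT y:D|lborel. f ((x + h) + y))"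
    unfolding set_lebesgue_integral_def
    by (intro Bochner_Integration.integral_cong) (auto simp: indicator_def add.assoc)
  finally show ?thesis unfolding set_lebesgue_integral_def ..
qed

lemma nrm_scaleR:
  assumes "g \<in> borel_measurable lebesgue"
  shows "nrm (\<lambda>x. c *\<^sub>R g x) = ennreal \<bar>c\<bar> * nrm g"
proof -
  have "(\<lambda>x. ennreal (norm (c *\<^sub>R g x))) = (\<lambda>x. ennreal \<bar>c\<bar> * ennreal (norm (g x)))"
    by (simp add: ennreal_mult)
  then show ?thesis
    unfolding nrm_def using assms by (simp add: banach_function_norm_scale[OF ri_imp_banach])
qed

text \<open>
  \<open>A\<close> is the mean of \<open>f\<close> over a cube of side \<open>l\<close> at the current point; \<open>l\<close> is
  so small that the cube and its translates by vectors of length at most \<open>l\<close> lie in the ball of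
  radius \<open>t\<close>. The last estimate expresses the smoothness of \<open>A\<close>: the difference
  \<open>A (x + h) - A x\<close> is a signed integral of \<open>f\<close> over the symmetric difference of two cubes, which has
  relative volume of order \<open>\<bar>h\<bar> / t\<close>. Both parts of the symmetric difference have the same volume, so
  \<open>f x\<close> can be subtracted in the integrand, which makes the modulus of \<open>f\<close> appear.
\<close>
lemma mean_approximation:
  fixes t :: real
  assumes t: "0 < t"
  defines "l \<equiv> t / (2 * real CARD('n))"
  defines "A \<equiv> \<lambda>x. (1 / measure lborel (cube l :: (real ^ 'n) set)) *\<^sub>R (LINT y:cube l|lborel. f (x + y))"
  shows "A \<in> borel_measurable borel"
    and "nrm (\<lambda>x. f x - A x) \<le> modulus (bfs lebesgue N) f t"
    and "modulus (bfs lebesgue N) A u \<le> modulus (bfs lebesgue N) f u"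
    and "0 < u \<Longrightarrow> u \<le> t \<Longrightarrow>
      modulus (bfs lebesgue N) A u \<le> ennreal (4 * (real CARD('n))\<^sup>2 * (u / t)) * modulus (bfs lebesgue N) f t"
proof -
  define n where "n = real CARD('n)"
  have n: "1 \<le> n" by (simp add: n_def Suc_leI)
  have l: "0 < l" "2 * n * l = t" using t n by (auto simp: l_def n_def)
  let ?Q = "cube l :: (real ^ 'n) set"
  let ?m = "modulus (bfs lebesgue N)"
  define c where "c = measure lborel ?Q"
  have c: "0 < c" using l by (simp add: c_def measure_cube)
  have Q [measurable]: "?Q \<in> sets borel" and Qb: "bounded ?Q" by (auto simp: cube_def)
  have Qe: "emeasure lborel ?Q = ennreal c"
    unfolding c_def using emeasure_bounded_finite[OF Qb] by (intro emeasure_eq_ennreal_measure) auto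
  have Qn: "norm y \<le> t / 2" if "y \<in> ?Q" for y
    using norm_cube[OF that] l by (simp add: n_def)
  have Qt: "norm y \<le> t" if "y \<in> ?Q" for y
    using Qn[OF that] t by linarith
  have A: "A x = (1 / c) *\<^sub>R (LINT y:?Q|lborel. f (x + y))" for x by (simp add: A_def c_def)
  show Am: "A \<in> borel_measurable borel"
    unfolding A_def set_lebesgue_integral_def by measurable
  have Al: "A \<in> borel_measurable lebesgue" using Am by (simp add: measurable_completion)
  have "f x - A x = (- 1 / c) *\<^sub>R (LINT y:?Q|lborel. f (x + y) - f x)" for x
    using c Qt by (subst increment_mean_nrm(3)[OF Q Qb, of t]) (auto simp: A c_def[symmetric] scaleR_diff_right)
  then have "nrm (\<lambda>x. f x - A x) = nrm (\<lambda>x. (- 1 / c) *\<^sub>R (LINT y:?Q|lborel. f (x + y) - f x))"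
    by (simp only:)
  also have "\<dots> = ennreal \<bar>- 1 / c\<bar> * nrm (\<lambda>x. LINT y:?Q|lborel. f (x + y) - f x)"
    using increment_mean_nrm(2)[OF Q Qb, of t] Qt by (intro nrm_scaleR) (auto simp: measurable_completion)
  also have "\<bar>- 1 / c\<bar> = 1 / c" using c by simp
  also have "ennreal (1 / c) * nrm (\<lambda>x. LINT y:?Q|lborel. f (x + y) - f x) \<le> ennreal (1 / c) * (ennreal c * ?m f t)"
    using Qt Qe increment_mean_nrm(1)[OF Q Qb, of t] by (intro mult_left_mono) auto
  also have "\<dots> = ?m f t"
    using c by (simp add: mult.assoc[symmetric] ennreal_mult'[symmetric])
  finally show "nrm (\<lambda>x. f x - A x) \<le> ?m f t" .
  show le: "?m A u \<le> ?m f u" for u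
    unfolding modulus_bfs[of A]
  proof (intro SUP_least)
    fix h :: "real ^ 'n" assume h: "h \<in> {h. norm h \<le> u}"
    define g where "g x = f (x + h) - f x" for x
    have [measurable]: "g \<in> borel_measurable borel" unfolding g_def by measurable
    have gl: "g \<in> borel_measurable lebesgue" by (simp add: measurable_completion)
    have si: "set_integrable lborel ?Q (\<lambda>y. f (x + y))" for x by (rule locally_integrable[OF Q Qb])
    have gi: "(\<lambda>y. f ((x + h) + y) - f (x + y)) = (\<lambda>y. g (x + y))" for x by (simp add: g_def add_ac)
    have eq: "A (x + h) - A x = (1 / c) *\<^sub>R (LINT y:?Q|lborel. g (x + y))" for x
      using set_integral_diff(2)[OF si[of "x + h"] si[of x]] by (simp add: A gi scaleR_diff_right)
    have "(\<lambda>(x, y). g (x + y)) \<in> borel_measurable (borel \<Otimes>\<^sub>M borel)" by measurable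
    from nrm_set_integral_le[OF Q _ this, of "nrm g"] Qe
    have gm: "(\<lambda>x. LINT y:?Q|lborel. g (x + y)) \<in> borel_measurable borel"
      and "nrm (\<lambda>x. LINT y:?Q|lborel. g (x + y)) \<le> ennreal c * nrm g"
      using nrm_translate[OF gl] by auto
    then have "ennreal (1 / c) * nrm (\<lambda>x. LINT y:?Q|lborel. g (x + y)) \<le> ennreal (1 / c) * (ennreal c * nrm g)"
      by (intro mult_left_mono) auto
    also have "\<dots> = nrm g"
      using c by (simp add: mult.assoc[symmetric] ennreal_mult'[symmetric])
    also have "\<dots> \<le> ?m f u" using h modulus_upper[of h u f] by (simp add: g_def[abs_def])
    finally show "nrm (\<lambda>x. A (x + h) - A x) \<le> ?m f u"
      using gm c by (simp add: eq nrm_scaleR measurable_completion)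
  qed
  assume u: "0 < u" "u \<le> t"
  show "?m A u \<le> ennreal (4 * (real CARD('n))\<^sup>2 * (u / t)) * ?m f t"
  proof (cases "u \<le> l")
    case False
    \<comment> \<open>Here the asserted factor is at least 1 and smoothness is not an issue.\<close>
    have "1 * 1 \<le> 2 * n * (u / l)" using False l n by (intro mult_mono) (auto simp: field_simps)
    also have "\<dots> = 4 * n\<^sup>2 * (u / t)" using l n by (simp add: field_simps power2_eq_square flip: l(2))
    finally have "1 \<le> ennreal (4 * n\<^sup>2 * (u / t))" by simp
    have "?m A u \<le> ?m f u" by (rule le)
    also have "\<dots> \<le> 1 * ?m f t" unfolding modulus_bfs using u by (auto intro!: SUP_subset_mono)
    also have "\<dots> \<le> ennreal (4 * n\<^sup>2 * (u / t)) * ?m f t"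
      by (intro mult_right_mono) (use \<open>1 \<le> ennreal _\<close> in auto)
    finally show ?thesis by (simp add: n_def)
  next
    case True
    show ?thesis
      unfolding modulus_bfs[of A]
    proof (intro SUP_least)
      fix h :: "real ^ 'n" assume "h \<in> {h. norm h \<le> u}"
      then have h: "norm h \<le> u" "norm h \<le> l" using True by auto
      let ?hQ = "(+) h ` ?Q"
      have hQe: "?hQ = cbox h (h + (\<chi> i. l))"
        using cbox_translation[of h 0 "\<chi> i. l"] by (simp add: cube_def)
      have hQ [measurable]: "?hQ \<in> sets borel" and hQb: "bounded ?hQ" unfolding hQe by auto
      have hQc: "measure lborel ?hQ = c"
        using l unfolding c_def hQe by (simp add: cube_def content_cbox_if_cart interval_eq_empty_cart not_less)
      define D1 D2 where "D1 = ?hQ - ?Q" and "D2 = ?Q - ?hQ"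
      have D [measurable]: "D1 \<in> sets borel" "D2 \<in> sets borel" and Db: "bounded D1" "bounded D2"
        using Qb hQb by (auto simp: D1_def D2_def intro: bounded_subset)
      have "l \<le> n * l" using mult_right_mono[of 1 n l] l n by simp
      moreover have "t = n * l + n * l" using l(2) by (simp add: mult_ac)
      ultimately have lt: "l \<le> t / 2" by linarith
      have Dr: "norm y \<le> t" if "y \<in> D1 \<or> y \<in> D2" for y
      proof (cases "y \<in> D1")
        case True
        then obtain z where "z \<in> ?Q" "y = h + z" by (auto simp: D1_def)
        then show ?thesis using Qn[of z] h lt norm_triangle_ineq[of h z] by simp
      next
        case False
        then have "y \<in> ?Q" using that by (auto simp: D2_def)
        then show ?thesis using Qn[of y] t by simp
      qed
      have fm: "?Q \<in> fmeasurable lborel" "?hQ \<in> fmeasurable lborel"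
        unfolding hQe by (simp_all add: cube_def)
      have "measure lborel (?Q \<union> ?hQ) = measure lborel ?Q + measure lborel D1"
        "measure lborel (?hQ \<union> ?Q) = measure lborel ?hQ + measure lborel D2"
        unfolding D1_def D2_def by (rule measure_Un2[OF fm] measure_Un2[OF fm(2,1)])+
      then have Dm: "measure lborel D1 = measure lborel D2" using hQc by (simp add: c_def Un_commute)
      have De: "emeasure lborel D1 = ennreal (measure lborel D1)" "emeasure lborel D2 = ennreal (measure lborel D2)"
        using emeasure_bounded_finite[OF Db(1)] emeasure_bounded_finite[OF Db(2)]
        by (auto intro!: emeasure_eq_ennreal_measure)
      define J where "J D x = (LINT y:D|lborel. f (x + y) - f x)" for D x
      have eq: "A (x + h) - A x = (1 / c) *\<^sub>R (J D1 x - J D2 x)" for x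
      proof -
        let ?I = "\<lambda>D. LINT y:D|lborel. f (x + y)"
        have sum: "?I ?hQ + ?I D2 = ?I ?Q + ?I D1"
        proof -
          have "?I ?hQ + ?I D2 = ?I (?hQ \<union> D2)"
            by (rule set_integral_Un[symmetric]) (auto simp: D2_def intro!: locally_integrable Qb hQb bounded_diff)
          moreover have "?I ?Q + ?I D1 = ?I (?Q \<union> D1)"
            by (rule set_integral_Un[symmetric]) (auto simp: D1_def intro!: locally_integrable Qb hQb bounded_diff)
          moreover have "?hQ \<union> D2 = ?Q \<union> D1" by (auto simp: D1_def D2_def)
          ultimately show ?thesis by simp
        qed
        have "J D1 x - J D2 x = ?I D1 - ?I D2"
          unfolding J_def using Dr
          by (simp add: increment_mean_nrm(3)[OF D(1) Db(1), of t] increment_mean_nrm(3)[OF D(2) Db(2), of t] Dm)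
        also have "\<dots> = ?I ?hQ - ?I ?Q" using sum by (simp add: algebra_simps)
        also have "?I ?hQ = (LINT y:?Q|lborel. f ((x + h) + y))" by (rule mean_translate[OF Q hQ, symmetric])
        finally show ?thesis by (simp add: A scaleR_diff_right)
      qed
      have Jm: "J D1 \<in> borel_measurable lebesgue" "J D2 \<in> borel_measurable lebesgue"
        unfolding J_def using increment_mean_nrm(2)[OF D(1) Db(1), of t] increment_mean_nrm(2)[OF D(2) Db(2), of t] Dr
        by (auto simp: measurable_completion)
      have "nrm (\<lambda>x. J D1 x - J D2 x) \<le> nrm (J D1) + nrm (J D2)"
        using Jm by (intro nrm_le_add norm_triangle_ineq4) auto
      also have "\<dots> \<le> ennreal (measure lborel D1) * ?m f t + ennreal (measure lborel D2) * ?m f t"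
        unfolding J_def De[symmetric] using Dr
        by (intro add_mono increment_mean_nrm(1) D Db) auto
      also have "\<dots> \<le> ennreal (n * u / l * c) * ?m f t + ennreal (n * u / l * c) * ?m f t"
      proof -
        have "n * norm h / l * c \<le> n * u / l * c"
          using h n l c by (intro mult_right_mono divide_right_mono mult_left_mono) auto
        then show ?thesis
          using measure_cube_shift[OF l(1) h(2)] unfolding D1_def D2_def c_def[symmetric] n_def[symmetric]
          by (intro add_mono mult_right_mono ennreal_leI) auto
      qed
      also have "\<dots> = ennreal c * (ennreal (4 * n\<^sup>2 * (u / t)) * ?m f t)"
      proof -
        have two: "2 * (n * u / l * c) = c * (4 * n\<^sup>2 * (u / t))"
          using l n by (simp add: field_simps power2_eq_square flip: l(2))
        have "ennreal (n * u / l * c) + ennreal (n * u / l * c) = ennreal (n * u / l * c + n * u / l * c)"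
          using n u l c by (intro ennreal_plus[symmetric]) auto
        also have "\<dots> = ennreal (c * (4 * n\<^sup>2 * (u / t)))"
          unfolding two[symmetric] mult_2 ..
        also have "\<dots> = ennreal c * ennreal (4 * n\<^sup>2 * (u / t))"
          using c by (intro ennreal_mult') auto
        finally show ?thesis unfolding distrib_right[symmetric] by (simp only: mult.assoc)
      qed
      finally have "ennreal (1 / c) * nrm (\<lambda>x. J D1 x - J D2 x) \<le> ennreal (1 / c) * (ennreal c * (ennreal (4 * n\<^sup>2 * (u / t)) * ?m f t))"
        by (intro mult_left_mono) auto
      also have "\<dots> = ennreal (4 * n\<^sup>2 * (u / t)) * ?m f t"
        using c by (simp add: mult.assoc[symmetric] ennreal_mult'[symmetric])
      finally show "nrm (\<lambda>x. A (x + h) - A x) \<le> ennreal (4 * (real CARD('n))\<^sup>2 * (u / t)) * ?m f t"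
        using Jm c by (simp add: eq nrm_scaleR n_def)
    qed
  qed
qed

end

end

text \<open>
  \<open>f1\<close> is the mean of \<open>f\<close> at scale \<open>t\<close>. The remainder \<open>f0\<close> has norm at most
  \<open>modulus E f t\<close>, which bounds its modulus at large arguments; at small arguments its modulus is
  bounded by the sum of those of \<open>f\<close> and \<open>f1\<close>.
\<close>
proposition smoothing_decomposition:
  fixes f :: "real ^ 'n \<Rightarrow> 's::{real_normed_field, euclidean_space}"
  assumes E: "ri_bfs E" and f: "f \<in> fst E" and t: "0 < t"
  obtains f0 f1 where "f0 \<in> fst E" "f1 \<in> fst E" "f = (\<lambda>x. f0 x + f1 x)"
    "\<And>u. 0 < u \<Longrightarrow> modulus E f0 u \<le> 2 * modulus E f (min u t)"
    "\<And>u. 0 < u \<Longrightarrow> modulus E f1 u \<le> modulus E f u"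
    "\<And>u. 0 < u \<Longrightarrow> u \<le> t \<Longrightarrow> modulus E f1 u \<le> ennreal (4 * (real CARD('n))\<^sup>2 * (u / t)) * modulus E f t"
proof -
  obtain N where N: "ri_norm lebesgue N" and EN: "E = bfs lebesgue N" using E by (auto simp: ri_bfs_def)
  have fE: "g \<in> fst E \<longleftrightarrow> g \<in> borel_measurable lebesgue \<and> nrm N g < top" for g :: "real ^ 'n \<Rightarrow> 's"
    by (simp add: EN bfs_def nrm_def[OF N])
  have fm: "f \<in> borel_measurable lebesgue" "nrm N f < top" using f by (auto simp: fE)
  obtain g where g: "g \<in> borel_measurable borel" "AE x in lebesgue. f x = g x"
    using lebesgue_ae_borel[OF fm(1)] by blast
  have gl: "g \<in> borel_measurable lebesgue" using g(1) by (simp add: measurable_completion)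
  have gfin: "nrm N g < top" using nrm_cong_AE[OF N fm(1) gl g(2)] fm(2) by simp
  have mod: "modulus E f u = modulus E g u" for u
    unfolding EN by (rule modulus_cong_AE[OF N fm(1) gl g(2)])
  define f1 where "f1 = (\<lambda>x. (1 / measure lborel (cube (t / (2 * real CARD('n))) :: (real ^ 'n) set)) *\<^sub>R (LINT y:cube (t / (2 * real CARD('n)))|lborel. g (x + y)))"
  note mean = mean_approximation[OF N g(1) gfin t]
  have ma: "f1 \<in> borel_measurable borel" "nrm N (\<lambda>x. g x - f1 x) \<le> modulus E g t" "modulus E f1 u \<le> modulus E g u"
    "0 < u \<Longrightarrow> u \<le> t \<Longrightarrow> modulus E f1 u \<le> ennreal (4 * (real CARD('n))\<^sup>2 * (u / t)) * modulus E g t" for u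
    unfolding f1_def EN by (rule mean; assumption)+
  define f0 where "f0 x = f x - f1 x" for x
  have f1l: "f1 \<in> borel_measurable lebesgue" using ma(1) by (simp add: measurable_completion)
  have f0l: "f0 \<in> borel_measurable lebesgue" unfolding f0_def using fm(1) f1l by measurable
  have gf1: "(\<lambda>x. g x - f1 x) \<in> borel_measurable lebesgue" using gl f1l by measurable
  have "nrm N f0 = nrm N (\<lambda>x. g x - f1 x)"
    using g(2) by (intro nrm_cong_AE[OF N f0l gf1]) (auto simp: f0_def)
  then have f0n: "nrm N f0 \<le> modulus E f t" using ma(2) mod by simp
  have "modulus E f t \<le> 2 * nrm N f" unfolding EN by (rule modulus_le_nrm[OF N fm(1)])
  then have f0fin: "nrm N f0 < top" using f0n fm(2) by (meson ennreal_mult_less_top ennreal_numeral_less_top le_less_trans)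
  have f1_le: "norm (f1 x) \<le> norm (f x) + norm (f0 x)" for x
    using norm_triangle_ineq4[of "f x" "f0 x"] by (simp add: f0_def)
  have "nrm N f1 \<le> nrm N f + nrm N f0"
    using fm(1) f0l f1l f1_le by (intro nrm_le_add[OF N]) auto
  then have f1fin: "nrm N f1 < top" using f0fin fm(2) by (simp add: le_less_trans)
  have le1: "modulus E f1 u \<le> modulus E f u" for u using ma(3) mod by simp
  have f0_diff: "norm (f0 y - f0 x) \<le> norm (f y - f x) + norm (f1 y - f1 x)" for x y
    using norm_triangle_ineq4[of "f y - f x" "f1 y - f1 x"] by (simp add: f0_def algebra_simps)
  show thesis
  proof (rule that)
    show "f0 \<in> fst E" "f1 \<in> fst E" using f0l f0fin f1l f1fin by (auto simp: fE)
    show "f = (\<lambda>x. f0 x + f1 x)" by (simp add: f0_def)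
    show "modulus E f1 u \<le> modulus E f u" for u by (rule le1)
    show "modulus E f1 u \<le> ennreal (4 * (real CARD('n))\<^sup>2 * (u / t)) * modulus E f t" if "0 < u" "u \<le> t" for u
      using ma(4)[OF that] mod by simp
    fix u :: real
    show "modulus E f0 u \<le> 2 * modulus E f (min u t)"
    proof (cases "u \<le> t")
      case True
      have "modulus E f0 u \<le> modulus E f u + modulus E f1 u"
        unfolding EN by (rule modulus_le_add[OF N f0l fm(1) f1l])
          (rule f0_diff)
      also have "\<dots> \<le> 2 * modulus E f u" using le1[of u] by (simp add: mult_2 add_left_mono)
      finally show ?thesis using True by simp
    next
      case False
      have "modulus E f0 u \<le> 2 * nrm N f0" unfolding EN by (rule modulus_le_nrm[OF N f0l])
      also have "\<dots> \<le> 2 * modulus E f t" using f0n by (intro mult_left_mono) auto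
      finally show ?thesis using False by simp
    qed
  qed
qed

section \<open>Hardy's inequality for two-sided sequences\<close>

abbreviation total_sum :: "('i \<Rightarrow> ennreal) \<Rightarrow> ennreal" (binder "\<Sum>\<^sup>+ " 10) where
  "total_sum f \<equiv> \<integral>\<^sup>+ i. f i \<partial>count_space UNIV"

lemma nn_integral_count_space_ge:
  fixes f :: "'i \<Rightarrow> ennreal"
  assumes "i \<in> A"
  shows "f i \<le> (\<integral>\<^sup>+ j. f j \<partial>count_space A)"
proof -
  have "f i = (\<integral>\<^sup>+ j. f j * indicator {i} j \<partial>count_space A)"
    using assms by (subst nn_integral_indicator_singleton) auto
  also have "\<dots> \<le> (\<integral>\<^sup>+ j. f j \<partial>count_space A)"
    by (intro nn_integral_mono) (auto simp: indicator_def)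
  finally show ?thesis .
qed

lemma nn_integral_geometric:
  assumes "0 \<le> l" "l < 1"
  shows "(\<Sum>\<^sup>+ i. ennreal (l ^ i)) = ennreal (1 / (1 - l))"
  using assms summable_geometric[of l] suminf_geometric[of l]
  by (simp add: nn_integral_count_space_nat suminf_ennreal2)

text \<open>
  With \<open>r = sqrt l\<close>, the inner sum is at most \<open>1 / (1 - r)\<close> times the supremum of
  \<open>r ^ i * x (s i k)\<close> over \<open>i\<close>, and the \<open>p\<close>-th power of the supremum is at most the sum of
  the \<open>p\<close>-th powers. This treats \<open>p \<le> 1\<close> and \<open>p \<ge> 1\<close> alike. Since each
  \<open>s i\<close> is a bijection, summation over \<open>k\<close> restores the full sum of the powers of \<open>x\<close>.
\<close>
lemma convolution_geometric_le:
  fixes x :: "int \<Rightarrow> ennreal"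
  assumes l: "0 < l" "l < 1" and p: "0 < p" and s: "\<And>i. bij (s i)"
  shows "(\<Sum>\<^sup>+ k. epowr (\<Sum>\<^sup>+ i. ennreal (l ^ i) * x (s i k)) p)
       \<le> ennreal ((1 / (1 - sqrt l)) powr p * (1 / (1 - sqrt l powr p))) *
         (\<Sum>\<^sup>+ k. epowr (x k) p)"
proof -
  define r where "r = sqrt l"
  have r: "0 < r" "r < 1" "r * r = l" using l by (auto simp: r_def)
  have rp: "0 < r powr p" "r powr p < 1"
    using r p powr_less_mono2[of p r 1] by auto
  let ?C = "1 / (1 - r)"
  have point: "epowr (\<Sum>\<^sup>+ i. ennreal (l ^ i) * x (s i k)) p
     \<le> ennreal (?C powr p) * (\<Sum>\<^sup>+ i. ennreal ((r powr p) ^ i) * epowr (x (s i k)) p)"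
    (is "epowr ?S p \<le> _ * ?T") for k
  proof -
    have "ennreal (r ^ i) * x (s i k) \<le> epowr ?T (1 / p)" for i
    proof -
      have "epowr (ennreal (r ^ i) * x (s i k)) p = ennreal ((r powr p) ^ i) * epowr (x (s i k)) p"
        using p r by (simp add: epowr_mult epowr_ennreal powr_realpow[symmetric] powr_powr mult.commute)
      also have "\<dots> \<le> ?T" by (rule nn_integral_count_space_ge) simp
      finally have "epowr (epowr (ennreal (r ^ i) * x (s i k)) p) (1 / p) \<le> epowr ?T (1 / p)"
        using p by (intro epowr_mono) auto
      then show ?thesis using p by (simp add: epowr_epowr)
    qed
    then have "?S \<le> (\<Sum>\<^sup>+ i. ennreal (r ^ i) * epowr ?T (1 / p))"
      using r by (intro nn_integral_mono)
        (auto simp: r(3)[symmetric] power_mult_distrib ennreal_mult mult.assoc intro!: mult_left_mono)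
    also have "\<dots> = ennreal ?C * epowr ?T (1 / p)"
      using r by (simp add: nn_integral_multc nn_integral_geometric)
    finally have "epowr ?S p \<le> epowr (ennreal ?C * epowr ?T (1 / p)) p"
      using p by (intro epowr_mono) auto
    also have "\<dots> = ennreal (?C powr p) * ?T"
      using p r by (simp add: epowr_mult epowr_ennreal epowr_epowr)
    finally show ?thesis .
  qed
  have "(\<Sum>\<^sup>+ k. epowr (\<Sum>\<^sup>+ i. ennreal (l ^ i) * x (s i k)) p)
      \<le> (\<Sum>\<^sup>+ k. ennreal (?C powr p) * (\<Sum>\<^sup>+ i. ennreal ((r powr p) ^ i) * epowr (x (s i k)) p))"
    by (intro nn_integral_mono point)
  also have "\<dots> = ennreal (?C powr p) * (\<Sum>\<^sup>+ k. (\<Sum>\<^sup>+ i. ennreal ((r powr p) ^ i) * epowr (x (s i k)) p))"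
    by (subst nn_integral_cmult) auto
  also have "(\<Sum>\<^sup>+ k. (\<Sum>\<^sup>+ i. ennreal ((r powr p) ^ i) * epowr (x (s i k)) p))
     = (\<Sum>\<^sup>+ i. (\<Sum>\<^sup>+ k. ennreal ((r powr p) ^ i) * epowr (x (s i k)) p))"
    by (subst nn_integral_count_space_nn_integral) auto
  also have "\<dots> = (\<Sum>\<^sup>+ i. ennreal ((r powr p) ^ i) * (\<Sum>\<^sup>+ k. epowr (x k) p))"
  proof (intro nn_integral_cong)
    fix i :: nat
    show "(\<Sum>\<^sup>+ k. ennreal ((r powr p) ^ i) * epowr (x (s i k)) p)
      = ennreal ((r powr p) ^ i) * (\<Sum>\<^sup>+ k. epowr (x k) p)"
      using nn_integral_bij_count_space[OF s[of i], of "\<lambda>k. epowr (x k) p"]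
      by (simp add: nn_integral_cmult)
  qed
  also have "\<dots> = ennreal (1 / (1 - r powr p)) * (\<Sum>\<^sup>+ k. epowr (x k) p)"
    using rp by (simp add: nn_integral_multc nn_integral_geometric)
  finally show ?thesis unfolding r_def[symmetric]
    using rp r by (subst ennreal_mult) (auto simp only: mult.assoc, auto)
qed

text \<open>
  If the weight grows geometrically along \<open>i \<mapsto> s i k\<close>, then summing the \<open>r\<close>-th powers of \<open>a\<close>
  along these chains enlarges the weighted quasi-norm with exponent \<open>q\<close> by a constant factor only. The choices
  \<open>s i k = k - i\<close> and \<open>s i k = k + i\<close> give the two Hardy inequalities.
\<close>
lemma weighted_hardy:
  fixes a W :: "int \<Rightarrow> ennreal"
  assumes l: "0 < l" "l < 1" and q: "0 < q" and r: "0 < r" and c: "0 < c" and s: "\<And>i. bij (s i)"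
    and W: "\<And>i k. W k \<le> ennreal (c * l ^ i) * W (s i k)"
  shows "\<exists>C>0. \<forall>a. (\<Sum>\<^sup>+ k. epowr (W k * epowr (\<Sum>\<^sup>+ i. epowr (a (s i k)) r) (1 / r)) q)
       \<le> ennreal C * (\<Sum>\<^sup>+ k. epowr (W k * a k) q)"
proof -
  define m where "m = l powr r"
  define p where "p = q / r"
  have m: "0 < m" "m < 1" and p: "0 < p"
    using l r q powr_less_mono2[of r l 1] by (auto simp: m_def p_def)
  define C0 where "C0 = (1 / (1 - sqrt m)) powr p * (1 / (1 - sqrt m powr p))"
  have sm: "0 < sqrt m" "sqrt m < 1" using m by auto
  have "0 < C0"
    unfolding C0_def using sm p powr_less_mono2[of p "sqrt m" 1] by (intro mult_pos_pos) auto
  show ?thesis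
  proof (intro exI[of _ "c powr q * C0"] conjI allI)
    show "0 < c powr q * C0" using \<open>0 < C0\<close> c by simp
    fix a :: "int \<Rightarrow> ennreal"
    have point: "epowr (W k * epowr (\<Sum>\<^sup>+ i. epowr (a (s i k)) r) (1 / r)) q
      \<le> ennreal (c powr q) * epowr (\<Sum>\<^sup>+ i. ennreal (m ^ i) * epowr (W (s i k) * a (s i k)) r) p" for k
    proof -
      let ?A = "(\<Sum>\<^sup>+ i. epowr (a (s i k)) r)"
      have "epowr (W k) r * ?A = (\<Sum>\<^sup>+ i. epowr (W k) r * epowr (a (s i k)) r)"
        by (simp add: nn_integral_cmult)
      also have "\<dots> \<le> (\<Sum>\<^sup>+ i. ennreal (c powr r) * (ennreal (m ^ i) * epowr (W (s i k) * a (s i k)) r))"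
      proof (intro nn_integral_mono)
        fix i :: nat
        have "epowr (W k) r * epowr (a (s i k)) r \<le> epowr (ennreal (c * l ^ i) * W (s i k)) r * epowr (a (s i k)) r"
          using W r by (intro mult_right_mono epowr_mono) auto
        also have "\<dots> = ennreal (c powr r) * (ennreal (m ^ i) * epowr (W (s i k) * a (s i k)) r)"
        proof -
          have "(c * l ^ i) powr r = c powr r * m ^ i"
            using c l by (simp add: m_def powr_mult powr_realpow[symmetric] powr_powr mult.commute)
          then have "ennreal ((c * l ^ i) powr r) = ennreal (c powr r) * ennreal (m ^ i)"
            using m by (simp add: ennreal_mult)
          moreover have "epowr (ennreal (c * l ^ i)) r = ennreal ((c * l ^ i) powr r)"
            using c l by (intro epowr_ennreal) auto
          ultimately show ?thesis using r by (simp only: epowr_mult mult.assoc)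
        qed
        finally show "epowr (W k) r * epowr (a (s i k)) r \<le> ennreal (c powr r) * (ennreal (m ^ i) * epowr (W (s i k) * a (s i k)) r)" .
      qed
      also have "\<dots> = ennreal (c powr r) * (\<Sum>\<^sup>+ i. ennreal (m ^ i) * epowr (W (s i k) * a (s i k)) r)" (is "_ = _ * ?B")
        by (simp add: nn_integral_cmult)
      finally have "epowr (epowr (W k) r * ?A) p \<le> epowr (ennreal (c powr r) * ?B) p"
        using p by (intro epowr_mono) auto
      then show ?thesis using r q p c
        by (simp add: epowr_mult epowr_epowr epowr_ennreal powr_powr p_def)
    qed
    have "(\<Sum>\<^sup>+ k. epowr (W k * epowr (\<Sum>\<^sup>+ i. epowr (a (s i k)) r) (1 / r)) q)
       \<le> ennreal (c powr q) * (\<Sum>\<^sup>+ k. epowr (\<Sum>\<^sup>+ i. ennreal (m ^ i) * epowr (W (s i k) * a (s i k)) r) p)"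
      using point by (subst nn_integral_cmult[symmetric]) (auto intro!: nn_integral_mono)
    also have "\<dots> \<le> ennreal (c powr q) * (ennreal C0 * (\<Sum>\<^sup>+ k. epowr (epowr (W k * a k) r) p))"
      unfolding C0_def using convolution_geometric_le[OF m p s, of "\<lambda>k. epowr (W k * a k) r"] by (intro mult_left_mono) auto
    also have "\<dots> = ennreal (c powr q * C0) * (\<Sum>\<^sup>+ k. epowr (W k * a k) q)"
      using \<open>0 < C0\<close> r by (simp add: epowr_epowr p_def ennreal_mult mult.assoc)
    finally show "(\<Sum>\<^sup>+ k. epowr (W k * epowr (\<Sum>\<^sup>+ i. epowr (a (s i k)) r) (1 / r)) q)
       \<le> ennreal (c powr q * C0) * (\<Sum>\<^sup>+ k. epowr (W k * a k) q)" .
  qed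
qed

section \<open>Comparison of integrals with step functions\<close>

text \<open>
  The nonnegative integral is monotone for all functions, measurable or not, so any function can be
  enclosed between measurable step functions. This generality serves the Besov weight, which
  contains \<open>b \<circ> \<rho>\<close>: a Lebesgue measurable function composed with \<open>\<rho>\<close> can fail to be measurable.
\<close>
lemma nn_integral_le_steps:
  fixes f :: "'a \<Rightarrow> ennreal"
  assumes A: "\<And>i::'i::countable. A i \<in> sets M" and cover: "B \<subseteq> (\<Union>i. A i)"
    and \<beta>: "\<And>i. (\<lambda>x. \<beta> i x * indicator (A i) x) \<in> borel_measurable M"
    and le: "\<And>i x. x \<in> A i \<Longrightarrow> x \<in> B \<Longrightarrow> f x \<le> c i * \<beta> i x"
  shows "(\<integral>\<^sup>+ x\<in>B. f x \<partial>M) \<le> (\<Sum>\<^sup>+ i. c i * (\<integral>\<^sup>+ x\<in>A i. \<beta> i x \<partial>M))"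
proof -
  have "(\<integral>\<^sup>+ x\<in>B. f x \<partial>M) \<le> (\<integral>\<^sup>+ x. (\<Sum>\<^sup>+ i. c i * (\<beta> i x * indicator (A i) x)) \<partial>M)"
  proof (intro nn_integral_mono)
    fix x
    show "f x * indicator B x \<le> (\<Sum>\<^sup>+ i. c i * (\<beta> i x * indicator (A i) x))"
    proof (cases "x \<in> B")
      case True
      then obtain i where i: "x \<in> A i" using cover by blast
      then have "f x * indicator B x \<le> c i * (\<beta> i x * indicator (A i) x)" using le True by simp
      also have "\<dots> \<le> (\<Sum>\<^sup>+ i. c i * (\<beta> i x * indicator (A i) x))"
        by (rule nn_integral_count_space_ge) simp
      finally show ?thesis .
    qed simp
  qed
  also have "\<dots> = (\<Sum>\<^sup>+ i. (\<integral>\<^sup>+ x. c i * (\<beta> i x * indicator (A i) x) \<partial>M))"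
    using \<beta> by (intro nn_integral_count_space_nn_integral) auto
  also have "\<dots> = (\<Sum>\<^sup>+ i. c i * (\<integral>\<^sup>+ x\<in>A i. \<beta> i x \<partial>M))"
    using \<beta> by (intro nn_integral_cong nn_integral_cmult) auto
  finally show ?thesis .
qed

lemma nn_integral_ge_steps:
  fixes f :: "'a \<Rightarrow> ennreal"
  assumes A: "\<And>i::'i::countable. A i \<subseteq> B" and disj: "disjoint_family A"
    and \<beta>: "\<And>i. (\<lambda>x. \<beta> i x * indicator (A i) x) \<in> borel_measurable M"
    and le: "\<And>i x. x \<in> A i \<Longrightarrow> c i * \<beta> i x \<le> f x"
  shows "(\<Sum>\<^sup>+ i. c i * (\<integral>\<^sup>+ x\<in>A i. \<beta> i x \<partial>M)) \<le> (\<integral>\<^sup>+ x\<in>B. f x \<partial>M)"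
proof -
  have "(\<Sum>\<^sup>+ i. c i * (\<integral>\<^sup>+ x\<in>A i. \<beta> i x \<partial>M))
      = (\<Sum>\<^sup>+ i. (\<integral>\<^sup>+ x. c i * (\<beta> i x * indicator (A i) x) \<partial>M))"
    using \<beta> by (intro nn_integral_cong nn_integral_cmult[symmetric]) auto
  also have "\<dots> = (\<integral>\<^sup>+ x. (\<Sum>\<^sup>+ i. c i * (\<beta> i x * indicator (A i) x)) \<partial>M)"
    using \<beta> by (intro nn_integral_count_space_nn_integral[symmetric]) auto
  also have "\<dots> \<le> (\<integral>\<^sup>+ x\<in>B. f x \<partial>M)"
  proof (intro nn_integral_mono)
    fix x
    show "(\<Sum>\<^sup>+ i. c i * (\<beta> i x * indicator (A i) x)) \<le> f x * indicator B x"
    proof (cases "\<exists>i. x \<in> A i")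
      case True
      then obtain i where i: "x \<in> A i" by blast
      then have "(\<Sum>\<^sup>+ j. c j * (\<beta> j x * indicator (A j) x))
        = (\<Sum>\<^sup>+ j. c j * \<beta> i x * indicator {i} j)"
        using disj by (intro nn_integral_cong) (auto simp: disjoint_family_on_def indicator_def)
      also have "\<dots> = c i * \<beta> i x"
        using i by (subst nn_integral_indicator_singleton) auto
      finally show ?thesis using le[OF i] A[of i] i by (auto simp: subset_iff)
    next
      case False
      then show ?thesis by simp
    qed
  qed
  finally show ?thesis .
qed

section \<open>Slowly varying weights and their tails\<close>

text \<open>
  The two monotone equivalents in the definition say that a slowly varying function changes by less
  than any power, in both directions.
\<close>
lemma SV_ratio:
  assumes "b \<in> SV" "0 < \<epsilon>"
  shows "\<exists>C>0. \<forall>s t. 0 < s \<longrightarrow> s \<le> t \<longrightarrow>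
           b t \<le> C * (t / s) powr \<epsilon> * b s \<and> b s \<le> C * (t / s) powr \<epsilon> * b t"
proof -
  from assms obtain g h where g: "mono_on {0<..} g" "equiv_pos (\<lambda>t. t powr \<epsilon> * b t) g"
    and h: "antimono_on {0<..} h" "equiv_pos (\<lambda>t. t powr (- \<epsilon>) * b t) h"
    unfolding SV_def by blast
  obtain c1 c2 where c: "c1 > 0" "c2 > 0" "\<And>t. t > 0 \<Longrightarrow> t powr \<epsilon> * b t \<le> c1 * g t"
    "\<And>t. t > 0 \<Longrightarrow> g t \<le> c2 * (t powr \<epsilon> * b t)"
    using g(2) unfolding equiv_pos_def by blast
  obtain d1 d2 where d: "d1 > 0" "d2 > 0" "\<And>t. t > 0 \<Longrightarrow> t powr (-\<epsilon>) * b t \<le> d1 * h t"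
    "\<And>t. t > 0 \<Longrightarrow> h t \<le> d2 * (t powr (-\<epsilon>) * b t)"
    using h(2) unfolding equiv_pos_def by blast
  have bpos: "t > 0 \<Longrightarrow> b t > 0" for t using assms(1) by (auto simp: SV_def)
  show ?thesis
  proof (intro exI[of _ "c1 * c2 + d1 * d2"] conjI allI impI)
    show "0 < c1 * c2 + d1 * d2" using c d by (simp add: add_pos_pos)
    fix s t :: real assume st: "0 < s" "s \<le> t"
    have "t powr (-\<epsilon>) * b t \<le> d1 * h t" using d st by auto
    also have "\<dots> \<le> d1 * h s" using h(1) d st by (intro mult_left_mono) (auto simp: monotone_on_def)
    also have "\<dots> \<le> d1 * (d2 * (s powr (-\<epsilon>) * b s))" using d st by (intro mult_left_mono) auto
    finally have 1: "b t \<le> d1 * d2 * (t / s) powr \<epsilon> * b s"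
      using st by (simp add: powr_minus powr_divide field_simps)
    have "s powr \<epsilon> * b s \<le> c1 * g s" using c st by auto
    also have "\<dots> \<le> c1 * g t" using g(1) c st by (intro mult_left_mono) (auto simp: monotone_on_def)
    also have "\<dots> \<le> c1 * (c2 * (t powr \<epsilon> * b t))" using c st by (intro mult_left_mono) auto
    finally have 2: "b s \<le> c1 * c2 * (t / s) powr \<epsilon> * b t"
      using st by (simp add: powr_divide field_simps)
    have "0 \<le> c1 * c2 * (t / s) powr \<epsilon> * b s" "0 \<le> d1 * d2 * (t / s) powr \<epsilon> * b t"
      using c d bpos[of s] bpos[of t] st by (auto intro!: mult_nonneg_nonneg)
    with 1 2 show "b t \<le> (c1 * c2 + d1 * d2) * (t / s) powr \<epsilon> * b s"
      "b s \<le> (c1 * c2 + d1 * d2) * (t / s) powr \<epsilon> * b t" by (simp_all add: distrib_right)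
  qed
qed

lemma nn_integral_powr_interval:
  assumes "0 < p" "0 < t"
  shows "(\<integral>\<^sup>+ u\<in>{0<..t}. ennreal (u powr (p - 1)) \<partial>lebesgue) = ennreal (t powr p / p)"
proof -
  have "((\<lambda>u. u powr (p - 1)) has_integral (t powr (p - 1 + 1) / (p - 1 + 1))) {0..t}"
    using assms by (intro has_integral_powr_from_0) auto
  then have "((\<lambda>u. u powr (p - 1)) has_integral (t powr p / p)) {0..t}" by simp
  then have "(\<integral>\<^sup>+ u. ennreal (u powr (p - 1)) * indicator {0..t} u \<partial>lborel) = ennreal (t powr p / p)"
    by (intro nn_integral_has_integral_lebesgue') auto
  moreover have "(\<integral>\<^sup>+ u. ennreal (u powr (p - 1)) * indicator {0..t} u \<partial>lborel) = (\<integral>\<^sup>+ u. ennreal (u powr (p - 1)) * indicator {0..t} u \<partial>lebesgue)"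
    by (rule nn_integral_completion[symmetric])
  moreover have "(\<integral>\<^sup>+ u. ennreal (u powr (p - 1)) * indicator {0..t} u \<partial>lebesgue) = (\<integral>\<^sup>+ u\<in>{0<..t}. ennreal (u powr (p - 1)) \<partial>lebesgue)"
    by (intro nn_integral_cong) (auto simp: indicator_def)
  ultimately show ?thesis by simp
qed

definition weight :: "real \<Rightarrow> (real \<Rightarrow> real) \<Rightarrow> real \<Rightarrow> ennreal" where
  "weight q b u = ennreal (b u powr q / u)"

abbreviation mass :: "real \<Rightarrow> (real \<Rightarrow> real) \<Rightarrow> real set \<Rightarrow> ennreal" where
  "mass q b A \<equiv> \<integral>\<^sup>+ u\<in>A. weight q b u \<partial>lebesgue"

definition tail :: "real \<Rightarrow> (real \<Rightarrow> real) \<Rightarrow> real \<Rightarrow> real" where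
  "tail q b t = enn2real (tail_norm q b t)"

lemma epowr_weight:
  assumes "0 < q" "0 < u" "0 \<le> b u"
  shows "epowr (ennreal (u powr (- 1 / q) * b u)) q = weight q b u"
proof -
  have "(u powr (- 1 / q) * b u) powr q = (u powr (- 1 / q)) powr q * b u powr q"
    by (rule powr_mult)
  also have "(u powr (- 1 / q)) powr q = u powr - 1"
    using assms(1) by (subst powr_powr) simp
  also have "u powr - 1 * b u powr q = b u powr q / u"
    using assms by (simp add: powr_minus field_simps)
  finally show ?thesis using assms by (subst epowr_ennreal) (auto simp: weight_def)
qed

lemma borel_measurable_weight:
  assumes "b \<in> SV" "A \<in> sets lebesgue" "A \<subseteq> {0<..}"
  shows "(\<lambda>u. weight q b u * indicator A u) \<in> borel_measurable lebesgue"
proof -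
  have "b \<in> borel_measurable (lebesgue_on {0<..})" using assms by (auto simp: SV_def)
  then have [measurable]: "(\<lambda>x. indicator {0<..} x *\<^sub>R b x) \<in> borel_measurable lebesgue"
    by (subst (asm) borel_measurable_restrict_space_iff) auto
  note assms(2)[measurable]
      note ident_borel_measurable_lebesgue[measurable]
  have "(\<lambda>u. ennreal ((indicator {0<..} u *\<^sub>R b u) powr q / u) * indicator A u) \<in> borel_measurable lebesgue"
    by measurable
  moreover have "(\<lambda>u. ennreal ((indicator {0<..} u *\<^sub>R b u) powr q / u) * indicator A u)
      = (\<lambda>u. weight q b u * indicator A u)"
    using assms(3) by (auto simp: fun_eq_iff weight_def indicator_def)
  ultimately show ?thesis by simp
qed

lemma tail_norm_eq:
  assumes "b \<in> SV" "0 < q" "0 < t"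
  shows "tail_norm q b t = epowr (mass q b {t<..}) (1 / q)"
proof -
  have "(\<integral>\<^sup>+ u\<in>{t<..}. epowr (ennreal (u powr (- 1 / q) * b u)) q \<partial>lebesgue) = (mass q b {t<..})"
  proof (intro nn_integral_cong)
    fix u
    show "epowr (ennreal (u powr (- 1 / q) * b u)) q * indicator {t<..} u = weight q b u * indicator {t<..} u"
    proof (cases "t < u")
      case True
      then have "epowr (ennreal (u powr (- 1 / q) * b u)) q = weight q b u"
        using assms by (intro epowr_weight less_imp_le) (auto simp: SV_def)
      then show ?thesis by (rule arg_cong)
    qed simp
  qed
  then show ?thesis by (simp add: tail_norm_def Lq_norm_def)
qed

lemma weight_split:
  assumes "b \<in> SV" "0 < s" "s \<le> t"
  shows "(mass q b {s<..})
    = (mass q b {s<..t}) + (mass q b {t<..})"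
proof -
  have "(mass q b {s<..}) = (\<integral>\<^sup>+ u. weight q b u * indicator {s<..t} u + weight q b u * indicator {t<..} u \<partial>lebesgue)"
    using assms by (intro nn_integral_cong) (auto simp: indicator_def)
  also have "\<dots> = (mass q b {s<..t}) + (mass q b {t<..})"
    using assms by (intro nn_integral_add borel_measurable_weight) auto
  finally show ?thesis .
qed

text \<open>
  The weight is bounded on \<open>[a, c]\<close>, so its tail is locally Lipschitz continuous.
\<close>
lemma weight_interval_le:
  assumes "b \<in> SV" "0 < q" "0 < a"
  shows "\<exists>L\<ge>0. \<forall>s t. a \<le> s \<longrightarrow> s \<le> t \<longrightarrow> t \<le> c \<longrightarrow> (mass q b {s<..t}) \<le> ennreal (L * (t - s))"
proof -
  obtain C where C: "C > 0" "\<And>s t. 0 < s \<Longrightarrow> s \<le> t \<Longrightarrow> b t \<le> C * (t / s) powr 1 * b s"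
    using SV_ratio[OF assms(1), of 1] by auto
  have bpos: "t > 0 \<Longrightarrow> b t > 0" for t using assms(1) by (auto simp: SV_def)
  define L where "L = (C * (c / a) * b a) powr q / a"
  have L0: "0 \<le> L" using assms by (simp add: L_def)
  have "(mass q b {s<..t}) \<le> ennreal (L * (t - s))" if st: "a \<le> s" "s \<le> t" "t \<le> c" for s t
  proof -
    have "weight q b u \<le> ennreal L" if u: "s < u" "u \<le> t" for u
    proof -
      have "b u \<le> C * (u / a) * b a" using C(2)[of a u] assms u st by simp
      also have "\<dots> \<le> C * (c / a) * b a"
        using C(1) bpos[of a] assms u st by (intro mult_right_mono mult_left_mono divide_right_mono) auto
      finally have "b u powr q / u \<le> L"
        unfolding L_def using assms u st bpos[of u] by (intro frac_le powr_mono2) auto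
      then show ?thesis unfolding weight_def by (rule ennreal_leI)
    qed
    then have "(mass q b {s<..t}) \<le> (\<integral>\<^sup>+ u. ennreal L * indicator {s<..t} u \<partial>lebesgue)"
      by (intro nn_integral_mono) (auto simp: indicator_def)
    also have "\<dots> = ennreal (L * (t - s))"
      using st assms by (subst nn_integral_cmult_indicator) (auto simp: ennreal_mult' L0)
    finally show ?thesis .
  qed
  then show ?thesis using L0 by blast
qed

context
  fixes q :: real and b :: "real \<Rightarrow> real"
  assumes b: "b \<in> SV0 q" and q: "0 < q"
begin

lemma SV0_SV: "b \<in> SV" using b by (simp add: SV0_def)

lemma SV0_pos: "0 < t \<Longrightarrow> 0 < b t" using SV0_SV by (simp add: SV_def)

lemma weight_tail_finite:
  assumes "0 < t"
  shows "(mass q b {t<..}) < top"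
proof -
  have 1: "mass q b {1<..} < top"
    using b q tail_norm_eq[OF SV0_SV q, of 1] by (simp add: SV0_def)
  show ?thesis
  proof (cases "t \<le> 1")
    case True
    obtain L where "(mass q b {t<..1}) \<le> ennreal (L * (1 - t))"
      using weight_interval_le[OF SV0_SV q assms, of 1] True by auto
    then have "(mass q b {t<..1}) < top"
      using le_less_trans ennreal_less_top by blast
    then show ?thesis using 1 weight_split[OF SV0_SV assms True] by simp
  next
    case False
    then have "(mass q b {t<..}) \<le> (mass q b {1<..})"
      by (intro nn_integral_mono) (auto simp: indicator_def)
    then show ?thesis using 1 by simp
  qed
qed

lemma tail_nonneg: "0 \<le> tail q b t"
  by (simp add: tail_def)

lemma weight_tail:
  assumes "0 < t"
  shows "(mass q b {t<..}) = ennreal (tail q b t powr q)"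
proof -
  have "ennreal (tail q b t) = tail_norm q b t"
    using weight_tail_finite[OF assms] unfolding tail_def by (simp add: tail_norm_eq[OF SV0_SV q assms])
  then have "epowr (ennreal (tail q b t)) q = epowr (tail_norm q b t) q" by simp
  then show ?thesis using q
    by (simp add: tail_norm_eq[OF SV0_SV q assms] epowr_epowr epowr_ennreal tail_nonneg)
qed

lemma tail_pos:
  assumes "0 < t"
  shows "0 < tail q b t"
proof -
  have "(mass q b {t<..}) \<noteq> 0"
  proof
    assume "(mass q b {t<..}) = 0"
    then have "AE u in lebesgue. weight q b u * indicator {t<..} u = 0"
      using assms by (subst (asm) nn_integral_0_iff_AE) (auto intro!: borel_measurable_weight SV0_SV)
    then have "AE u in lebesgue. u \<notin> {t<..}"
    proof eventually_elim
      case (elim u)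
      show ?case
      proof
        assume u: "u \<in> {t<..}"
        then have "0 < b u powr q / u" using assms SV0_pos[of u] by (intro divide_pos_pos) auto
        then show False using elim u by (simp add: weight_def ennreal_eq_0_iff)
      qed
    qed
    then have "emeasure lebesgue {t<..} = 0"
      by (subst (asm) AE_iff_measurable[of "{t<..}"]) auto
    moreover have "emeasure lebesgue {t<..t+1} \<le> emeasure lebesgue {t<..}"
      by (intro emeasure_mono) auto
    ultimately show False by simp
  qed
  then have "tail q b t \<noteq> 0" using q weight_tail[OF assms] by auto
  then show ?thesis using tail_nonneg[of t] by simp
qed

lemma weight_interval:
  assumes "0 < s" "s \<le> t"
  shows "(mass q b {s<..t}) + ennreal (tail q b t powr q) = ennreal (tail q b s powr q)"
  using weight_split[OF SV0_SV assms, of q] assms by (simp add: weight_tail)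

lemma weight_interval_le_tail:
  assumes "0 < s" "s \<le> t"
  shows "(mass q b {s<..t}) \<le> ennreal (tail q b s powr q)"
  using weight_interval[OF assms] by (metis le_iff_add)

lemma tail_antimono:
  assumes "0 < s" "s \<le> t"
  shows "tail q b t \<le> tail q b s"
proof -
  have "ennreal (tail q b t powr q) \<le> ennreal (tail q b s powr q)"
    using weight_interval[OF assms] by (metis le_iff_add add.commute)
  then have "epowr (ennreal (tail q b t)) q \<le> epowr (ennreal (tail q b s)) q"
    by (simp add: epowr_ennreal tail_nonneg)
  then show ?thesis using q by (simp add: epowr_le_iff tail_nonneg)
qed

lemma tail_continuous: "continuous_on {0<..} (tail q b)"
proof (intro continuous_at_imp_continuous_on ballI)
  fix t0 :: real assume "t0 \<in> {0<..}"
  then have t0: "0 < t0" by simp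
  obtain L where L: "L \<ge> 0" "\<And>s t. t0 / 2 \<le> s \<Longrightarrow> s \<le> t \<Longrightarrow> t \<le> 2 * t0 \<Longrightarrow>
      (mass q b {s<..t}) \<le> ennreal (L * (t - s))"
    using weight_interval_le[OF SV0_SV q, of "t0/2" "2 * t0"] t0 by auto
  have lip: "tail q b s powr q - tail q b t powr q \<le> L * (t - s)"
    if "t0 / 2 \<le> s" "s \<le> t" "t \<le> 2 * t0" for s t
  proof -
    have "ennreal (tail q b s powr q) \<le> ennreal (L * (t - s)) + ennreal (tail q b t powr q)"
    proof -
      have "0 < s" using that t0 by linarith
      then show ?thesis
        using add_right_mono[OF L(2)[OF that], of "ennreal (tail q b t powr q)"] weight_interval[of s t] that by simp
    qed
    also have "\<dots> = ennreal (L * (t - s) + tail q b t powr q)"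
      using L(1) that by (intro ennreal_plus[symmetric]) auto
    finally have "tail q b s powr q \<le> L * (t - s) + tail q b t powr q"
      using L(1) that by (subst (asm) ennreal_le_iff) auto
    then show ?thesis by simp
  qed
  have "L-lipschitz_on {t0/2..2*t0} (\<lambda>t. tail q b t powr q)"
  proof (rule lipschitz_onI)
    fix s t assume st: "s \<in> {t0/2..2*t0}" "t \<in> {t0/2..2*t0}"
    show "dist (tail q b s powr q) (tail q b t powr q) \<le> L * dist s t"
    proof (cases "s \<le> t")
      case True
      have "tail q b t powr q \<le> tail q b s powr q"
        using True st t0 q by (intro powr_mono2 tail_antimono) (auto simp: tail_nonneg)
      then show ?thesis using lip[of s t] st True by (simp add: dist_real_def)
    next
      case False
      have "tail q b s powr q \<le> tail q b t powr q"
        using False st t0 q by (intro powr_mono2 tail_antimono) (auto simp: tail_nonneg)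
      then show ?thesis using lip[of t s] st False by (simp add: dist_real_def)
    qed
  qed (use L in auto)
  then have "continuous_on {t0/2..2*t0} (\<lambda>t. tail q b t powr q)"
    by (rule lipschitz_on_continuous_on)
  then have "continuous_on {t0/2<..<2*t0} (\<lambda>t. tail q b t powr q)"
    by (rule continuous_on_subset) auto
  then have "isCont (\<lambda>t. tail q b t powr q) t0"
    using t0 by (subst (asm) continuous_on_eq_continuous_at) auto
  then have "isCont (\<lambda>t. (tail q b t powr q) powr (1 / q)) t0"
    unfolding isCont_def by (rule tendsto_powr) (use tail_pos[OF t0] q in auto)
  then show "isCont (tail q b) t0"
    using q tail_nonneg by (simp add: powr_powr)
qed

text \<open>
  The tail at \<open>t\<close> dominates the contribution of \<open>[t, 2 t]\<close>, where \<open>b\<close> is comparable to \<open>b t\<close>.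
\<close>
lemma tail_lower: "\<exists>C>0. \<forall>t>0. b t \<le> C * tail q b t"
proof -
  obtain C where C: "C > 0" "\<And>s t. 0 < s \<Longrightarrow> s \<le> t \<Longrightarrow> b s \<le> C * (t / s) powr 1 * b t"
    using SV_ratio[OF SV0_SV, of 1] by auto
  have "b t \<le> (2 * C * 2 powr (1/q)) * tail q b t" if t: "0 < t" for t
  proof -
    have "ennreal ((b t / (2 * C)) powr q / (2 * t)) \<le> weight q b u" if u: "t < u" "u \<le> 2 * t" for u
    proof -
      have "b t \<le> C * (u / t) * b u" using C(2)[of t u] t u by simp
      also have "\<dots> \<le> C * 2 * b u"
        using C(1) SV0_pos[of u] t u by (intro mult_right_mono mult_left_mono) (auto simp: field_simps)
      finally have "b t / (2 * C) \<le> b u" using C(1) by (simp add: field_simps)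
      then have "(b t / (2 * C)) powr q / (2 * t) \<le> b u powr q / u"
        using t u q C(1) SV0_pos[of t] by (intro frac_le powr_mono2) auto
      then show ?thesis unfolding weight_def by (rule ennreal_leI)
    qed
    then have "(\<integral>\<^sup>+ u. ennreal ((b t / (2 * C)) powr q / (2 * t)) * indicator {t<..2*t} u \<partial>lebesgue)
      \<le> (mass q b {t<..2*t})"
      by (intro nn_integral_mono) (auto simp: indicator_def)
    also have "\<dots> \<le> ennreal (tail q b t powr q)" using t by (intro weight_interval_le_tail) auto
    finally have "ennreal ((b t / (2 * C)) powr q / 2) \<le> ennreal (tail q b t powr q)"
      using t by (simp add: nn_integral_cmult_indicator ennreal_mult'[symmetric])
    then have "(b t / (2 * C)) powr q \<le> 2 * tail q b t powr q"
      by (simp add: ennreal_le_iff)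
    also have "\<dots> = (2 powr (1/q) * tail q b t) powr q"
      using q tail_nonneg by (simp add: powr_mult powr_powr)
    finally have "b t / (2 * C) \<le> 2 powr (1/q) * tail q b t"
      using powr_less_mono2[of q "2 powr (1/q) * tail q b t" "b t / (2 * C)"] q tail_nonneg[of t]
      by (meson mult_nonneg_nonneg not_le powr_ge_zero)
    then show ?thesis using C(1) by (simp add: field_simps)
  qed
  then show ?thesis using C(1) by (intro exI[of _ "2 * C * 2 powr (1/q)"]) auto
qed

text \<open>
  \<open>b u\<close> is at most a multiple of \<open>(t / u) powr (1 / 2) * b t\<close> for \<open>u \<le> t\<close>; the
  exponent \<open>1 / 2\<close> is one that leaves an integrable power of \<open>u\<close>. The factor \<open>b t\<close> is then
  absorbed by the tail.
\<close>
lemma weight_near_zero: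
  "\<exists>C>0. \<forall>t>0. (\<integral>\<^sup>+ u\<in>{0<..t}. ennreal (u powr q) * weight q b u \<partial>lebesgue)
      \<le> ennreal (C * (t powr q * tail q b t powr q))"
proof -
  obtain C where C: "C > 0" "\<And>s t. 0 < s \<Longrightarrow> s \<le> t \<Longrightarrow> b s \<le> C * (t / s) powr (1/2) * b t"
    using SV_ratio[OF SV0_SV, of "1/2"] by auto
  obtain D where D: "D > 0" "\<And>t. 0 < t \<Longrightarrow> b t \<le> D * tail q b t" using tail_lower by auto
  have "(\<integral>\<^sup>+ u\<in>{0<..t}. ennreal (u powr q) * weight q b u \<partial>lebesgue)
      \<le> ennreal ((2 / q * (C * D) powr q) * (t powr q * tail q b t powr q))" if t: "0 < t" for t
  proof -
    define c where "c = (C * t powr (1/2) * (D * tail q b t)) powr q"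
    have pt: "ennreal (u powr q) * weight q b u \<le> ennreal c * ennreal (u powr (q/2 - 1))" if u: "0 < u" "u \<le> t" for u
    proof -
      have "b u \<le> C * (t / u) powr (1/2) * b t" using C(2) u by blast
      also have "\<dots> \<le> C * (t / u) powr (1/2) * (D * tail q b t)"
        using C(1) D(2)[OF t] by (intro mult_left_mono) auto
      finally have "b u powr q \<le> (C * (t / u) powr (1/2) * (D * tail q b t)) powr q"
        using SV0_pos[OF u(1)] q by (intro powr_mono2) auto
      also have "\<dots> = c * u powr (- q / 2)"
        using u t C(1) D(1) by (simp add: c_def powr_mult powr_divide powr_powr powr_minus tail_nonneg field_simps)
      finally have "u powr q * (b u powr q / u) \<le> u powr q * (c * u powr (- q / 2) / u)"
        using u by (intro mult_left_mono divide_right_mono) auto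
      also have "\<dots> = c * u powr (q/2 - 1)"
      proof -
        have "u powr q * u powr (- q / 2) = u powr (q / 2)" by (simp add: powr_add[symmetric])
        moreover have "u powr (q/2 - 1) = u powr (q/2) / u" using u by (simp add: powr_diff)
        ultimately show ?thesis by simp
      qed
      finally show ?thesis unfolding weight_def
        by (simp add: ennreal_mult'[symmetric] ennreal_leI c_def)
    qed
    have "(\<integral>\<^sup>+ u\<in>{0<..t}. ennreal (u powr q) * weight q b u \<partial>lebesgue) \<le> (\<integral>\<^sup>+ u. ennreal c * (ennreal (u powr (q/2 - 1)) * indicator {0<..t} u) \<partial>lebesgue)"
      using pt by (intro nn_integral_mono) (auto simp: indicator_def)
    also have "\<dots> = ennreal c * ennreal (t powr (q/2) / (q/2))"
    proof -
      note ident_borel_measurable_lebesgue[measurable]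
      show ?thesis using q t by (subst nn_integral_cmult) (auto simp: nn_integral_powr_interval)
    qed
    also have "\<dots> = ennreal ((2 / q * (C * D) powr q) * (t powr q * tail q b t powr q))"
      using q C(1) D(1) t tail_nonneg[of t] powr_add[of t "q/2" "q/2"]
      by (simp add: c_def ennreal_mult'[symmetric] powr_mult powr_powr field_simps)
    finally show ?thesis .
  qed
  then show ?thesis using q C(1) D(1) by (intro exI[of _ "2 / q * (C * D) powr q"]) auto
qed

lemma tail_powr_eq_integral:
  assumes "0 < t"
  shows "(LINT u:{t<..}|lebesgue. b u powr q / u) = tail q b t powr q"
proof -
  have "set_lebesgue_integral lebesgue {t<..} (\<lambda>u. b u powr q / u) = integral\<^sup>L lebesgue (\<lambda>u. indicator {t<..} u * (b u powr q / u))"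
    by (simp add: set_lebesgue_integral_def)
  also have "\<dots> = enn2real (\<integral>\<^sup>+ u. ennreal (indicator {t<..} u * (b u powr q / u)) \<partial>lebesgue)"
  proof (rule integral_eq_nn_integral)
    have "(\<lambda>u. enn2real (weight q b u * indicator {t<..} u)) \<in> borel_measurable lebesgue"
      using assms by (intro borel_measurable_enn2real borel_measurable_weight SV0_SV) auto
    moreover have "(\<lambda>u. enn2real (weight q b u * indicator {t<..} u)) = (\<lambda>u. indicator {t<..} u * (b u powr q / u))"
      using assms by (auto simp: weight_def indicator_def fun_eq_iff)
    ultimately show "(\<lambda>u. indicator {t<..} u * (b u powr q / u)) \<in> borel_measurable lebesgue" by simp
    show "AE u in lebesgue. 0 \<le> indicator {t<..} u * (b u powr q / u)"
      using assms by (intro AE_I2) (auto simp: indicator_def)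
  qed
  also have "(\<integral>\<^sup>+ u. ennreal (indicator {t<..} u * (b u powr q / u)) \<partial>lebesgue) = (mass q b {t<..})"
    by (intro nn_integral_cong) (auto simp: weight_def indicator_def)
  finally show ?thesis using weight_tail[OF assms] by simp
qed

end

section \<open>Discretization along the dyadic values of rho\<close>

lemma le_of_powr_le:
  fixes D :: real
  assumes "0 < \<epsilon>" "0 < x" "0 < y" "x powr \<epsilon> \<le> D * y powr \<epsilon>" "0 < D"
  shows "x \<le> D powr (1 / \<epsilon>) * y"
proof -
  have "(x powr \<epsilon>) powr (1 / \<epsilon>) \<le> (D * y powr \<epsilon>) powr (1 / \<epsilon>)"
    using assms by (intro powr_mono2) auto
  also have "\<dots> = D powr (1 / \<epsilon>) * (y powr \<epsilon>) powr (1 / \<epsilon>)" by (rule powr_mult)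
  finally show ?thesis using assms by (simp add: powr_powr)
qed

text \<open>
  The data of the interpolation theorem that do not involve the function space.
\<close>
locale limiting_weights =
  fixes q0 q1 q \<theta> :: real and b0 b1 b \<rho> bt :: "real \<Rightarrow> real"
  assumes exponents: "0 < q0" "0 < q1" "0 < q"
    and theta: "0 < \<theta>" "\<theta> < 1"
    and weights: "b0 \<in> SV0 q0" "b1 \<in> SV0 q1" "b \<in> SV"
    and rho_def: "\<And>t. t > 0 \<Longrightarrow> \<rho> t = tail q0 b0 t / tail q1 b1 t"
    and rho_eps: "\<exists>\<epsilon>>0. \<exists>g. mono_on {0<..} g \<and> equiv_pos (\<lambda>t. tail q0 b0 t powr (1 + \<epsilon>) / tail q1 b1 t) g"
    and rho_mono: "strict_mono_on {0<..} \<rho>"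
    and rho_0: "(\<rho> \<longlongrightarrow> 0) (at_right 0)"
    and rho_top: "filterlim \<rho> at_top at_top"
    and bt_def: "\<And>t. t > 0 \<Longrightarrow>
      bt t = \<rho> t powr (1 - \<theta>) * b (\<rho> t) * b1 t powr (q1 / q) *
             (LINT u:{t<..}|lebesgue. b1 u powr q1 / u) powr (1 / q1 - 1 / q)"
begin

abbreviation T0 where "T0 \<equiv> tail q0 b0"
abbreviation T1 where "T1 \<equiv> tail q1 b1"

lemmas T0_pos = tail_pos[OF weights(1) exponents(1)]
lemmas T1_pos = tail_pos[OF weights(2) exponents(2)]
lemmas T0_antimono = tail_antimono[OF weights(1) exponents(1)]
lemmas T1_antimono = tail_antimono[OF weights(2) exponents(2)]

lemma b_pos: "0 < t \<Longrightarrow> 0 < b t" using weights(3) by (simp add: SV_def)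

lemma T0_eq: "0 < t \<Longrightarrow> T0 t = \<rho> t * T1 t"
  using T1_pos[of t] by (simp add: rho_def)

lemma rho_pos: "0 < t \<Longrightarrow> 0 < \<rho> t"
  using T0_pos[of t] T1_pos[of t] by (simp add: rho_def)

lemma rho_less_iff: "0 < s \<Longrightarrow> 0 < t \<Longrightarrow> \<rho> s < \<rho> t \<longleftrightarrow> s < t"
  using rho_mono by (simp add: strict_mono_on_less)

lemma rho_le_iff: "0 < s \<Longrightarrow> 0 < t \<Longrightarrow> \<rho> s \<le> \<rho> t \<longleftrightarrow> s \<le> t"
  using rho_mono by (simp add: strict_mono_on_less_eq)

lemma rho_continuous: "continuous_on {0<..} \<rho>"
proof -
  have "continuous_on {0<..} (\<lambda>t. T0 t / T1 t)"
    using T1_pos by (intro continuous_on_divide tail_continuous weights exponents) (auto simp: less_imp_neq[symmetric])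
  then show ?thesis by (subst continuous_on_cong[OF refl]) (auto simp: rho_def)
qed

lemma rho_surj:
  assumes "0 < y"
  shows "\<exists>t>0. \<rho> t = y"
proof -
  have "eventually (\<lambda>t. \<rho> t < y) (at_right 0)" using rho_0 assms by (rule order_tendstoD)
  moreover have "eventually (\<lambda>t::real. t \<in> {0<..<1}) (at_right 0)" by (rule eventually_at_right_real) simp
  ultimately have "eventually (\<lambda>t. \<rho> t < y \<and> t \<in> {0<..<1}) (at_right 0)" by (rule eventually_conj)
  then obtain s where s: "0 < s" "s < 1" "\<rho> s < y"
    using eventually_happens[of _ "at_right (0::real)"] by auto
  have "eventually (\<lambda>t. y \<le> \<rho> t) at_top" using rho_top by (simp add: filterlim_at_top)
  then have "eventually (\<lambda>t. y \<le> \<rho> t \<and> 1 \<le> t) at_top" using eventually_ge_at_top by (rule eventually_conj)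
  then obtain t where t: "1 \<le> t" "y \<le> \<rho> t" using eventually_happens[of _ "at_top :: real filter"] by auto
  have "s \<le> t" using s t by linarith
  then have "\<exists>x\<ge>s. x \<le> t \<and> \<rho> x = y"
    using s t by (intro IVT' continuous_on_subset[OF rho_continuous]) auto
  then obtain x where "s \<le> x" "\<rho> x = y" by blast
  then show ?thesis using s by (intro exI[of _ x]) auto
qed

definition node :: "int \<Rightarrow> real" where
  "node k = (SOME t. 0 < t \<and> \<rho> t = 2 powr real_of_int k)"

lemma node_pos: "0 < node k" and rho_node: "\<rho> (node k) = 2 powr real_of_int k"
proof -
  have "\<exists>t. 0 < t \<and> \<rho> t = 2 powr real_of_int k" using rho_surj[of "2 powr real_of_int k"] by auto
  from someI_ex[OF this] show "0 < node k" "\<rho> (node k) = 2 powr real_of_int k"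
    by (auto simp: node_def)
qed

lemma node_mono: "k \<le> l \<Longrightarrow> node k \<le> node l"
  by (subst rho_le_iff[symmetric]) (auto simp: node_pos rho_node)

definition cell :: "int \<Rightarrow> real set" where "cell k = {node k<..node (k + 1)}"

definition dyad :: "int \<Rightarrow> real set" where "dyad k = {2 powr real_of_int k<..2 powr (real_of_int k + 1)}"

lemma dyad_cover: "0 < s \<Longrightarrow> \<exists>k. s \<in> dyad k"
proof -
  assume s: "0 < s"
  define k where "k = \<lceil>log 2 s\<rceil> - 1"
  have "real_of_int k < log 2 s" "log 2 s \<le> real_of_int k + 1" unfolding k_def by linarith+
  then have "2 powr real_of_int k < s" "s \<le> 2 powr (real_of_int k + 1)"
    using s by (simp_all add: less_log_iff log_le_iff)
  then show ?thesis by (auto simp: dyad_def)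
qed

lemma dyad_disjoint: "disjoint_family_on dyad UNIV"
proof (clarsimp simp: disjoint_family_on_def)
  fix k l :: int assume "k \<noteq> l"
  then have "k + 1 \<le> l \<or> l + 1 \<le> k" by linarith
  then have "(2::real) powr (real_of_int k + 1) \<le> 2 powr real_of_int l \<or> (2::real) powr (real_of_int l + 1) \<le> 2 powr real_of_int k"
    by (auto simp: powr_mono)
  then show "dyad k \<inter> dyad l = {}" by (auto simp: dyad_def)
qed

lemma dyad_sets: "dyad k \<in> sets lebesgue"
  by (simp add: dyad_def)

lemma mem_cell_iff: "t \<in> cell k \<longleftrightarrow> 0 < t \<and> \<rho> t \<in> dyad k"
proof (cases "0 < t")
  case True
  have "node k < t \<longleftrightarrow> 2 powr real_of_int k < \<rho> t"
    by (subst rho_less_iff[symmetric]) (auto simp: node_pos rho_node True)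
  moreover have "t \<le> node (k + 1) \<longleftrightarrow> \<rho> t \<le> 2 powr (real_of_int k + 1)"
    by (subst rho_le_iff[symmetric]) (auto simp: node_pos rho_node True)
  ultimately show ?thesis using True by (auto simp: cell_def dyad_def)
next
  case False
  then show ?thesis using node_pos[of k] by (auto simp: cell_def)
qed

lemma cell_cover: "0 < t \<Longrightarrow> \<exists>k. t \<in> cell k"
  using dyad_cover[OF rho_pos] by (auto simp: mem_cell_iff)

lemma cell_disjoint: "disjoint_family_on cell UNIV"
  using dyad_disjoint by (auto simp: disjoint_family_on_def mem_cell_iff set_eq_iff)

lemma cell_subset: "cell k \<subseteq> {0<..}"
  by (auto simp: mem_cell_iff)

lemma cell_sets: "cell k \<in> sets lebesgue"
  by (simp add: cell_def)

text \<open>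
  Since \<open>T0 = \<rho> * T1\<close>, the quantity in the hypothesis on \<open>\<rho>\<close> is
  \<open>\<rho> powr (1 + \<epsilon>) * T1 powr \<epsilon>\<close>. It cannot drop by more than a constant factor, while
  \<open>\<rho>\<close> exactly doubles from one node to the next; hence \<open>T1\<close> cannot drop by more than a constant factor.
\<close>
lemma tail_doubling:
  "\<exists>D\<ge>1. \<forall>k. T0 (node k) \<le> D * T0 (node (k + 1)) \<and> T1 (node k) \<le> D * T1 (node (k + 1))"
proof -
  obtain \<epsilon> g where e: "0 < \<epsilon>" and g: "mono_on {0<..} g" "equiv_pos (\<lambda>t. T0 t powr (1 + \<epsilon>) / T1 t) g"
    using rho_eps by blast
  obtain c1 c2 where c: "c1 > 0" "c2 > 0" "\<And>t. t > 0 \<Longrightarrow> T0 t powr (1 + \<epsilon>) / T1 t \<le> c1 * g t"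
    "\<And>t. t > 0 \<Longrightarrow> g t \<le> c2 * (T0 t powr (1 + \<epsilon>) / T1 t)"
    using g(2) unfolding equiv_pos_def by blast
  have eq: "T0 t powr (1 + \<epsilon>) / T1 t = \<rho> t powr (1 + \<epsilon>) * T1 t powr \<epsilon>" if "0 < t" for t
  proof -
    have "T0 t powr (1 + \<epsilon>) = \<rho> t powr (1 + \<epsilon>) * T1 t powr (1 + \<epsilon>)"
      by (simp only: T0_eq[OF that] powr_mult)
    moreover have "T1 t powr (1 + \<epsilon>) = T1 t * T1 t powr \<epsilon>"
      using T1_pos[OF that] by (simp add: powr_add)
    ultimately show ?thesis using T1_pos[OF that] by simp
  qed
  define D where "D = max 1 ((c1 * c2 * 2 powr (1 + \<epsilon>)) powr (1 / \<epsilon>))"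
  have T1D: "T1 (node k) \<le> D * T1 (node (k + 1))" for k
  proof -
    let ?s = "node k" and ?t = "node (k + 1)"
    have pos: "0 < ?s" "0 < ?t" "?s \<le> ?t" by (auto simp: node_pos node_mono)
    have "T0 ?s powr (1 + \<epsilon>) / T1 ?s \<le> c1 * g ?s" using c(3) pos by blast
    also have "\<dots> \<le> c1 * g ?t" using g(1) pos c(1) by (intro mult_left_mono) (auto simp: monotone_on_def)
    also have "\<dots> \<le> c1 * (c2 * (T0 ?t powr (1 + \<epsilon>) / T1 ?t))"
      using c(1) c(4)[OF pos(2)] by (intro mult_left_mono) auto
    finally have "\<rho> ?s powr (1 + \<epsilon>) * T1 ?s powr \<epsilon> \<le> c1 * c2 * (\<rho> ?t powr (1 + \<epsilon>) * T1 ?t powr \<epsilon>)"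
      by (simp add: eq pos)
    moreover have "\<rho> ?t = 2 * \<rho> ?s" by (simp add: rho_node powr_add)
    then have "\<rho> ?t powr (1 + \<epsilon>) = 2 powr (1 + \<epsilon>) * \<rho> ?s powr (1 + \<epsilon>)" by (simp only: powr_mult)
    moreover have "0 < \<rho> ?s powr (1 + \<epsilon>)" using rho_pos[OF pos(1)] by simp
    ultimately have "\<rho> ?s powr (1 + \<epsilon>) * T1 ?s powr \<epsilon> \<le> \<rho> ?s powr (1 + \<epsilon>) * (c1 * c2 * 2 powr (1 + \<epsilon>) * T1 ?t powr \<epsilon>)"
      by (simp add: mult_ac)
    then have "T1 ?s powr \<epsilon> \<le> c1 * c2 * 2 powr (1 + \<epsilon>) * T1 ?t powr \<epsilon>"
      using \<open>0 < \<rho> ?s powr (1 + \<epsilon>)\<close> by (simp only: mult_le_cancel_left_pos)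
    then have "T1 ?s \<le> (c1 * c2 * 2 powr (1 + \<epsilon>)) powr (1 / \<epsilon>) * T1 ?t"
      using c(1,2) e T1_pos pos by (intro le_of_powr_le) auto
    also have "\<dots> \<le> D * T1 ?t"
      using T1_pos[OF pos(2)] by (intro mult_right_mono) (auto simp: D_def)
    finally show ?thesis .
  qed
  have "T0 (node k) \<le> D * T0 (node (k + 1))" for k
  proof -
    have "T0 (node k) = \<rho> (node k) * T1 (node k)" by (rule T0_eq) (rule node_pos)
    also have "\<dots> \<le> \<rho> (node (k+1)) * (D * T1 (node (k+1)))"
      using T1D[of k] T1_pos[OF node_pos, of k] by (intro mult_mono) (auto simp: rho_node)
    also have "\<dots> = D * T0 (node (k+1))" using T0_eq[OF node_pos, of "k+1"] by simp
    finally show ?thesis .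
  qed
  with T1D show ?thesis by (intro exI[of _ D]) (auto simp: D_def)
qed

text \<open>
  \<open>T1 = T0 / \<rho>\<close>, where \<open>T0\<close> decreases and \<open>\<rho>\<close> doubles.
\<close>
lemma T1_halving: "T1 (node (k + 1)) \<le> T1 (node k) / 2"
proof -
  have "T0 (node (k + 1)) \<le> T0 (node k)" by (intro T0_antimono node_pos node_mono) auto
  then have "2 * (2 powr real_of_int k * T1 (node (k + 1))) \<le> 2 powr real_of_int k * T1 (node k)"
    by (simp add: T0_eq node_pos rho_node powr_add)
  then have "2 powr real_of_int k * (2 * T1 (node (k + 1))) \<le> 2 powr real_of_int k * T1 (node k)" by simp
  then show ?thesis by simp
qed

definition W :: "int \<Rightarrow> real" where
  "W k = (2 powr real_of_int k) powr (- \<theta>) * b (2 powr real_of_int k)"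

lemma W_pos: "0 < W k"
  using b_pos by (simp add: W_def)

lemma W_dyad:
  "\<exists>c\<ge>1. \<forall>k. W k \<le> c * W (k + 1) \<and>
     (\<forall>s\<in>dyad k. s powr (- \<theta>) * b s \<le> c * W k \<and> W k \<le> c * (s powr (- \<theta>) * b s))"
proof -
  obtain C where C: "C > 0" "\<And>s t. 0 < s \<Longrightarrow> s \<le> t \<Longrightarrow> b t \<le> C * (t / s) powr 1 * b s \<and> b s \<le> C * (t / s) powr 1 * b t"
    using SV_ratio[OF weights(3), of 1] by auto
  define c where "c = max 1 (2 * C * 2 powr \<theta>)"
  have main: "s powr (- \<theta>) * b s \<le> c * W k \<and> W k \<le> c * (s powr (- \<theta>) * b s)"
    if s: "s \<in> dyad k" for k s
  proof -
    define x where "x = (2::real) powr real_of_int k"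
    have x: "0 < x" "x \<le> s" "s \<le> 2 * x" using s by (auto simp: x_def dyad_def powr_add)
    have Wx: "W k = x powr (- \<theta>) * b x" by (simp add: W_def x_def)
    have sx: "s / x \<le> 2" using x by (simp add: field_simps)
    have pos: "0 < b x" "0 < b s" using x b_pos by auto
    have "b s \<le> C * (s / x) powr 1 * b x" using C(2) x by blast
    also have "\<dots> \<le> C * 2 * b x" using sx C(1) pos x by (intro mult_right_mono mult_left_mono) auto
    finally have 1: "b s \<le> 2 * C * b x" by simp
    have "b x \<le> C * (s / x) powr 1 * b s" using C(2) x by blast
    also have "\<dots> \<le> C * 2 * b s" using sx C(1) pos x by (intro mult_right_mono mult_left_mono) auto
    finally have 2: "b x \<le> 2 * C * b s" by simp
    have p1: "s powr (- \<theta>) \<le> x powr (- \<theta>)"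
      using x theta by (intro powr_mono2') auto
    have "(2 * x) powr (- \<theta>) \<le> s powr (- \<theta>)"
      using x theta by (intro powr_mono2') auto
    moreover have "(2 * x) powr (- \<theta>) = 2 powr (- \<theta>) * x powr (- \<theta>)" by (rule powr_mult)
    ultimately have "2 powr \<theta> * (2 powr (- \<theta>) * x powr (- \<theta>)) \<le> 2 powr \<theta> * s powr (- \<theta>)"
      by (intro mult_left_mono) auto
    then have p2: "x powr (- \<theta>) \<le> 2 powr \<theta> * s powr (- \<theta>)"
      by (simp add: mult.assoc[symmetric] powr_add[symmetric])
    have "2 powr 0 \<le> (2::real) powr \<theta>" using theta by (intro powr_mono) auto
    then have "2 * C * 1 \<le> 2 * C * 2 powr \<theta>" using C(1) by (intro mult_left_mono) auto
    moreover have cge2: "2 * C * 2 powr \<theta> \<le> c" by (simp add: c_def)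
    ultimately have cge: "2 * C * 1 \<le> c" "2 * C * 2 powr \<theta> \<le> c" by (blast intro: order_trans)+
    have "s powr (- \<theta>) * b s \<le> x powr (- \<theta>) * (2 * C * b x)"
      using p1 1 pos by (intro mult_mono) auto
    also have "\<dots> = (2 * C * 1) * W k" by (simp add: Wx)
    also have "\<dots> \<le> c * W k" using cge W_pos[of k] by (intro mult_right_mono) auto
    finally have "s powr (- \<theta>) * b s \<le> c * W k" .
    moreover have "W k \<le> (2 powr \<theta> * s powr (- \<theta>)) * (2 * C * b s)"
      unfolding Wx using p2 2 pos by (intro mult_mono) auto
    then have "W k \<le> (2 * C * 2 powr \<theta>) * (s powr (- \<theta>) * b s)" by (simp add: mult_ac)
    moreover have "(2 * C * 2 powr \<theta>) * (s powr (- \<theta>) * b s) \<le> c * (s powr (- \<theta>) * b s)"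
      using cge pos by (intro mult_right_mono) auto
    ultimately show ?thesis by linarith
  qed
  moreover have "W k \<le> c * W (k + 1)" for k
  proof -
    have "2 powr (real_of_int k + 1) \<in> dyad k" by (auto simp: dyad_def)
    from main[OF this] show ?thesis by (simp add: W_def)
  qed
  ultimately show ?thesis by (intro exI[of _ c]) (auto simp: c_def)
qed

text \<open>
  Half of the room between \<open>\<theta>\<close> and the end points \<open>0\<close> and \<open>1\<close> is spent on the slowly
  varying factor, the other half gives geometric decay.
\<close>
lemma W_decay:
  "\<exists>c>0. \<forall>k (i::nat). W k \<le> c * (2 powr (- (\<theta> / 2))) ^ i * W (k - int i)"
  "\<exists>c>0. \<forall>k (i::nat). 2 powr real_of_int k * W k
      \<le> c * (2 powr (- ((1 - \<theta>) / 2))) ^ i * (2 powr real_of_int (k + int i) * W (k + int i))"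
proof -
  have pw: "(2 powr x) ^ i = (2::real) powr (x * real i)" for x and i :: nat
    by (simp add: powr_powr flip: powr_realpow)
  obtain C where C: "C > 0" "\<And>s t. 0 < s \<Longrightarrow> s \<le> t \<Longrightarrow> b t \<le> C * (t / s) powr (\<theta>/2) * b s"
    using SV_ratio[OF weights(3), of "\<theta>/2"] theta by auto
  have "W k \<le> C * (2 powr (- (\<theta> / 2))) ^ i * W (k - int i)" for k i
  proof -
    have "b (2 powr real_of_int k) \<le> C * (2 powr real_of_int k / 2 powr real_of_int (k - int i)) powr (\<theta>/2) * b (2 powr real_of_int (k - int i))"
      by (rule C(2)) auto
    also have "2 powr real_of_int k / 2 powr real_of_int (k - int i) = (2::real) powr real i"
      by (simp add: powr_diff[symmetric])
    also have "((2::real) powr real i) powr (\<theta>/2) = 2 powr (real i * (\<theta>/2))" by (rule powr_powr)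
    finally have "W k \<le> (2 powr real_of_int k) powr (- \<theta>) * (C * 2 powr (real i * (\<theta>/2)) * b (2 powr real_of_int (k - int i)))"
      unfolding W_def by (intro mult_left_mono) auto
    also have "\<dots> = C * (2 powr (- (\<theta> / 2))) ^ i * W (k - int i)"
      by (simp add: W_def pw powr_powr powr_add[symmetric] algebra_simps)
    finally show ?thesis .
  qed
  then show "\<exists>c>0. \<forall>k (i::nat). W k \<le> c * (2 powr (- (\<theta> / 2))) ^ i * W (k - int i)"
    using C(1) by blast
  obtain C where C: "C > 0" "\<And>s t. 0 < s \<Longrightarrow> s \<le> t \<Longrightarrow> b s \<le> C * (t / s) powr ((1 - \<theta>)/2) * b t"
    using SV_ratio[OF weights(3), of "(1 - \<theta>)/2"] theta by auto
  have "2 powr real_of_int k * W k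
      \<le> C * (2 powr (- ((1 - \<theta>) / 2))) ^ i * (2 powr real_of_int (k + int i) * W (k + int i))" for k i
  proof -
    have "b (2 powr real_of_int k) \<le> C * (2 powr real_of_int (k + int i) / 2 powr real_of_int k) powr ((1 - \<theta>)/2) * b (2 powr real_of_int (k + int i))"
      by (rule C(2)) auto
    also have "2 powr real_of_int (k + int i) / 2 powr real_of_int k = (2::real) powr real i"
      by (simp add: powr_diff[symmetric])
    also have "((2::real) powr real i) powr ((1 - \<theta>)/2) = 2 powr (real i * ((1 - \<theta>)/2))" by (rule powr_powr)
    finally have "2 powr real_of_int k * W k \<le> 2 powr real_of_int k * ((2 powr real_of_int k) powr (- \<theta>) * (C * 2 powr (real i * ((1 - \<theta>)/2)) * b (2 powr real_of_int (k + int i))))"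
      unfolding W_def by (intro mult_left_mono) auto
    also have "\<dots> = C * (2 powr (- ((1 - \<theta>) / 2))) ^ i * (2 powr real_of_int (k + int i) * W (k + int i))"
    proof -
      have "real_of_int k + real_of_int k * (- \<theta>) + real i * ((1 - \<theta>)/2)
        = - ((1 - \<theta>)/2) * real i + real_of_int (k + int i) + real_of_int (k + int i) * (- \<theta>)"
        by (simp add: field_simps)
      then have "(2::real) powr real_of_int k * 2 powr (real_of_int k * (- \<theta>)) * 2 powr (real i * ((1 - \<theta>)/2))
        = 2 powr (- ((1 - \<theta>)/2) * real i) * 2 powr (real_of_int (k + int i)) * 2 powr (real_of_int (k + int i) * (- \<theta>))"
        by (simp only: powr_add[symmetric])
      then show ?thesis unfolding W_def pw powr_powr by (simp add: mult_ac)
    qed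
    finally show ?thesis .
  qed
  then show "\<exists>c>0. \<forall>k (i::nat). 2 powr real_of_int k * W k
      \<le> c * (2 powr (- ((1 - \<theta>) / 2))) ^ i * (2 powr real_of_int (k + int i) * W (k + int i))"
    using C(1) by blast
qed

abbreviation comparable :: "real \<Rightarrow> ennreal \<Rightarrow> ennreal \<Rightarrow> bool" where
  "comparable C x y \<equiv> x \<le> ennreal C * y \<and> y \<le> ennreal C * x"

lemma shift_sum:
  fixes f :: "int \<Rightarrow> ennreal"
  shows "(\<Sum>\<^sup>+ k. f (k + 1)) = (\<Sum>\<^sup>+ k. f k)"
  by (rule nn_integral_bij_count_space) (rule bij_plus_right)

text \<open>
  On a dyadic interval \<open>s powr (- \<theta>) * b s\<close> is comparable to \<open>W k\<close>, and a monotone \<open>K\<close> lies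
  between its values at the end points.
\<close>
lemma interp_discrete:
  "\<exists>C>0. \<forall>K. mono_on {0<..} K \<longrightarrow>
     comparable C (\<integral>\<^sup>+ s\<in>{0<..}. epowr (ennreal (s powr (- \<theta> - 1 / q) * b s) * K s) q \<partial>lebesgue)
       (\<Sum>\<^sup>+ k. epowr (ennreal (W k) * K (2 powr real_of_int k)) q)"
proof -
  obtain c where c: "c \<ge> 1" "\<And>k. W k \<le> c * W (k + 1)"
    "\<And>k s. s \<in> dyad k \<Longrightarrow> s powr (- \<theta>) * b s \<le> c * W k"
    "\<And>k s. s \<in> dyad k \<Longrightarrow> W k \<le> c * (s powr (- \<theta>) * b s)"
    using W_dyad by blast
  define C where "C = max (c powr q * c powr q) (2 * c powr q)"
  show ?thesis
  proof (intro exI[of _ C] conjI allI impI)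
    show "0 < C" using c(1) by (simp add: C_def less_max_iff_disj)
    fix K :: "real \<Rightarrow> ennreal" assume K: "mono_on {0<..} K"
    let ?f = "\<lambda>s. epowr (ennreal (s powr (- \<theta> - 1 / q) * b s) * K s) q"
    let ?u = "\<lambda>k. ennreal ((c * W k) powr q / 2 powr real_of_int k) * epowr (K (2 powr (real_of_int (k + 1)))) q"
    let ?v = "\<lambda>k. ennreal ((W k / c) powr q / (2 * 2 powr real_of_int k)) * epowr (K (2 powr (real_of_int k))) q"
    let ?S = "\<Sum>\<^sup>+ k. epowr (ennreal (W k) * K (2 powr real_of_int k)) q"
    have f: "?f s = ennreal ((s powr (- \<theta>) * b s) powr q / s) * epowr (K s) q" if s: "0 < s" for s
    proof -
      have "(s powr (- \<theta> - 1 / q) * b s) powr q = ((s powr (- \<theta>) * b s) * s powr (- 1 / q)) powr q"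
        by (simp add: mult_ac flip: powr_add)
      also have "\<dots> = (s powr (- \<theta>) * b s) powr q * (s powr (- 1 / q)) powr q" by (rule powr_mult)
      also have "(s powr (- 1 / q)) powr q = 1 / s"
        using s exponents by (subst powr_powr) (simp add: powr_minus divide_inverse)
      finally show ?thesis
        using exponents b_pos[OF s] by (simp add: epowr_mult epowr_ennreal)
    qed
    have meas: "(\<integral>\<^sup>+ s\<in>dyad k. 1 \<partial>lebesgue) = ennreal (2 powr real_of_int k)" for k
      by (simp add: dyad_def powr_add)
    have split: "epowr (ennreal (W k) * x) q = ennreal (W k powr q) * epowr x q" for k x
      using exponents W_pos[of k] by (simp add: epowr_mult epowr_ennreal)
    have "(\<integral>\<^sup>+ s\<in>{0<..}. ?f s \<partial>lebesgue) \<le>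
      (\<Sum>\<^sup>+ k. ?u k * (\<integral>\<^sup>+ s\<in>dyad k. 1 \<partial>lebesgue))"
    proof (intro nn_integral_le_steps)
      fix k s assume s: "s \<in> dyad k"
      then have s0: "0 < s" "2 powr real_of_int k \<le> s" "s \<le> 2 powr (real_of_int (k + 1))"
        using less_trans[of 0 "2 powr real_of_int k" s] by (auto simp: dyad_def)
      have "(s powr (- \<theta>) * b s) powr q / s \<le> (c * W k) powr q / 2 powr real_of_int k"
        using c(3)[OF s] s0 b_pos[of s] exponents by (intro frac_le powr_mono2) auto
      moreover have "epowr (K s) q \<le> epowr (K (2 powr (real_of_int (k + 1)))) q"
        using K s0 exponents by (intro epowr_mono) (auto simp: monotone_on_def)
      ultimately show "?f s \<le> ?u k * 1"
        unfolding f[OF s0(1)] mult_1_right by (intro mult_mono ennreal_leI) auto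
    qed (use dyad_cover dyad_sets in auto)
    also have "\<dots> \<le> (\<Sum>\<^sup>+ k. ennreal (c powr q * c powr q) * epowr (ennreal (W (k + 1)) * K (2 powr real_of_int (k + 1))) q)"
    proof (intro nn_integral_mono)
      fix k
      have "(c * W k) powr q \<le> (c * c * W (k + 1)) powr q"
        using c(1) c(2)[of k] W_pos[of k] exponents by (intro powr_mono2) auto
      also have "\<dots> = c powr q * c powr q * W (k + 1) powr q" by (simp only: powr_mult)
      finally have "ennreal ((c * W k) powr q) * epowr (K (2 powr (real_of_int (k + 1)))) q
        \<le> ennreal (c powr q * c powr q * W (k + 1) powr q) * epowr (K (2 powr (real_of_int (k + 1)))) q"
        by (intro mult_right_mono ennreal_leI) auto
      moreover have "?u k * ennreal (2 powr real_of_int k)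
        = ennreal ((c * W k) powr q) * epowr (K (2 powr (real_of_int (k + 1)))) q"
      proof -
        have "ennreal ((c * W k) powr q / 2 powr real_of_int k) * ennreal (2 powr real_of_int k) = ennreal ((c * W k) powr q)"
          by (simp flip: ennreal_mult')
        then show ?thesis by (metis mult.commute mult.assoc)
      qed
      ultimately show "?u k * (\<integral>\<^sup>+ s\<in>dyad k. 1 \<partial>lebesgue)
        \<le> ennreal (c powr q * c powr q) * epowr (ennreal (W (k + 1)) * K (2 powr real_of_int (k + 1))) q"
        unfolding meas split by (simp add: ennreal_mult mult.assoc)
    qed
    also have "\<dots> = ennreal (c powr q * c powr q) * ?S"
      using shift_sum[of "\<lambda>k. epowr (ennreal (W k) * K (2 powr real_of_int k)) q"]
      by (simp add: nn_integral_cmult)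
    also have "\<dots> \<le> ennreal C * ?S" by (intro mult_right_mono ennreal_leI) (auto simp: C_def)
    finally show "(\<integral>\<^sup>+ s\<in>{0<..}. ?f s \<partial>lebesgue) \<le> ennreal C * ?S" .
    have "(\<Sum>\<^sup>+ k. ?v k * (\<integral>\<^sup>+ s\<in>dyad k. 1 \<partial>lebesgue))
       \<le> (\<integral>\<^sup>+ s\<in>{0<..}. ?f s \<partial>lebesgue)"
    proof (intro nn_integral_ge_steps)
      show "disjoint_family dyad" by (rule dyad_disjoint)
      show "dyad k \<subseteq> {0<..}" for k using less_trans[of 0 "2 powr real_of_int k"] by (auto simp: dyad_def)
      fix k s assume s: "s \<in> dyad k"
      then have s0: "0 < s" "2 powr real_of_int k \<le> s" "s \<le> 2 * 2 powr real_of_int k"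
        using less_trans[of 0 "2 powr real_of_int k" s] by (auto simp: dyad_def powr_add)
      have "W k / c \<le> s powr (- \<theta>) * b s"
        using c(4)[OF s] c(1) by (simp add: field_simps)
      then have "(W k / c) powr q / (2 * 2 powr real_of_int k) \<le> (s powr (- \<theta>) * b s) powr q / s"
        using s0 b_pos[of s] exponents W_pos[of k] c(1) by (intro frac_le powr_mono2) auto
      moreover have "epowr (K (2 powr (real_of_int k))) q \<le> epowr (K s) q"
        using K s0 exponents by (intro epowr_mono) (auto simp: monotone_on_def)
      ultimately show "?v k * 1 \<le> ?f s"
        unfolding f[OF s0(1)] mult_1_right by (intro mult_mono ennreal_leI) auto
    qed (use dyad_sets in auto)
    also have "(\<Sum>\<^sup>+ k. ?v k * (\<integral>\<^sup>+ s\<in>dyad k. 1 \<partial>lebesgue))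
      = (\<Sum>\<^sup>+ k. ennreal (1 / (2 * c powr q)) * epowr (ennreal (W k) * K (2 powr real_of_int k)) q)"
    proof (intro nn_integral_cong)
      fix k
      have "(W k / c) powr q / (2 * 2 powr real_of_int k) * 2 powr real_of_int k = 1 / (2 * c powr q) * W k powr q"
        using c(1) W_pos[of k] by (simp add: powr_divide)
      then have "ennreal ((W k / c) powr q / (2 * 2 powr real_of_int k)) * ennreal (2 powr real_of_int k) = ennreal (1 / (2 * c powr q)) * ennreal (W k powr q)"
        by (simp flip: ennreal_mult')
      then show "?v k * (\<integral>\<^sup>+ s\<in>dyad k. 1 \<partial>lebesgue)
        = ennreal (1 / (2 * c powr q)) * epowr (ennreal (W k) * K (2 powr real_of_int k)) q"
        unfolding meas split by (metis mult.commute mult.assoc)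
    qed
    also have "\<dots> = ennreal (1 / (2 * c powr q)) * ?S" by (simp add: nn_integral_cmult)
    finally have "ennreal (2 * c powr q) * (ennreal (1 / (2 * c powr q)) * ?S) \<le> ennreal (2 * c powr q) * (\<integral>\<^sup>+ s\<in>{0<..}. ?f s \<partial>lebesgue)"
      by (rule mult_left_mono) simp
    also have "ennreal (2 * c powr q) * (ennreal (1 / (2 * c powr q)) * ?S) = ?S"
      using c(1) by (simp add: mult.assoc[symmetric] ennreal_mult'[symmetric])
    also have "ennreal (2 * c powr q) * (\<integral>\<^sup>+ s\<in>{0<..}. ?f s \<partial>lebesgue) \<le> ennreal C * (\<integral>\<^sup>+ s\<in>{0<..}. ?f s \<partial>lebesgue)"
      by (intro mult_right_mono ennreal_leI) (auto simp: C_def)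
    finally show "?S \<le> ennreal C * (\<integral>\<^sup>+ s\<in>{0<..}. ?f s \<partial>lebesgue)" .
  qed
qed

text \<open>
  In terms of the tails, the weight \<open>bt powr q / t\<close> is a function that is nearly constant on each
  cell times the density \<open>T1 powr (- q1) * b1 powr q1 / t\<close>, which is proportional to the
  logarithmic derivative of \<open>1 / T1\<close>.
\<close>
lemma weight_bt:
  assumes t: "0 < t"
  shows "weight q bt t = ennreal ((\<rho> t powr (- \<theta>) * b (\<rho> t) * T0 t) powr q * T1 t powr (- q1)) * weight q1 b1 t"
proof -
  define r B x where "r = \<rho> t" and "B = b (\<rho> t)" and "x = T1 t"
  have pos: "0 < r" "0 < B" "0 < x" "0 < b1 t"
    using t rho_pos b_pos T1_pos SV0_pos[OF weights(2) exponents(2)] by (auto simp: r_def B_def x_def)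
  have T0: "T0 t = r * x" using T0_eq[OF t] by (simp add: r_def x_def)
  have "bt t = r powr (1 - \<theta>) * B * b1 t powr (q1 / q) * (x powr q1) powr (1 / q1 - 1 / q)"
    using bt_def[OF t] tail_powr_eq_integral[OF weights(2) exponents(2) t] by (simp add: r_def B_def x_def)
  also have "r powr (1 - \<theta>) = r powr (- \<theta>) * r"
    using pos by (simp add: powr_diff powr_minus divide_inverse)
  also have "(x powr q1) powr (1 / q1 - 1 / q) = x * x powr (- q1 / q)"
  proof -
    have "q1 * (1 / q1 - 1 / q) = 1 + - q1 / q" using exponents by (simp add: field_simps)
    then show ?thesis using pos by (simp add: powr_powr powr_add[of x 1 "- q1 / q", simplified])
  qed
  finally have "bt t = (r powr (- \<theta>) * B * T0 t) * b1 t powr (q1 / q) * x powr (- q1 / q)"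
    by (simp add: T0 mult_ac)
  then have "bt t powr q = (r powr (- \<theta>) * B * T0 t) powr q * (b1 t powr (q1 / q)) powr q * (x powr (- q1 / q)) powr q"
    by (simp only: powr_mult)
  also have "(b1 t powr (q1 / q)) powr q = b1 t powr q1" using exponents by (simp add: powr_powr)
  also have "(x powr (- q1 / q)) powr q = x powr (- q1)" using exponents by (simp add: powr_powr)
  finally have e: "bt t powr q / t = ((r powr (- \<theta>) * B * T0 t) powr q * x powr (- q1)) * (b1 t powr q1 / t)"
    by (simp add: mult_ac)
  show ?thesis
    unfolding weight_def e unfolding r_def B_def x_def by (intro ennreal_mult') simp
qed

lemma bt_nonneg: "0 < t \<Longrightarrow> 0 \<le> bt t"
  using bt_def[of t] b_pos[OF rho_pos, of t] by simp

lemma cell_weight: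
  "(mass q1 b1 (cell k)) \<le> ennreal (T1 (node k) powr q1)"
  "ennreal ((1 - 2 powr (- q1)) * T1 (node k) powr q1) \<le> (mass q1 b1 (cell k))"
proof -
  have *: "0 < node k" "node k \<le> node (k + 1)" by (auto simp: node_pos node_mono)
  show "(mass q1 b1 (cell k)) \<le> ennreal (T1 (node k) powr q1)"
    unfolding cell_def by (rule weight_interval_le_tail[OF weights(2) exponents(2) *])
  let ?I = "mass q1 b1 (cell k)"
  have "?I + ennreal (T1 (node (k + 1)) powr q1) = ennreal (T1 (node k) powr q1)"
    unfolding cell_def by (rule weight_interval[OF weights(2) exponents(2) *])
  then have "?I = ennreal (T1 (node k) powr q1) - ennreal (T1 (node (k + 1)) powr q1)"
    by (metis ennreal_add_diff_cancel_right ennreal_neq_top infinity_ennreal_def)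
  also have "\<dots> = ennreal (T1 (node k) powr q1 - T1 (node (k + 1)) powr q1)"
    by (simp add: ennreal_minus)
  finally have I: "?I = ennreal (T1 (node k) powr q1 - T1 (node (k + 1)) powr q1)" .
  have "T1 (node (k + 1)) powr q1 \<le> (1 / 2 * T1 (node k)) powr q1"
    using T1_halving[of k] T1_pos[OF node_pos, of "k + 1"] exponents by (intro powr_mono2) auto
  moreover have "(1 / 2 :: real) powr q1 = 2 powr (- q1)"
    by (simp add: powr_minus_divide powr_divide)
  ultimately have "(1 - 2 powr (- q1)) * T1 (node k) powr q1 \<le> T1 (node k) powr q1 - T1 (node (k + 1)) powr q1"
    unfolding powr_mult by (simp add: algebra_simps)
  then have "ennreal ((1 - 2 powr (- q1)) * T1 (node k) powr q1) \<le> ennreal (T1 (node k) powr q1 - T1 (node (k + 1)) powr q1)"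
    by (rule ennreal_leI)
  then show "ennreal ((1 - 2 powr (- q1)) * T1 (node k) powr q1) \<le> ?I" unfolding I .
qed

abbreviation coeff where "coeff \<omega> k \<equiv> ennreal (T0 (node k)) * \<omega> (node k)"

text \<open>
  By \<open>tail_doubling\<close> and \<open>T1_halving\<close> each cell has mass comparable to 1 with respect to the
  logarithmic derivative in \<open>weight_bt\<close>, while the remaining factors of the integrand vary on it by
  constant factors, up to a shift of \<open>\<omega>\<close> by one node.
\<close>
lemma besov_discrete:
  "\<exists>C>0. \<forall>\<omega>. mono_on {0<..} \<omega> \<longrightarrow>
     comparable C (\<integral>\<^sup>+ t\<in>{0<..}. epowr (ennreal (t powr (- 1 / q) * bt t) * \<omega> t) q \<partial>lebesgue)
       (\<Sum>\<^sup>+ k. epowr (ennreal (W k) * coeff \<omega> k) q)"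
proof -
  obtain c where c: "c \<ge> 1" "\<And>k. W k \<le> c * W (k + 1)"
    "\<And>k s. s \<in> dyad k \<Longrightarrow> s powr (- \<theta>) * b s \<le> c * W k"
    "\<And>k s. s \<in> dyad k \<Longrightarrow> W k \<le> c * (s powr (- \<theta>) * b s)"
    using W_dyad by blast
  obtain D where D: "D \<ge> 1" "\<And>k. T0 (node k) \<le> D * T0 (node (k + 1))" "\<And>k. T1 (node k) \<le> D * T1 (node (k + 1))"
    using tail_doubling by blast
  define \<kappa> where "\<kappa> = 1 - 2 powr (- q1)"
  have "(2::real) powr (- q1) < 2 powr 0" using exponents by (intro powr_less_mono) auto
  then have k0: "0 < \<kappa>" by (simp add: \<kappa>_def)
  define C1 where "C1 = (c * c * D) powr q * D powr q1"
  define C2 where "C2 = (c * D) powr q / \<kappa>"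
  have C0: "0 < C1" "0 < C2" using c(1) D(1) k0 by (auto simp: C1_def C2_def)
  have P0: "0 < T0 (node k)" "0 < T1 (node k)" "0 < W k" for k
    using T0_pos T1_pos W_pos node_pos by auto
  show ?thesis
  proof (intro exI[of _ "C1 + C2"] conjI allI impI)
    show "0 < C1 + C2" using C0 by simp
    fix \<omega> :: "real \<Rightarrow> ennreal" assume \<omega>: "mono_on {0<..} \<omega>"
    let ?f = "\<lambda>t. epowr (ennreal (t powr (- 1 / q) * bt t) * \<omega> t) q"
    let ?S = "\<Sum>\<^sup>+ k. epowr (ennreal (W k) * coeff \<omega> k) q"
    let ?u = "\<lambda>k. (c * W k * T0 (node k)) powr q * T1 (node (k + 1)) powr (- q1)"
    let ?v = "\<lambda>k. (W k / c * T0 (node (k + 1))) powr q * T1 (node k) powr (- q1)"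
    let ?o = "\<lambda>k. epowr (\<omega> (node k)) q"
    let ?m = "\<lambda>k. mass q1 b1 (cell k)"
    let ?a = "\<lambda>k. epowr (ennreal (W k) * coeff \<omega> k) q"
    define R where "R t = \<rho> t powr (- \<theta>) * b (\<rho> t) * T0 t" for t
    have f: "?f t = ennreal (R t powr q * T1 t powr (- q1)) * epowr (\<omega> t) q * weight q1 b1 t" if t: "0 < t" for t
    proof -
      have "?f t = weight q bt t * epowr (\<omega> t) q"
        using exponents epowr_weight[of q t bt] bt_nonneg[OF t] t by (simp add: epowr_mult)
      then show ?thesis unfolding weight_bt[OF t] R_def by (simp only: mult_ac)
    qed
    have split: "epowr (ennreal (W k) * coeff \<omega> k) q
       = ennreal ((W k * T0 (node k)) powr q) * epowr (\<omega> (node k)) q" for k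
      using exponents P0[of k] by (simp add: epowr_mult epowr_ennreal powr_mult ennreal_mult mult.assoc)
    have cellD: "0 < t" "node k \<le> t" "t \<le> node (k + 1)" "\<rho> t \<in> dyad k" if "t \<in> cell k" for k t
    proof -
      show "0 < t" "\<rho> t \<in> dyad k" using that by (simp_all add: mem_cell_iff)
      show "node k \<le> t" "t \<le> node (k + 1)" using that by (simp_all add: cell_def)
    qed
    have "(\<integral>\<^sup>+ t\<in>{0<..}. ?f t \<partial>lebesgue) \<le>
      (\<Sum>\<^sup>+ k. (ennreal (?u k) * ?o (k + 1)) * ?m k)"
    proof (intro nn_integral_le_steps)
      show "(\<lambda>x. weight q1 b1 x * indicator (cell k) x) \<in> borel_measurable lebesgue" for k
        by (intro borel_measurable_weight SV0_SV[OF weights(2) exponents(2)] cell_sets cell_subset)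
      fix k t assume t: "t \<in> cell k"
      note t' = cellD[OF t]
      have "R t \<le> c * W k * T0 (node k)"
        unfolding R_def using c(3)[OF t'(4)] T0_antimono[OF node_pos t'(2)] T0_pos[OF t'(1)] P0 c(1)
        by (intro mult_mono[of "\<rho> t powr (- \<theta>) * b (\<rho> t)"]) (auto intro!: mult_nonneg_nonneg simp: less_imp_le)
      then have "R t powr q \<le> (c * W k * T0 (node k)) powr q"
        using exponents b_pos[OF rho_pos[OF t'(1)]] T0_pos[OF t'(1)] by (intro powr_mono2) (auto simp: R_def)
      moreover have "T1 t powr (- q1) \<le> T1 (node (k + 1)) powr (- q1)"
        using T1_antimono[OF t'(1,3)] exponents P0 by (intro powr_mono2') auto
      moreover have "epowr (\<omega> t) q \<le> ?o (k + 1)"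
        using \<omega> t' node_pos exponents by (intro epowr_mono) (auto simp: monotone_on_def)
      ultimately show "?f t \<le> (ennreal (?u k) * ?o (k + 1)) * weight q1 b1 t"
        unfolding f[OF t'(1)] by (intro mult_mono ennreal_leI) auto
    qed (use cell_cover cell_sets in auto)
    also have "\<dots> \<le> (\<Sum>\<^sup>+ k. ennreal C1 * ?a (k + 1))"
    proof (intro nn_integral_mono)
      fix k
      have "c * W k * T0 (node k) \<le> c * (c * W (k + 1)) * (D * T0 (node (k + 1)))"
        using c D P0 by (intro mult_mono[of "c * W k"] mult_left_mono) (auto intro!: mult_nonneg_nonneg simp: less_imp_le)
      then have "(c * W k * T0 (node k)) powr q \<le> ((c * c * D) * (W (k + 1) * T0 (node (k + 1)))) powr q"
        using c(1) P0[of k] exponents by (intro powr_mono2) (auto simp: mult_ac)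
      also have "\<dots> = (c * c * D) powr q * (W (k + 1) * T0 (node (k + 1))) powr q" by (rule powr_mult)
      finally have 1: "(c * W k * T0 (node k)) powr q \<le> (c * c * D) powr q * (W (k + 1) * T0 (node (k + 1))) powr q" .
      have "T1 (node k) powr q1 \<le> (D * T1 (node (k + 1))) powr q1"
        using D(3)[of k] P0[of k] exponents by (intro powr_mono2) auto
      then have "T1 (node k) powr q1 \<le> D powr q1 * T1 (node (k + 1)) powr q1" by (simp only: powr_mult)
      then have 2: "T1 (node (k + 1)) powr (- q1) * T1 (node k) powr q1 \<le> D powr q1"
        using P0[of "k + 1"] by (simp add: powr_minus field_simps)
      have "(c * W k * T0 (node k)) powr q * (T1 (node (k + 1)) powr (- q1) * T1 (node k) powr q1)
          \<le> ((c * c * D) powr q * (W (k + 1) * T0 (node (k + 1))) powr q) * D powr q1"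
        using 1 2 by (intro mult_mono) auto
      then have 3: "ennreal (?u k) * ennreal (T1 (node k) powr q1)
          \<le> ennreal C1 * ennreal ((W (k + 1) * T0 (node (k + 1))) powr q)"
        by (simp add: C1_def ennreal_mult'[symmetric] mult_ac ennreal_leI)
      have "(ennreal (?u k) * ?o (k + 1)) * ?m k
         \<le> (ennreal (?u k) * ?o (k + 1)) * ennreal (T1 (node k) powr q1)"
        by (intro mult_left_mono cell_weight) simp
      also have "\<dots> = (ennreal (?u k) * ennreal (T1 (node k) powr q1)) * ?o (k + 1)"
        by (simp only: mult_ac)
      also have "\<dots> \<le> (ennreal C1 * ennreal ((W (k + 1) * T0 (node (k + 1))) powr q)) * ?o (k + 1)"
        using 3 by (rule mult_right_mono) simp
      finally show "(ennreal (?u k) * ?o (k + 1)) * ?m k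
        \<le> ennreal C1 * ?a (k + 1)"
        unfolding split by (simp only: mult.assoc)
    qed
    also have "\<dots> = ennreal C1 * ?S"
      using shift_sum[of ?a]
      by (simp add: nn_integral_cmult)
    also have "\<dots> \<le> ennreal (C1 + C2) * ?S" using C0 by (intro mult_right_mono ennreal_leI) auto
    finally show "(\<integral>\<^sup>+ t\<in>{0<..}. ?f t \<partial>lebesgue) \<le> ennreal (C1 + C2) * ?S" .
    have "(\<Sum>\<^sup>+ k. ennreal (1 / C2) * ?a k)
      \<le> (\<Sum>\<^sup>+ k. (ennreal (?v k) * ?o k) * ?m k)"
    proof (intro nn_integral_mono)
      fix k
      have "W k * T0 (node k) / (c * D) \<le> W k / c * T0 (node (k + 1))"
        using D(1) D(2)[of k] c(1) P0[of k] by (simp add: field_simps)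
      then have "(W k * T0 (node k) / (c * D)) powr q \<le> (W k / c * T0 (node (k + 1))) powr q"
        using c(1) D(1) P0[of k] exponents by (intro powr_mono2) auto
      moreover have "(W k * T0 (node k) / (c * D)) powr q = (W k * T0 (node k)) powr q / (c * D) powr q"
        by (rule powr_divide)
      ultimately have le: "(W k * T0 (node k)) powr q / (c * D) powr q * \<kappa> \<le> (W k / c * T0 (node (k + 1))) powr q * \<kappa>"
        using k0 by (intro mult_right_mono) auto
      have "T1 (node k) powr (- q1) * T1 (node k) powr q1 = 1"
        using P0[of k] by (simp flip: powr_add)
      then have eq1: "(W k / c * T0 (node (k + 1))) powr q * \<kappa> = ?v k * (\<kappa> * T1 (node k) powr q1)"
        by (simp add: mult_ac)
      have eq2: "1 / C2 * (W k * T0 (node k)) powr q = (W k * T0 (node k)) powr q / (c * D) powr q * \<kappa>"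
        by (simp add: C2_def)
      have "1 / C2 * (W k * T0 (node k)) powr q
          \<le> ?v k * (\<kappa> * T1 (node k) powr q1)"
        unfolding eq2 eq1[symmetric] by (rule le)
      then have "ennreal (1 / C2 * (W k * T0 (node k)) powr q)
          \<le> ennreal (?v k * (\<kappa> * T1 (node k) powr q1))"
        by (rule ennreal_leI)
      then have 3: "ennreal (1 / C2) * ennreal ((W k * T0 (node k)) powr q) \<le>
         ennreal (?v k) * ennreal (\<kappa> * T1 (node k) powr q1)"
        using C0 by (subst (asm) (1 2) ennreal_mult') auto
      have "ennreal (1 / C2) * ennreal ((W k * T0 (node k)) powr q) * ?o k \<le>
         ennreal (?v k) * ennreal (\<kappa> * T1 (node k) powr q1) * ?o k"
        using 3 by (rule mult_right_mono) simp
      also have "\<dots> = (ennreal (?v k) * ?o k) * ennreal (\<kappa> * T1 (node k) powr q1)"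
        by (simp only: mult_ac)
      also have "\<dots> \<le> (ennreal (?v k) * ?o k) * ?m k"
        unfolding \<kappa>_def by (intro mult_left_mono cell_weight) simp
      finally show "ennreal (1 / C2) * ?a k \<le>
        (ennreal (?v k) * ?o k) * ?m k"
        unfolding split by (simp only: mult.assoc)
    qed
    also have "\<dots> \<le> (\<integral>\<^sup>+ t\<in>{0<..}. ?f t \<partial>lebesgue)"
    proof (intro nn_integral_ge_steps)
      show "(\<lambda>x. weight q1 b1 x * indicator (cell k) x) \<in> borel_measurable lebesgue" for k
        by (intro borel_measurable_weight SV0_SV[OF weights(2) exponents(2)] cell_sets cell_subset)
      fix k t assume t: "t \<in> cell k"
      note t' = cellD[OF t]
      have "W k / c \<le> \<rho> t powr (- \<theta>) * b (\<rho> t)" using c(4)[OF t'(4)] c(1) by (simp add: field_simps)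
      then have "W k / c * T0 (node (k + 1)) \<le> R t"
        unfolding R_def using T0_antimono[OF t'(1,3)] P0 c(1) b_pos[OF rho_pos[OF t'(1)]]
        by (intro mult_mono[of "W k / c"]) (auto simp: less_imp_le)
      then have "(W k / c * T0 (node (k + 1))) powr q \<le> R t powr q"
        using P0 c(1) exponents by (intro powr_mono2) (auto intro!: mult_nonneg_nonneg simp: less_imp_le)
      moreover have "T1 (node k) powr (- q1) \<le> T1 t powr (- q1)"
        using T1_antimono[OF node_pos t'(2)] exponents T1_pos[OF t'(1)] by (intro powr_mono2') auto
      moreover have "?o k \<le> epowr (\<omega> t) q"
        using \<omega> t' node_pos exponents by (intro epowr_mono) (auto simp: monotone_on_def)
      ultimately show "(ennreal (?v k) * ?o k) * weight q1 b1 t \<le> ?f t"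
        unfolding f[OF t'(1)] by (intro mult_mono ennreal_leI) auto
    qed (use cell_subset cell_disjoint in auto)
    finally have "ennreal (1 / C2) * ?S \<le> (\<integral>\<^sup>+ t\<in>{0<..}. ?f t \<partial>lebesgue)" by (simp add: nn_integral_cmult)
    then have "ennreal C2 * (ennreal (1 / C2) * ?S) \<le> ennreal C2 * (\<integral>\<^sup>+ t\<in>{0<..}. ?f t \<partial>lebesgue)"
      by (rule mult_left_mono) simp
    also have "ennreal C2 * (ennreal (1 / C2) * ?S) = ?S"
      using C0 by (simp add: mult.assoc[symmetric] ennreal_mult'[symmetric])
    also have "ennreal C2 * (\<integral>\<^sup>+ t\<in>{0<..}. ?f t \<partial>lebesgue) \<le> ennreal (C1 + C2) * (\<integral>\<^sup>+ t\<in>{0<..}. ?f t \<partial>lebesgue)"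
      using C0 by (intro mult_right_mono ennreal_leI) auto
    finally show "?S \<le> ennreal (C1 + C2) * (\<integral>\<^sup>+ t\<in>{0<..}. ?f t \<partial>lebesgue)" .
  qed
qed

end

section \<open>The K-functional and the interpolation space\<close>

lemma modulus_mono_on: "mono_on S (modulus E f)"
  unfolding modulus_def by (intro monotone_onI SUP_subset_mono) auto

lemma K_functional_mono_on: "mono_on S (\<lambda>t. K_functional A0 A1 t f)"
proof (intro monotone_onI)
  fix s t :: real assume "s \<le> t"
  then show "K_functional A0 A1 s f \<le> K_functional A0 A1 t f"
    unfolding K_functional_def by (intro Inf_mono) (force intro!: add_left_mono mult_right_mono ennreal_leI)
qed

context limiting_weights
begin

lemma T1_node: "T1 (node k) = 2 powr (- real_of_int k) * T0 (node k)"
  by (simp add: T0_eq node_pos rho_node powr_minus)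

text \<open>
  On a cell below \<open>node k\<close> the weight integrates to at most the power of \<open>T0\<close> at its left end, and
  \<open>\<omega>\<close> is bounded by its value at its right end; \<open>tail_doubling\<close> moves both to the same node.
  The cell next to \<open>node k\<close> and the half line beyond, where the bound for \<open>w\<close> is constant,
  together contribute the term \<open>i = 0\<close>.
\<close>
lemma besov_low:
  "\<exists>C>0. \<forall>\<omega> w k. mono_on {0<..} \<omega> \<longrightarrow> (\<forall>u>0. w u \<le> 2 * \<omega> (min u (node k))) \<longrightarrow>
     (\<integral>\<^sup>+ u\<in>{0<..}. epowr (ennreal (u powr (- 1 / q0) * b0 u) * w u) q0 \<partial>lebesgue)
      \<le> ennreal C * (\<Sum>\<^sup>+ i. epowr (ennreal (T0 (node (k - int i))) * \<omega> (node (k - int i))) q0)"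
proof -
  obtain D where D: "D \<ge> 1" "\<And>k. T0 (node k) \<le> D * T0 (node (k + 1))"
    using tail_doubling by blast
  show ?thesis
  proof (intro exI[of _ "2 powr q0 * D powr q0"] conjI allI impI)
    show "0 < 2 powr q0 * D powr q0" using D(1) by simp
    fix \<omega> w :: "real \<Rightarrow> ennreal" and k
    assume \<omega>: "mono_on {0<..} \<omega>" and le: "\<forall>u>0. w u \<le> 2 * \<omega> (min u (node k))"
    let ?f = "\<lambda>u. epowr (ennreal (u powr (- 1 / q0) * b0 u) * w u) q0"
    have SV: "b0 \<in> SV" using SV0_SV[OF weights(1) exponents(1)] .
    define A where "A i = (if i = 0 then {node (k - 1)<..} else cell (k - 1 - int i))" for i :: nat
    define c where "c i = ennreal (2 powr q0) * epowr (\<omega> (node (k - int i))) q0" for i :: nat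
    have Asub: "A i \<subseteq> {0<..}" and Asets: "A i \<in> sets lebesgue" for i
      using cell_subset cell_sets node_pos[of "k - 1"] by (auto simp: A_def)
    have cover: "{0<..} \<subseteq> (\<Union>i. A i)"
    proof
      fix u :: real assume u: "u \<in> {0<..}"
      show "u \<in> (\<Union>i. A i)"
      proof (cases "node (k - 1) < u")
        case True
        then have "u \<in> A 0" by (simp add: A_def)
        then show ?thesis by blast
      next
        case False
        obtain j where j: "u \<in> cell j" using cell_cover u by auto
        have "node j < node (k - 1)" using j False by (simp add: cell_def)
        then have "j < k - 1" using node_mono[of "k - 1" j] by linarith
        then have "u \<in> A (nat (k - 1 - j))" using j by (simp add: A_def)
        then show ?thesis by blast
      qed
    qed
    have mass: "mass q0 b0 (A i) \<le> ennreal (D powr q0 * T0 (node (k - int i)) powr q0)" for i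
    proof -
      have "mass q0 b0 (A i) \<le> ennreal (T0 (node (k - 1 - int i)) powr q0)"
        using weight_tail[OF weights(1) exponents(1) node_pos, of "k - 1"]
          weight_interval_le_tail[OF weights(1) exponents(1) node_pos node_mono, of "k - 1 - int i" "k - 1 - int i + 1"]
        by (auto simp: A_def cell_def)
      also have "T0 (node (k - 1 - int i)) powr q0 \<le> (D * T0 (node (k - int i))) powr q0"
        using D(2)[of "k - 1 - int i"] T0_pos[OF node_pos, of "k - 1 - int i"] exponents by (intro powr_mono2) auto
      then have "ennreal (T0 (node (k - 1 - int i)) powr q0) \<le> ennreal (D powr q0 * T0 (node (k - int i)) powr q0)"
        unfolding powr_mult by (rule ennreal_leI)
      finally show ?thesis .
    qed
    have "(\<integral>\<^sup>+ u\<in>{0<..}. ?f u \<partial>lebesgue) \<le> (\<Sum>\<^sup>+ i. c i * mass q0 b0 (A i))"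
    proof (intro nn_integral_le_steps)
      show "(\<lambda>u. weight q0 b0 u * indicator (A i) u) \<in> borel_measurable lebesgue" for i
        by (intro borel_measurable_weight SV Asets Asub)
      fix i u assume u: "u \<in> A i"
      then have u0: "0 < u" using Asub by auto
      have "\<omega> (min u (node k)) \<le> \<omega> (node (k - int i))"
      proof (cases "i = 0")
        case False
        then have "u \<le> node (k - int i)" using u by (simp add: A_def cell_def)
        then show ?thesis using \<omega> u0 node_pos by (auto simp: monotone_on_def)
      qed (use \<omega> u0 node_pos in \<open>auto simp: monotone_on_def\<close>)
      then have "w u \<le> 2 * \<omega> (node (k - int i))"
        using le u0 by (meson mult_left_mono order_trans zero_le)
      then have "epowr (w u) q0 \<le> epowr (2 * \<omega> (node (k - int i))) q0"
        using exponents by (intro epowr_mono) auto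
      also have "\<dots> = c i"
        using exponents epowr_ennreal[of 2 q0] by (simp add: epowr_mult c_def)
      finally have "epowr (w u) q0 * weight q0 b0 u \<le> c i * weight q0 b0 u" by (rule mult_right_mono) simp
      moreover have "?f u = epowr (w u) q0 * weight q0 b0 u"
        using exponents epowr_weight[of q0 u b0] SV0_pos[OF weights(1) exponents(1) u0] u0
        by (simp add: epowr_mult mult.commute)
      ultimately show "?f u \<le> c i * weight q0 b0 u" by simp
    qed (use cover Asets in auto)
    also have "\<dots> \<le> (\<Sum>\<^sup>+ i. ennreal (2 powr q0 * D powr q0) * epowr (ennreal (T0 (node (k - int i))) * \<omega> (node (k - int i))) q0)"
    proof (intro nn_integral_mono)
      fix i :: nat
      have "c i * mass q0 b0 (A i) \<le> c i * ennreal (D powr q0 * T0 (node (k - int i)) powr q0)"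
        by (intro mult_left_mono mass) simp
      also have "\<dots> = ennreal (2 powr q0 * D powr q0) * epowr (ennreal (T0 (node (k - int i))) * \<omega> (node (k - int i))) q0"
        using exponents T0_pos[OF node_pos, of "k - int i"]
        by (simp add: c_def epowr_mult epowr_ennreal ennreal_mult mult_ac)
      finally show "c i * mass q0 b0 (A i) \<le> \<dots>" .
    qed
    also have "\<dots> = ennreal (2 powr q0 * D powr q0) * (\<Sum>\<^sup>+ i. epowr (ennreal (T0 (node (k - int i))) * \<omega> (node (k - int i))) q0)"
      by (simp add: nn_integral_cmult)
    finally show "(\<integral>\<^sup>+ u\<in>{0<..}. ?f u \<partial>lebesgue) \<le> \<dots>" .
  qed
qed

text \<open>
  The linear bound for \<open>w\<close> makes the part below \<open>node k\<close> contribute no more than the tail at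
  \<open>node k\<close>, by \<open>weight_near_zero\<close>. The part above is summed over cells as in \<open>besov_low\<close>.
\<close>
lemma besov_high:
  "\<exists>C>0. \<forall>\<omega> w k. mono_on {0<..} \<omega> \<longrightarrow> (\<forall>u>0. w u \<le> \<omega> u) \<longrightarrow>
     (\<forall>u. 0 < u \<longrightarrow> u \<le> node k \<longrightarrow> w u \<le> ennreal (M * (u / node k)) * \<omega> (node k)) \<longrightarrow>
     (\<integral>\<^sup>+ u\<in>{0<..}. epowr (ennreal (u powr (- 1 / q1) * b1 u) * w u) q1 \<partial>lebesgue)
      \<le> ennreal C * (\<Sum>\<^sup>+ i. epowr (ennreal (T1 (node (k + int i))) * \<omega> (node (k + int i))) q1)"
proof -
  obtain D where D: "D \<ge> 1" "\<And>k. T1 (node k) \<le> D * T1 (node (k + 1))"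
    using tail_doubling by blast
  obtain L where L: "L > 0" "\<And>t. t > 0 \<Longrightarrow> (\<integral>\<^sup>+ u\<in>{0<..t}. ennreal (u powr q1) * weight q1 b1 u \<partial>lebesgue)
      \<le> ennreal (L * (t powr q1 * T1 t powr q1))"
    using weight_near_zero[OF weights(2) exponents(2)] by blast
  have SV: "b1 \<in> SV" using SV0_SV[OF weights(2) exponents(2)] .
  define m where "m = max M 0"
  define C where "C = m powr q1 * L + D powr q1"
  show ?thesis
  proof (intro exI[of _ C] conjI allI impI)
    show "0 < C" using D(1) L(1) by (simp add: C_def add_nonneg_pos)
    fix \<omega> w :: "real \<Rightarrow> ennreal" and k
    assume \<omega>: "mono_on {0<..} \<omega>" and le: "\<forall>u>0. w u \<le> \<omega> u"
      and le': "\<forall>u. 0 < u \<longrightarrow> u \<le> node k \<longrightarrow> w u \<le> ennreal (M * (u / node k)) * \<omega> (node k)"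
    let ?f = "\<lambda>u. epowr (ennreal (u powr (- 1 / q1) * b1 u) * w u) q1"
    define \<nu> where "\<nu> = node k"
    have \<nu>: "0 < \<nu>" using node_pos by (simp add: \<nu>_def)
    define a where "a i = epowr (ennreal (T1 (node (k + int i))) * \<omega> (node (k + int i))) q1" for i
    have a: "a i = ennreal (T1 (node (k + int i)) powr q1) * epowr (\<omega> (node (k + int i))) q1" for i
      using exponents T1_pos[OF node_pos, of "k + int i"] by (simp add: a_def epowr_mult epowr_ennreal)
    have f: "?f u = epowr (w u) q1 * weight q1 b1 u" if u: "0 < u" for u
      using exponents epowr_weight[of q1 u b1] SV0_pos[OF weights(2) exponents(2) u] u
      by (simp add: epowr_mult mult.commute)
    define A where "A i = (if i = 0 then {0<..\<nu>} else cell (k + int i - 1))" for i :: nat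
    \<comment> \<open>Below the node the linear growth of the bound for \<open>w\<close> becomes part of the density.\<close>
    define \<beta> where "\<beta> i u = (if i = 0 then ennreal (u powr q1) * weight q1 b1 u else weight q1 b1 u)" for i :: nat and u
    define c where "c i = (if i = 0 then ennreal ((m / \<nu>) powr q1) else 1) * epowr (\<omega> (node (k + int i))) q1" for i :: nat
    have Asub: "A i \<subseteq> {0<..}" and Asets: "A i \<in> sets lebesgue" for i
      using cell_subset cell_sets by (auto simp: A_def)
    have cover: "{0<..} \<subseteq> (\<Union>i. A i)"
    proof
      fix u :: real assume u: "u \<in> {0<..}"
      show "u \<in> (\<Union>i. A i)"
      proof (cases "u \<le> \<nu>")
        case True
        then have "u \<in> A 0" using u by (simp add: A_def)
        then show ?thesis by blast
      next
        case False
        obtain j where j: "u \<in> cell j" using cell_cover u by auto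
        have "node k < node (j + 1)" using j False by (simp add: cell_def \<nu>_def)
        then have "k < j + 1" using node_mono[of "j + 1" k] by linarith
        then have "u \<in> A (nat (j + 1 - k))" using j by (simp add: A_def)
        then show ?thesis by blast
      qed
    qed
    have "(\<integral>\<^sup>+ u\<in>{0<..}. ?f u \<partial>lebesgue) \<le> (\<Sum>\<^sup>+ i. c i * (\<integral>\<^sup>+ u\<in>A i. \<beta> i u \<partial>lebesgue))"
    proof (intro nn_integral_le_steps)
      fix i :: nat
      note ident_borel_measurable_lebesgue[measurable]
      have [measurable]: "(\<lambda>u. weight q1 b1 u * indicator (A i) u) \<in> borel_measurable lebesgue"
        by (intro borel_measurable_weight SV Asets Asub)
      have "(\<lambda>u. (if i = 0 then ennreal (u powr q1) else 1) * (weight q1 b1 u * indicator (A i) u)) \<in> borel_measurable lebesgue"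
        by measurable
      also have "(\<lambda>u. (if i = 0 then ennreal (u powr q1) else 1) * (weight q1 b1 u * indicator (A i) u)) = (\<lambda>u. \<beta> i u * indicator (A i) u)"
        by (auto simp: \<beta>_def mult.assoc)
      finally show "(\<lambda>u. \<beta> i u * indicator (A i) u) \<in> borel_measurable lebesgue" .
      fix u assume u: "u \<in> A i"
      then have u0: "0 < u" using Asub by auto
      show "?f u \<le> c i * \<beta> i u"
      proof (cases "i = 0")
        case True
        then have u\<nu>: "u \<le> \<nu>" using u by (simp add: A_def)
        have "w u \<le> ennreal (M * (u / \<nu>)) * \<omega> \<nu>" using le' u0 u\<nu> by (simp add: \<nu>_def)
        also have "\<dots> \<le> ennreal (u * (m / \<nu>)) * \<omega> \<nu>"
        proof -
          have "M * (u / \<nu>) \<le> m * (u / \<nu>)" using u0 \<nu> by (intro mult_right_mono) (auto simp: m_def)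
          then show ?thesis by (intro mult_right_mono ennreal_leI) (auto simp: mult_ac)
        qed
        finally have "epowr (w u) q1 \<le> epowr (ennreal (u * (m / \<nu>)) * \<omega> \<nu>) q1"
          using exponents by (intro epowr_mono) auto
        also have "\<dots> = ennreal (u powr q1) * ennreal ((m / \<nu>) powr q1) * epowr (\<omega> \<nu>) q1"
        proof -
          have "0 \<le> u * (m / \<nu>)" using u0 \<nu> by (simp add: m_def)
          then have "epowr (ennreal (u * (m / \<nu>))) q1 = ennreal (u powr q1) * ennreal ((m / \<nu>) powr q1)"
            by (simp only: epowr_ennreal powr_mult) (rule ennreal_mult', simp)
          then show ?thesis using exponents by (simp only: epowr_mult)
        qed
        finally have "epowr (w u) q1 * weight q1 b1 u \<le> ennreal (u powr q1) * ennreal ((m / \<nu>) powr q1) * epowr (\<omega> \<nu>) q1 * weight q1 b1 u"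
          by (rule mult_right_mono) simp
        then show ?thesis unfolding f[OF u0] using True by (simp add: c_def \<beta>_def \<nu>_def mult_ac)
      next
        case False
        then have "u \<le> node (k + int i)" using u by (simp add: A_def cell_def)
        then have "w u \<le> \<omega> (node (k + int i))"
          using le \<omega> u0 node_pos by (auto simp: monotone_on_def intro: order_trans)
        then have "epowr (w u) q1 \<le> c i" using False exponents by (simp add: c_def epowr_mono)
        then show ?thesis unfolding f[OF u0] using False by (simp add: \<beta>_def mult_right_mono)
      qed
    qed (use cover Asets in auto)
    also have "\<dots> \<le> (\<Sum>\<^sup>+ i. ennreal C * a i)"
    proof (intro nn_integral_mono)
      fix i :: nat
      show "c i * (\<integral>\<^sup>+ u\<in>A i. \<beta> i u \<partial>lebesgue) \<le> ennreal C * a i"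
      proof (cases "i = 0")
        case True
        have e: "(m / \<nu>) powr q1 * (L * (\<nu> powr q1 * T1 \<nu> powr q1)) = m powr q1 * L * T1 \<nu> powr q1"
          using \<nu> by (simp add: powr_divide)
        have "c i * (\<integral>\<^sup>+ u\<in>A i. \<beta> i u \<partial>lebesgue) \<le> c i * ennreal (L * (\<nu> powr q1 * T1 \<nu> powr q1))"
          using L(2)[OF \<nu>] True by (intro mult_left_mono) (auto simp: A_def \<beta>_def)
        also have "\<dots> = ennreal ((m / \<nu>) powr q1) * ennreal (L * (\<nu> powr q1 * T1 \<nu> powr q1)) * epowr (\<omega> \<nu>) q1"
          using True by (simp add: c_def \<nu>_def mult_ac)
        also have "\<dots> = ennreal (m powr q1 * L * T1 \<nu> powr q1) * epowr (\<omega> \<nu>) q1"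
          unfolding e[symmetric] by (subst ennreal_mult'[OF powr_ge_zero]) simp
        also have "\<dots> = ennreal (m powr q1 * L) * a i"
          using True L(1) by (simp add: a \<nu>_def ennreal_mult mult.assoc)
        also have "\<dots> \<le> ennreal C * a i"
          by (intro mult_right_mono ennreal_leI) (auto simp: C_def)
        finally show ?thesis .
      next
        case False
        have "mass q1 b1 (A i) \<le> ennreal (T1 (node (k + int i - 1)) powr q1)"
          using False cell_weight(1)[of "k + int i - 1"] by (simp add: A_def)
        also have "T1 (node (k + int i - 1)) powr q1 \<le> (D * T1 (node (k + int i))) powr q1"
          using D(2)[of "k + int i - 1"] T1_pos[OF node_pos, of "k + int i - 1"] exponents by (intro powr_mono2) auto
        then have "ennreal (T1 (node (k + int i - 1)) powr q1) \<le> ennreal (D powr q1 * T1 (node (k + int i)) powr q1)"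
          unfolding powr_mult by (rule ennreal_leI)
        finally have "c i * (\<integral>\<^sup>+ u\<in>A i. \<beta> i u \<partial>lebesgue) \<le> c i * ennreal (D powr q1 * T1 (node (k + int i)) powr q1)"
          using False by (intro mult_left_mono) (auto simp: \<beta>_def)
        also have "\<dots> = ennreal (D powr q1) * a i"
          using False by (simp add: a c_def ennreal_mult mult_ac)
        also have "\<dots> \<le> ennreal C * a i"
          using L(1) by (intro mult_right_mono ennreal_leI) (auto simp: C_def)
        finally show ?thesis .
      qed
    qed
    also have "\<dots> = ennreal C * (\<Sum>\<^sup>+ i. a i)" by (simp add: nn_integral_cmult)
    finally show "(\<integral>\<^sup>+ u\<in>{0<..}. ?f u \<partial>lebesgue)
      \<le> ennreal C * (\<Sum>\<^sup>+ i. epowr (ennreal (T1 (node (k + int i))) * \<omega> (node (k + int i))) q1)"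
      unfolding a_def .
  qed
qed

end

lemma tail_times_le_Lq_norm:
  fixes \<omega> :: "real \<Rightarrow> ennreal"
  assumes b: "b \<in> SV0 q" and q: "0 < q" and \<omega>: "mono_on {0<..} \<omega>" and t: "0 < t"
  shows "ennreal (tail q b t) * \<omega> t \<le> Lq_norm q {0<..} (\<lambda>u. ennreal (u powr (- 1 / q) * b u) * \<omega> u)"
proof -
  have "epowr (ennreal (tail q b t) * \<omega> t) q = ennreal (tail q b t powr q) * epowr (\<omega> t) q"
    using q tail_nonneg[OF b q] by (simp add: epowr_mult epowr_ennreal)
  also have "\<dots> = (\<integral>\<^sup>+ u. (weight q b u * indicator {t<..} u) * epowr (\<omega> t) q \<partial>lebesgue)"
    using t unfolding weight_tail[OF b q t, symmetric]
    by (intro nn_integral_multc[symmetric] borel_measurable_weight SV0_SV[OF b q]) auto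
  also have "\<dots> \<le> (\<integral>\<^sup>+ u\<in>{0<..}. epowr (ennreal (u powr (- 1 / q) * b u) * \<omega> u) q \<partial>lebesgue)"
  proof (intro nn_integral_mono)
    fix u
    show "(weight q b u * indicator {t<..} u) * epowr (\<omega> t) q \<le> epowr (ennreal (u powr (- 1 / q) * b u) * \<omega> u) q * indicator {0<..} u"
    proof (cases "t < u")
      case True
      then have u: "0 < u" using t by simp
      have "\<omega> t \<le> \<omega> u" using \<omega> t u True by (auto simp: monotone_on_def)
      then have "epowr (\<omega> t) q \<le> epowr (\<omega> u) q" using q by (intro epowr_mono) auto
      then have "weight q b u * epowr (\<omega> t) q \<le> weight q b u * epowr (\<omega> u) q" by (rule mult_left_mono) simp
      also have "\<dots> = epowr (ennreal (u powr (- 1 / q) * b u) * \<omega> u) q"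
        using q epowr_weight[of q u b] SV0_pos[OF b q u] u by (simp add: epowr_mult)
      finally show ?thesis using True u by simp
    qed simp
  qed
  also have "\<dots> = epowr (Lq_norm q {0<..} (\<lambda>u. ennreal (u powr (- 1 / q) * b u) * \<omega> u)) q"
    using q by (simp add: epowr_Lq_norm)
  finally show ?thesis using q by (simp add: epowr_le_iff)
qed

lemma ri_bfs_add:
  fixes f g :: "real ^ 'n \<Rightarrow> 's::{real_normed_field, euclidean_space}"
  assumes E: "ri_bfs E" and f: "f \<in> fst E" and g: "g \<in> fst E"
  shows "(\<lambda>x. f x + g x) \<in> fst E"
    and "modulus E (\<lambda>x. f x + g x) u \<le> modulus E f u + modulus E g u"
proof -
  obtain N where N: "ri_norm lebesgue N" and EN: "E = bfs lebesgue N" using E by (auto simp: ri_bfs_def)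
  have fE: "g \<in> fst E \<longleftrightarrow> g \<in> borel_measurable lebesgue \<and> nrm N g < top" for g :: "real ^ 'n \<Rightarrow> 's"
    by (simp add: EN bfs_def nrm_def[OF N])
  have m: "f \<in> borel_measurable lebesgue" "g \<in> borel_measurable lebesgue" "nrm N f + nrm N g < top"
    using f g by (auto simp: fE)
  show "(\<lambda>x. f x + g x) \<in> fst E"
    unfolding fE using m(1,2) le_less_trans[OF nrm_le_add[OF N _ m(1,2) norm_triangle_ineq] m(3)] by simp
  show "modulus E (\<lambda>x. f x + g x) u \<le> modulus E f u + modulus E g u"
    unfolding EN using m norm_triangle_ineq
    by (intro modulus_le_add[OF N]) (auto simp: add_diff_add)
qed

context limiting_weights
begin

text \<open>
  Both summands of a decomposition are controlled by the tails of their Besov quasi-norms, where the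
  moduli are at least their values at \<open>t\<close>; the factor \<open>\<rho> t\<close> is exactly what turns \<open>T1 t\<close> into \<open>T0 t\<close>.
\<close>
lemma K_lower:
  fixes f :: "real ^ 'n \<Rightarrow> 's::{real_normed_field, euclidean_space}"
  assumes E: "ri_bfs E" and t: "0 < t"
  shows "ennreal (T0 t) * modulus E f t \<le> K_functional (besov E q0 b0) (besov E q1 b1) (\<rho> t) f"
  unfolding K_functional_def
proof (rule Inf_greatest, clarify)
  fix f0 f1 :: "real ^ 'n \<Rightarrow> 's"
  assume f01: "f0 \<in> fst (besov E q0 b0)" "f1 \<in> fst (besov E q1 b1)"
  have "modulus E (\<lambda>x. f0 x + f1 x) t \<le> modulus E f0 t + modulus E f1 t"
    using f01 by (intro ri_bfs_add(2) E) (auto simp: besov_def)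
  then have "ennreal (T0 t) * modulus E (\<lambda>x. f0 x + f1 x) t \<le> ennreal (T0 t) * (modulus E f0 t + modulus E f1 t)"
    by (rule mult_left_mono) simp
  also have "\<dots> = ennreal (T0 t) * modulus E f0 t + ennreal (\<rho> t) * (ennreal (T1 t) * modulus E f1 t)"
    using rho_pos[OF t] by (simp add: distrib_left T0_eq[OF t] ennreal_mult' mult.assoc)
  also have "\<dots> \<le> snd (besov E q0 b0) f0 + ennreal (\<rho> t) * snd (besov E q1 b1) f1"
    unfolding besov_def besov_norm_def snd_conv
    by (intro add_mono mult_left_mono tail_times_le_Lq_norm weights exponents modulus_mono_on t) simp
  finally show "ennreal (T0 t) * modulus E (\<lambda>x. f0 x + f1 x) t \<le> snd (besov E q0 b0) f0 + ennreal (\<rho> t) * snd (besov E q1 b1) f1" .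
qed

abbreviation low_part :: "(real \<Rightarrow> ennreal) \<Rightarrow> int \<Rightarrow> ennreal" where
  "low_part \<omega> k \<equiv> epowr (\<Sum>\<^sup>+ i. epowr (coeff \<omega> (k - int i)) q0) (1 / q0)"

abbreviation high_part :: "(real \<Rightarrow> ennreal) \<Rightarrow> int \<Rightarrow> ennreal" where
  "high_part \<omega> k \<equiv>
    epowr (\<Sum>\<^sup>+ i. epowr (ennreal (2 powr (- real_of_int (k + int i))) * coeff \<omega> (k + int i)) q1) (1 / q1)"

abbreviation besov_K ::
  "(real ^ 'n, 's::{real_normed_field, euclidean_space}) qspace \<Rightarrow> real \<Rightarrow> (real ^ 'n \<Rightarrow> 's) \<Rightarrow> ennreal" where
  "besov_K E \<equiv> K_functional (besov E q0 b0) (besov E q1 b1)"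

text \<open>
  Half of a Holmstedt formula, obtained from the decomposition of \<open>f\<close> at scale \<open>node k\<close>. If one of its
  parts has infinite Besov quasi-norm then the right-hand side is infinite.
\<close>
lemma K_upper:
  fixes E :: "(real ^ 'n, 's::{real_normed_field, euclidean_space}) qspace"
  assumes E: "ri_bfs E"
  shows "\<exists>C>0. \<forall>f\<in>fst E. \<forall>k. besov_K E (2 powr real_of_int k) f
    \<le> ennreal C * (low_part (modulus E f) k
        + ennreal (2 powr real_of_int k) *
          high_part (modulus E f) k)"
proof -
  define M where "M = 4 * (real CARD('n))\<^sup>2"
  obtain C0 where C0: "C0 > 0" "\<And>\<omega> w k. mono_on {0<..} \<omega> \<Longrightarrow> (\<forall>u>0. w u \<le> 2 * \<omega> (min u (node k))) \<Longrightarrow>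
     (\<integral>\<^sup>+ u\<in>{0<..}. epowr (ennreal (u powr (- 1 / q0) * b0 u) * w u) q0 \<partial>lebesgue)
      \<le> ennreal C0 * (\<Sum>\<^sup>+ i. epowr (coeff \<omega> (k - int i)) q0)"
    using besov_low by blast
  obtain C1 where C1: "C1 > 0" "\<And>\<omega> w k. mono_on {0<..} \<omega> \<Longrightarrow> (\<forall>u>0. w u \<le> \<omega> u) \<Longrightarrow>
     (\<forall>u. 0 < u \<longrightarrow> u \<le> node k \<longrightarrow> w u \<le> ennreal (M * (u / node k)) * \<omega> (node k)) \<Longrightarrow>
     (\<integral>\<^sup>+ u\<in>{0<..}. epowr (ennreal (u powr (- 1 / q1) * b1 u) * w u) q1 \<partial>lebesgue)
      \<le> ennreal C1 * (\<Sum>\<^sup>+ i. epowr (ennreal (T1 (node (k + int i))) * \<omega> (node (k + int i))) q1)"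
    using besov_high[of M] by blast
  define C where "C = C0 powr (1 / q0) + C1 powr (1 / q1)"
  show ?thesis
  proof (intro exI[of _ C] conjI ballI allI)
    show "0 < C" using C0(1) C1(1) by (simp add: C_def add_pos_pos)
    fix f and k :: int assume f: "f \<in> fst E"
    let ?w = "modulus E f"
    let ?A = "\<Sum>\<^sup>+ i. epowr (coeff ?w (k - int i)) q0"
    let ?B = "\<Sum>\<^sup>+ i. epowr (ennreal (2 powr (- real_of_int (k + int i))) * coeff ?w (k + int i)) q1"
    obtain f0 f1 where d: "f0 \<in> fst E" "f1 \<in> fst E" "f = (\<lambda>x. f0 x + f1 x)"
      "\<And>u. 0 < u \<Longrightarrow> modulus E f0 u \<le> 2 * ?w (min u (node k))"
      "\<And>u. 0 < u \<Longrightarrow> modulus E f1 u \<le> ?w u"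
      "\<And>u. 0 < u \<Longrightarrow> u \<le> node k \<Longrightarrow> modulus E f1 u \<le> ennreal (M * (u / node k)) * ?w (node k)"
      by (rule smoothing_decomposition[OF E f node_pos[of k], folded M_def]) blast
    have low: "besov_norm E q0 b0 f0 \<le> ennreal (C0 powr (1 / q0)) * epowr ?A (1 / q0)"
    proof -
      have "besov_norm E q0 b0 f0 \<le> epowr (ennreal C0 * ?A) (1 / q0)"
        unfolding besov_norm_def Lq_norm_def using d(4) exponents
        by (intro epowr_mono C0(2) modulus_mono_on) auto
      then show ?thesis using exponents C0(1) by (simp add: epowr_mult epowr_ennreal)
    qed
    have high: "besov_norm E q1 b1 f1 \<le> ennreal (C1 powr (1 / q1)) * epowr ?B (1 / q1)"
    proof -
      have "ennreal (T1 (node j)) * ?w (node j) = ennreal (2 powr (- real_of_int j)) * coeff ?w j" for j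
        by (simp add: T1_node ennreal_mult' mult.assoc)
      then have "besov_norm E q1 b1 f1 \<le> epowr (ennreal C1 * ?B) (1 / q1)"
        using C1(2)[of ?w "modulus E f1" k] d(5,6) exponents
        unfolding besov_norm_def Lq_norm_def
        by (intro epowr_mono) (auto simp: modulus_mono_on)
      then show ?thesis using exponents C1(1) by (simp add: epowr_mult epowr_ennreal)
    qed
    have K: "besov_K E (2 powr real_of_int k) f
      \<le> besov_norm E q0 b0 f0 + ennreal (2 powr real_of_int k) * besov_norm E q1 b1 f1"
    proof (cases "besov_norm E q0 b0 f0 < top \<and> besov_norm E q1 b1 f1 < top")
      case True
      show ?thesis
        unfolding K_functional_def using True d(1-3) by (intro Inf_lower) (auto simp: besov_def)
    next
      case False
      then have "besov_norm E q0 b0 f0 + ennreal (2 powr real_of_int k) * besov_norm E q1 b1 f1 = top"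
        by (auto simp: less_top[symmetric] ennreal_mult_top)
      then show ?thesis by (simp only: top_greatest)
    qed
    also have "\<dots> \<le> ennreal C * epowr ?A (1 / q0) + ennreal (2 powr real_of_int k) * (ennreal C * epowr ?B (1 / q1))"
    proof (intro add_mono mult_left_mono)
      show "besov_norm E q0 b0 f0 \<le> ennreal C * epowr ?A (1 / q0)"
        by (rule order_trans[OF low]) (intro mult_right_mono ennreal_leI, auto simp: C_def)
      show "besov_norm E q1 b1 f1 \<le> ennreal C * epowr ?B (1 / q1)"
        by (rule order_trans[OF high]) (intro mult_right_mono ennreal_leI, auto simp: C_def)
    qed simp
    also have "\<dots> = ennreal C * (epowr ?A (1 / q0) + ennreal (2 powr real_of_int k) * epowr ?B (1 / q1))"
      by (simp add: distrib_left mult_ac)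
    finally show "besov_K E (2 powr real_of_int k) f \<le> \<dots>" .
  qed
qed

text \<open>
  Both sums in \<open>K_upper\<close> are absorbed by Hardy's inequality: \<open>W\<close> grows geometrically towards
  smaller indices, and \<open>2 powr k * W k\<close> towards larger ones, because \<open>0 < \<theta> < 1\<close>.
\<close>
lemma sum_K_le:
  fixes E :: "(real ^ 'n, 's::{real_normed_field, euclidean_space}) qspace"
  assumes E: "ri_bfs E"
  shows "\<exists>C>0. \<forall>f\<in>fst E.
    (\<Sum>\<^sup>+ k. epowr (ennreal (W k) * besov_K E (2 powr real_of_int k) f) q)
    \<le> ennreal C * (\<Sum>\<^sup>+ k. epowr (ennreal (W k) * coeff (modulus E f) k) q)"
proof -
  obtain C where C: "C > 0" "\<And>f k. f \<in> fst E \<Longrightarrow> besov_K E (2 powr real_of_int k) f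
    \<le> ennreal C * (low_part (modulus E f) k
        + ennreal (2 powr real_of_int k) *
          high_part (modulus E f) k)"
    using K_upper[OF E] by blast
  obtain c where c: "c > 0" "\<And>k i. W k \<le> c * (2 powr (- (\<theta> / 2))) ^ i * W (k - int i)"
    using W_decay(1) by blast
  obtain c' where c': "c' > 0" "\<And>k i. 2 powr real_of_int k * W k
      \<le> c' * (2 powr (- ((1 - \<theta>) / 2))) ^ i * (2 powr real_of_int (k + int i) * W (k + int i))"
    using W_decay(2) by blast
  have lt1: "2 powr (- (\<theta> / 2)) < (1::real)" "2 powr (- ((1 - \<theta>) / 2)) < (1::real)"
    using theta powr_less_mono[of "- (\<theta> / 2)" 0 2] powr_less_mono[of "- ((1 - \<theta>) / 2)" 0 2] by auto
  have bij1: "bij (\<lambda>k. k - int i)" for i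
    by (rule bij_betw_byWitness[where f'="\<lambda>k. k + int i"]) auto
  have bij2: "bij (\<lambda>k. k + int i)" for i
    by (rule bij_betw_byWitness[where f'="\<lambda>k. k - int i"]) auto
  have W1: "ennreal (W k) \<le> ennreal (c * (2 powr (- (\<theta> / 2))) ^ i) * ennreal (W (k - int i))" for k i
    using c(1) c(2)[of k i] W_pos by (subst ennreal_mult'[symmetric]) (auto intro: ennreal_leI)
  have W2: "ennreal (2 powr real_of_int k * W k) \<le> ennreal (c' * (2 powr (- ((1 - \<theta>) / 2))) ^ i) * ennreal (2 powr real_of_int (k + int i) * W (k + int i))" for k i
    using c'(1) c'(2)[of k i] W_pos by (subst ennreal_mult'[symmetric]) (auto intro: ennreal_leI)
  obtain H1 where H1: "H1 > 0" "\<And>a. (\<Sum>\<^sup>+ k. epowr (ennreal (W k) * epowr (\<Sum>\<^sup>+ i. epowr (a (k - int i)) q0) (1 / q0)) q)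
       \<le> ennreal H1 * (\<Sum>\<^sup>+ k. epowr (ennreal (W k) * a k) q)"
    using weighted_hardy[of "2 powr (- (\<theta> / 2))" q q0 c "\<lambda>i k. k - int i" "\<lambda>k. ennreal (W k)"]
      lt1 exponents c(1) bij1 W1 by auto
  obtain H2 where H2: "H2 > 0" "\<And>a. (\<Sum>\<^sup>+ k. epowr (ennreal (2 powr real_of_int k * W k) * epowr (\<Sum>\<^sup>+ i. epowr (a (k + int i)) q1) (1 / q1)) q)
       \<le> ennreal H2 * (\<Sum>\<^sup>+ k. epowr (ennreal (2 powr real_of_int k * W k) * a k) q)"
    using weighted_hardy[of "2 powr (- ((1 - \<theta>) / 2))" q q1 c' "\<lambda>i k. k + int i" "\<lambda>k. ennreal (2 powr real_of_int k * W k)"]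
      lt1 exponents c'(1) bij2 W2 by auto
  define R where "R = C powr q * 2 powr q * (H1 + H2)"
  show ?thesis
  proof (intro exI[of _ R] conjI ballI)
    show "0 < R" using C(1) H1(1) H2(1) by (simp add: R_def)
    fix f assume f: "f \<in> fst E"
    define a where "a = coeff (modulus E f)"
    define a' where "a' k = ennreal (2 powr (- real_of_int k)) * a k" for k
    define X where "X k = ennreal (W k) * epowr (\<Sum>\<^sup>+ i. epowr (a (k - int i)) q0) (1 / q0)" for k
    define Y where "Y k = ennreal (2 powr real_of_int k * W k) * epowr (\<Sum>\<^sup>+ i. epowr (a' (k + int i)) q1) (1 / q1)" for k
    let ?S = "\<Sum>\<^sup>+ k. epowr (ennreal (W k) * a k) q"
    have point: "epowr (ennreal (W k) * besov_K E (2 powr real_of_int k) f) q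
      \<le> ennreal (C powr q * 2 powr q) * (epowr (X k) q + epowr (Y k) q)" for k
    proof -
      have "ennreal (W k) * besov_K E (2 powr real_of_int k) f
        \<le> ennreal (W k) * (ennreal C * (epowr (\<Sum>\<^sup>+ i. epowr (a (k - int i)) q0) (1 / q0)
        + ennreal (2 powr real_of_int k) * epowr (\<Sum>\<^sup>+ i. epowr (a' (k + int i)) q1) (1 / q1)))"
        unfolding a_def a'_def by (intro mult_left_mono C(2) f) simp
      also have "\<dots> = ennreal C * (X k + Y k)"
        unfolding X_def Y_def using W_pos[of k] by (simp add: distrib_left ennreal_mult less_imp_le mult_ac)
      finally have "epowr (ennreal (W k) * besov_K E (2 powr real_of_int k) f) q
        \<le> epowr (ennreal C * (X k + Y k)) q"
        using exponents by (intro epowr_mono) auto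
      also have "\<dots> = ennreal (C powr q) * epowr (X k + Y k) q"
        using exponents C(1) by (simp add: epowr_mult epowr_ennreal)
      also have "\<dots> \<le> ennreal (C powr q) * (ennreal (2 powr q) * (epowr (X k) q + epowr (Y k) q))"
        using exponents by (intro mult_left_mono epowr_add_le) auto
      also have "\<dots> = ennreal (C powr q * 2 powr q) * (epowr (X k) q + epowr (Y k) q)"
        by (simp only: mult.assoc ennreal_mult'[OF powr_ge_zero])
      finally show ?thesis .
    qed
    have "(\<Sum>\<^sup>+ k. epowr (ennreal (W k) * besov_K E (2 powr real_of_int k) f) q)
      \<le> (\<Sum>\<^sup>+ k. ennreal (C powr q * 2 powr q) * (epowr (X k) q + epowr (Y k) q))"
      by (intro nn_integral_mono point)
    also have "\<dots> = ennreal (C powr q * 2 powr q) * ((\<Sum>\<^sup>+ k. epowr (X k) q) + (\<Sum>\<^sup>+ k. epowr (Y k) q))"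
      by (simp add: nn_integral_cmult nn_integral_add)
    also have "\<dots> \<le> ennreal (C powr q * 2 powr q) * (ennreal H1 * ?S + ennreal H2 * ?S)"
    proof (intro mult_left_mono add_mono)
      show "(\<Sum>\<^sup>+ k. epowr (X k) q) \<le> ennreal H1 * ?S"
        unfolding X_def by (rule H1(2))
      have "ennreal (2 powr real_of_int k * W k) * a' k = ennreal (W k) * a k" for k
      proof -
        have "ennreal (2 powr real_of_int k * W k) * ennreal (2 powr (- real_of_int k)) = ennreal (W k)"
          using W_pos[of k] by (subst ennreal_mult'[symmetric]) (auto simp: powr_minus field_simps)
        then show ?thesis unfolding a'_def by (simp only: mult.assoc[symmetric])
      qed
      then show "(\<Sum>\<^sup>+ k. epowr (Y k) q) \<le> ennreal H2 * ?S"
        unfolding Y_def using H2(2)[of a'] by simp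
    qed simp
    also have "\<dots> = ennreal R * ?S"
      using H1(1) H2(1) C(1) by (simp add: R_def ennreal_mult' distrib_right mult.assoc)
    finally show "(\<Sum>\<^sup>+ k. epowr (ennreal (W k) * besov_K E (2 powr real_of_int k) f) q)
      \<le> ennreal R * (\<Sum>\<^sup>+ k. epowr (ennreal (W k) * coeff (modulus E f) k) q)"
      unfolding a_def .
  qed
qed

lemma Lq_norm_le_of_powers:
  assumes "epowr x q \<le> ennreal C * epowr y q" "0 < C"
  shows "x \<le> ennreal (C powr (1 / q)) * y"
proof -
  have "epowr (ennreal (C powr (1 / q)) * y) q = ennreal C * epowr y q"
    using exponents assms(2) by (simp add: epowr_mult epowr_ennreal powr_powr)
  then show ?thesis using assms(1) exponents by (simp flip: epowr_le_iff[of q x])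
qed

text \<open>
  The equality of the carriers also comes out of the inequalities: a finite interpolation quasi-norm
  makes the K-functional finite, and a finite value of it is witnessed by a decomposition.
\<close>
proposition interpolation_besov:
  fixes E :: "(real ^ 'n, 's::{real_normed_field, euclidean_space}) qspace"
  assumes E: "ri_bfs E"
  shows "same_space (interp (besov E q0 b0) (besov E q1 b1) \<theta> q b) (besov E q bt)"
proof -
  let ?K = "\<lambda>f t. besov_K E t f"
  let ?I = "interp_norm (besov E q0 b0) (besov E q1 b1) \<theta> q b"
  let ?B = "besov_norm E q bt"
  let ?SK = "\<lambda>f. \<Sum>\<^sup>+ k. epowr (ennreal (W k) * ?K f (2 powr real_of_int k)) q"
  let ?SB = "\<lambda>f. \<Sum>\<^sup>+ k. epowr (ennreal (W k) * coeff (modulus E f) k) q"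
  obtain C1 where C1: "C1 > 0" "\<And>f. epowr (?I f) q \<le> ennreal C1 * ?SK f" "\<And>f. ?SK f \<le> ennreal C1 * epowr (?I f) q"
  proof -
    obtain C where "C > 0" and C: "\<And>K. mono_on {0<..} K \<Longrightarrow>
     comparable C (\<integral>\<^sup>+ s\<in>{0<..}. epowr (ennreal (s powr (- \<theta> - 1 / q) * b s) * K s) q \<partial>lebesgue)
       (\<Sum>\<^sup>+ k. epowr (ennreal (W k) * K (2 powr real_of_int k)) q)"
      using interp_discrete by blast
    from that[OF \<open>C > 0\<close>] C[OF K_functional_mono_on] show thesis
      unfolding interp_norm_def epowr_Lq_norm[OF exponents(3)] by blast
  qed
  obtain C2 where C2: "C2 > 0" "\<And>f. epowr (?B f) q \<le> ennreal C2 * ?SB f" "\<And>f. ?SB f \<le> ennreal C2 * epowr (?B f) q"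
  proof -
    obtain C where "C > 0" and C: "\<And>\<omega>. mono_on {0<..} \<omega> \<Longrightarrow>
     comparable C (\<integral>\<^sup>+ t\<in>{0<..}. epowr (ennreal (t powr (- 1 / q) * bt t) * \<omega> t) q \<partial>lebesgue)
       (\<Sum>\<^sup>+ k. epowr (ennreal (W k) * coeff \<omega> k) q)"
      using besov_discrete by blast
    from that[OF \<open>C > 0\<close>] C[OF modulus_mono_on] show thesis
      unfolding besov_norm_def epowr_Lq_norm[OF exponents(3)] by blast
  qed
  obtain C3 where C3: "C3 > 0" "\<And>f. f \<in> fst E \<Longrightarrow> ?SK f \<le> ennreal C3 * ?SB f"
    using sum_K_le[OF E] by blast
  have SBK: "?SB f \<le> ?SK f" for f
    using K_lower[OF E node_pos, where f=f] exponents
    by (intro nn_integral_mono epowr_mono mult_left_mono) (auto simp: rho_node)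
  define c where "c = C1 * C3 * C2"
  define d where "d = C2 * C1"
  have cd: "0 < c" "0 < d" using C1 C2 C3 by (auto simp: c_def d_def)
  have IB: "?I f \<le> ennreal (c powr (1 / q)) * ?B f" if f: "f \<in> fst E" for f
  proof (rule Lq_norm_le_of_powers)
    have "epowr (?I f) q \<le> ennreal C1 * ?SK f" by (rule C1(2))
    also have "\<dots> \<le> ennreal C1 * (ennreal C3 * ?SB f)" by (intro mult_left_mono C3(2) f) simp
    also have "\<dots> \<le> ennreal C1 * (ennreal C3 * (ennreal C2 * epowr (?B f) q))"
      by (intro mult_left_mono C2(3)) auto
    also have "\<dots> = ennreal c * epowr (?B f) q"
      using C1(1) C2(1) C3(1) by (simp add: c_def ennreal_mult' mult.assoc)
    finally show "epowr (?I f) q \<le> ennreal c * epowr (?B f) q" .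
  qed (rule cd)
  have BI: "?B f \<le> ennreal (d powr (1 / q)) * ?I f" for f
  proof (rule Lq_norm_le_of_powers)
    have "epowr (?B f) q \<le> ennreal C2 * ?SB f" by (rule C2(2))
    also have "\<dots> \<le> ennreal C2 * ?SK f" by (intro mult_left_mono SBK) simp
    also have "\<dots> \<le> ennreal C2 * (ennreal C1 * epowr (?I f) q)" by (intro mult_left_mono C1(3)) simp
    also have "\<dots> = ennreal d * epowr (?I f) q"
      using C1(1) C2(1) by (simp add: d_def ennreal_mult' mult.assoc)
    finally show "epowr (?B f) q \<le> ennreal d * epowr (?I f) q" .
  qed (rule cd)
  have sumE: "f \<in> fst E" if "f \<in> sum_space (fst (besov E q0 b0)) (fst (besov E q1 b1))" for f
    using that ri_bfs_add(1)[OF E] by (auto simp: sum_space_def besov_def)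
  have carrier: "fst (interp (besov E q0 b0) (besov E q1 b1) \<theta> q b) = fst (besov E q bt)"
  proof (intro set_eqI iffI)
    fix f assume "f \<in> fst (interp (besov E q0 b0) (besov E q1 b1) \<theta> q b)"
    then have f: "f \<in> sum_space (fst (besov E q0 b0)) (fst (besov E q1 b1))" "?I f < top"
      by (auto simp: interp_def)
    have "?B f < top" using BI[of f] f(2) by (simp add: ennreal_mult_less_top le_less_trans)
    then show "f \<in> fst (besov E q bt)" using sumE[OF f(1)] by (simp add: besov_def)
  next
    fix f assume "f \<in> fst (besov E q bt)"
    then have f: "f \<in> fst E" "?B f < top" by (auto simp: besov_def)
    have I: "?I f < top" using IB[OF f(1)] f(2) by (simp add: ennreal_mult_less_top le_less_trans)
    have "epowr (ennreal (W 0) * ?K f (2 powr real_of_int 0)) q \<le> ?SK f"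
      by (rule nn_integral_count_space_ge) simp
    also have "\<dots> \<le> ennreal C1 * epowr (?I f) q" by (rule C1(3))
    also have "\<dots> < top" using I by (simp add: ennreal_mult_less_top)
    finally have "?K f (2 powr real_of_int 0) \<noteq> top"
      using W_pos[of 0] by (auto simp: ennreal_mult_top)
    then have "{snd (besov E q0 b0) f0 + ennreal (2 powr real_of_int 0) * snd (besov E q1 b1) f1 | f0 f1.
            f0 \<in> fst (besov E q0 b0) \<and> f1 \<in> fst (besov E q1 b1) \<and> f = (\<lambda>x. f0 x + f1 x)} \<noteq> {}"
      unfolding K_functional_def by (metis (lifting) Inf_empty)
    then have "f \<in> sum_space (fst (besov E q0 b0)) (fst (besov E q1 b1))"
      by (auto simp: sum_space_def)
    then show "f \<in> fst (interp (besov E q0 b0) (besov E q1 b1) \<theta> q b)"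
      using I by (simp add: interp_def)
  qed
  show ?thesis
    unfolding same_space_def
  proof (intro conjI exI ballI)
    show "fst (interp (besov E q0 b0) (besov E q1 b1) \<theta> q b) = fst (besov E q bt)" by (rule carrier)
    show "0 < c powr (1 / q)" "0 < d powr (1 / q)" using cd by auto
    fix f assume "f \<in> fst (interp (besov E q0 b0) (besov E q1 b1) \<theta> q b)"
    then have "f \<in> fst E" unfolding carrier by (simp add: besov_def)
    then show "snd (interp (besov E q0 b0) (besov E q1 b1) \<theta> q b) f \<le> ennreal (c powr (1 / q)) * snd (besov E q bt) f"
      using IB by (simp add: interp_def besov_def)
    show "snd (besov E q bt) f \<le> ennreal (d powr (1 / q)) * snd (interp (besov E q0 b0) (besov E q1 b1) \<theta> q b) f"
      using BI by (simp add: interp_def besov_def)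
  qed
qed

end

theorem theorem5p8:
  fixes E :: "(real ^ 'n, 's::{real_normed_field, euclidean_space}) qspace"
    and q0 q1 q \<theta> :: real
    and b0 b1 b \<rho> :: "real \<Rightarrow> real"
    and \<rho>\<epsilon> :: "real \<Rightarrow> real \<Rightarrow> real"
    and bt :: "real \<Rightarrow> real"
  assumes E: "ri_bfs E"
    and exponents: "0 < q0" "0 < q1" "q0 \<noteq> q1" "0 < q"
    and theta: "0 < \<theta>" "\<theta> < 1"
    and weights: "b0 \<in> SV0 q0" "b1 \<in> SV0 q1" "b \<in> SV"
    and rho_def: "\<And>t. t > 0 \<Longrightarrow>
      \<rho> t = enn2real (tail_norm q0 b0 t) / enn2real (tail_norm q1 b1 t)"
    and rho_eps_def: "\<And>\<epsilon> t. \<epsilon> > 0 \<Longrightarrow> t > 0 \<Longrightarrow>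
      \<rho>\<epsilon> \<epsilon> t = enn2real (tail_norm q0 b0 t) powr (1 + \<epsilon>) / enn2real (tail_norm q1 b1 t)"
    and rho_eps: "\<exists>\<epsilon>>0. \<exists>g. mono_on {0<..} g \<and> equiv_pos (\<rho>\<epsilon> \<epsilon>) g"
    and rho_mono: "strict_mono_on {0<..} \<rho>"
    and rho_0: "(\<rho> \<longlongrightarrow> 0) (at_right 0)"
    and rho_top: "filterlim \<rho> at_top at_top"
    and bt_def: "\<And>t. t > 0 \<Longrightarrow>
      bt t = \<rho> t powr (1 - \<theta>) * b (\<rho> t) * b1 t powr (q1 / q) *
             (LINT u:{t<..}|lebesgue. b1 u powr q1 / u) powr (1 / q1 - 1 / q)"
  shows "same_space (interp (besov E q0 b0) (besov E q1 b1) \<theta> q b) (besov E q bt)"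
proof -
  obtain \<epsilon> g where \<epsilon>: "0 < \<epsilon>" and g: "mono_on {0<..} g" "equiv_pos (\<rho>\<epsilon> \<epsilon>) g" using rho_eps by blast
  have "equiv_pos (\<lambda>t. tail q0 b0 t powr (1 + \<epsilon>) / tail q1 b1 t) g"
    using g(2) rho_eps_def[OF \<epsilon>] by (simp add: equiv_pos_def tail_def)
  then have "\<exists>\<epsilon>>0. \<exists>g. mono_on {0<..} g \<and> equiv_pos (\<lambda>t. tail q0 b0 t powr (1 + \<epsilon>) / tail q1 b1 t) g"
    using \<epsilon> g(1) by blast
  then interpret limiting_weights q0 q1 q \<theta> b0 b1 b \<rho> bt
    using exponents theta weights rho_def rho_mono rho_0 rho_top bt_def
    by unfold_locales (auto simp: tail_def)
  show ?thesis by (rule interpolation_besov[OF E])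
qed

end
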